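(* Let $n\ge 1$, $T>0$, and let $u_0:\mathbf{R}^n\to\mathbf{R}$ be Lipschitz continuous. Let $H_1:\mathbf{R}^n\times[0,T]\times\mathbf{R}^n\to\mathbf{R}$ be continuous and such that: $H_1(x,t,\lambda p)=\lambda H_1(x,t,p)$ for all $\lambda>0$ and all $(x,t,p)$; there is $L_1>0$ with $|H_1(x,t,p)-H_1(y,t,p)|\le L_1|x-y|$ for all $x,y\in\mathbf{R}^n$, $t\in[0,T]$, $|p|=1$; there is $L_2>0$ with $|H_1(x,t,p)-H_1(x,t,q)|\le L_2|p-q|$ for all $x,p,q\in\mathbf{R}^n$, $t\in[0,T]$; and $\sup\{|H_1(x,t,p)| : x\in\mathbf{R}^n,\ t\in[0,T],\ |p|=1\}<\infty$. Let $\beta:\mathbf{R}\to\mathbf{R}$ be Lipschitz continuous, non-decreasing and bounded, with $\beta(0)=0$, $\beta(r)>0$ for $r>0$ and $\beta(r)<0$ for $r<0$. Let $h:\mathbf{R}^n\to\mathbf{R}$ satisfy $|h(p)-h(q)|\le\omega_h(|p-q|)$ for all $p,q\in\mathbf{R}^n$ for some modulus $\omega_h$, and assume $h(p)>0$ if $|p|<1$ and $h(p)<0$ if $|p|>1$. Let $w$ be the viscosity solution of $w_t=H_1(x,t,\nabla w)$ in $\mathbf{R}^n\times(0,T)$, $w(\cdot,0)=u_0$, put $\Gamma_t=\{x: w(x,t)=0\}$, and assume $\Gamma_t\ne\emptyset$ for all $t\in[0,T)$. Let $d$ be the signed distance function, $d(x,t)=\mathrm{dist}(x,\Gamma_t)$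 if $w(x,t)\ge 0$ and $d(x,t)=-\mathrm{dist}(x,\Gamma_t)$ if $w(x,t)<0$. For $\theta>0$ let $u^\theta$ be the viscosity solution of $$u^\theta_t=H_1(x,t,\nabla u^\theta)+\theta\,\beta(u^\theta)\,h(\nabla u^\theta)\ \text{ in }\mathbf{R}^n\times(0,T),\qquad u^\theta(\cdot,0)=u_0.$$ Then: (i) for all $(x,t)\in\mathbf{R}^n\times(0,T)$, $$\lim_{\substack{(y,s,\theta)\to(x,t,\infty)\\ s\le t}}u^\theta(y,s)=d(x,t);$$ (ii) for every $t\in(0,T)$, $u^\theta(\cdot,t)$ converges to $d(\cdot,t)$ locally uniformly in $\mathbf{R}^n$ as $\theta\to+\infty$; (iii) if in addition $d$ is continuous in $\mathbf{R}^n\times(0,T)$, then $u^\theta$ converges to $d$ locally uniformly in $\mathbf{R}^n\times(0,T)$ as $\theta\to+\infty$.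
   Context: A modulus is a non-decreasing function $\omega:[0,\infty)\to[0,\infty)$ with $\omega(0)=0=\lim_{r\to0}\omega(r)$. $\mathrm{dist}(x,\Omega)=\inf_{y\in\Omega}|x-y|$. Viscosity solutions of $u_t=F(x,t,u,\nabla u)$ with $F$ continuous: $u$ is a subsolution if $\phi_t\le F(x_0,t_0,\phi,\nabla\phi)$ at $(x_0,t_0)$ whenever $\phi\in C^1$ touches the upper semicontinuous envelope $u^*$ from above at $(x_0,t_0)\in\mathbf{R}^n\times(0,T)$; a supersolution if $\phi_t\ge F$ whenever $\phi$ touches the lower semicontinuous envelope $u_*$ from below; a solution if both. "The viscosity solution" of an initial value problem here means the unique solution that is continuous on $\mathbf{R}^n\times[0,T)$, attains the initial datum, and satisfies $u_0(x)-Kt\le u(x,t)\le u_0(x)+Kt$ for some $K>0$ (depending on $\theta$). *)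

theory Defs
  imports "HOL-Analysis.Analysis"
begin

definition modulus :: "(real \<Rightarrow> real) \<Rightarrow> bool" where
  "modulus \<omega> \<longleftrightarrow>
     (\<forall>r\<ge>0. 0 \<le> \<omega> r) \<and> mono_on {0..} \<omega> \<and> \<omega> 0 = 0 \<and> (\<omega> \<longlongrightarrow> 0) (at_right 0)"

definition spacetime :: "real \<Rightarrow> ('a::euclidean_space \<times> real) set" where
  "spacetime T = UNIV \<times> {0<..<T}"

text \<open>
  The semicontinuous envelopes on \<open>Q\<close> are \<open>ereal\<close>-valued, as the function need not be locally
  bounded.  The filter is \<open>inf (nhds z) (principal Q)\<close> and not \<open>at z within Q\<close>, because the
  value at \<open>z\<close> itself has to be taken into account.
\<close>

definition usc_envelope :: "'b::topological_space set \<Rightarrow> ('b \<Rightarrow> real) \<Rightarrow> 'b \<Rightarrow> ereal" where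
  "usc_envelope Q u z = Limsup (inf (nhds z) (principal Q)) (\<lambda>y. ereal (u y))"

definition lsc_envelope :: "'b::topological_space set \<Rightarrow> ('b \<Rightarrow> real) \<Rightarrow> 'b \<Rightarrow> ereal" where
  "lsc_envelope Q u z = Liminf (inf (nhds z) (principal Q)) (\<lambda>y. ereal (u y))"

definition C1_with_gradient :: "'b::real_inner set \<Rightarrow> ('b \<Rightarrow> real) \<Rightarrow> ('b \<Rightarrow> 'b) \<Rightarrow> bool" where
  "C1_with_gradient Q \<phi> g \<longleftrightarrow> (\<forall>z\<in>Q. GDERIV \<phi> z :> g z) \<and> continuous_on Q g"

definition touches_above ::
    "'b::topological_space set \<Rightarrow> ('b \<Rightarrow> ereal) \<Rightarrow> ('b \<Rightarrow> real) \<Rightarrow> 'b \<Rightarrow> bool" where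
  "touches_above Q U \<phi> z \<longleftrightarrow>
     U z = ereal (\<phi> z) \<and> (\<forall>\<^sub>F y in inf (nhds z) (principal Q). U y \<le> ereal (\<phi> y))"

definition touches_below ::
    "'b::topological_space set \<Rightarrow> ('b \<Rightarrow> ereal) \<Rightarrow> ('b \<Rightarrow> real) \<Rightarrow> 'b \<Rightarrow> bool" where
  "touches_below Q U \<phi> z \<longleftrightarrow>
     U z = ereal (\<phi> z) \<and> (\<forall>\<^sub>F y in inf (nhds z) (principal Q). ereal (\<phi> y) \<le> U y)"

text \<open>
  Viscosity solutions of \<open>u\<^sub>t = F(x, t, u, \<nabla>u)\<close> on \<open>spacetime T\<close>.  If \<open>g\<close> is the space-time
  gradient of the test function, then \<open>fst (g (x, t))\<close> is its spatial gradient and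
  \<open>snd (g (x, t))\<close> its time derivative.
\<close>

definition viscosity_subsolution ::
    "('a \<Rightarrow> real \<Rightarrow> real \<Rightarrow> 'a \<Rightarrow> real) \<Rightarrow> real \<Rightarrow> ('a::euclidean_space \<Rightarrow> real \<Rightarrow> real) \<Rightarrow> bool" where
  "viscosity_subsolution F T u \<longleftrightarrow>
     (\<forall>\<phi> g x t. (x, t) \<in> spacetime T \<longrightarrow> C1_with_gradient (spacetime T) \<phi> g \<longrightarrow>
        touches_above (spacetime T) (usc_envelope (spacetime T) (\<lambda>(y, s). u y s)) \<phi> (x, t) \<longrightarrow>
        snd (g (x, t)) \<le> F x t (\<phi> (x, t)) (fst (g (x, t))))"

definition viscosity_supersolution ::
    "('a \<Rightarrow> real \<Rightarrow> real \<Rightarrow> 'a \<Rightarrow> real) \<Rightarrow> real \<Rightarrow> ('a::euclidean_space \<Rightarrow> real \<Rightarrow> real) \<Rightarrow> bool" where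
  "viscosity_supersolution F T u \<longleftrightarrow>
     (\<forall>\<phi> g x t. (x, t) \<in> spacetime T \<longrightarrow> C1_with_gradient (spacetime T) \<phi> g \<longrightarrow>
        touches_below (spacetime T) (lsc_envelope (spacetime T) (\<lambda>(y, s). u y s)) \<phi> (x, t) \<longrightarrow>
        snd (g (x, t)) \<ge> F x t (\<phi> (x, t)) (fst (g (x, t))))"

definition viscosity_solution ::
    "('a \<Rightarrow> real \<Rightarrow> real \<Rightarrow> 'a \<Rightarrow> real) \<Rightarrow> real \<Rightarrow> ('a::euclidean_space \<Rightarrow> real \<Rightarrow> real) \<Rightarrow> bool" where
  "viscosity_solution F T u \<longleftrightarrow> viscosity_subsolution F T u \<and> viscosity_supersolution F T u"

text \<open>
  The class of solutions of the initial value problem in which uniqueness holds.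
  Values of \<open>u\<close> at times outside \<open>[0, T)\<close> are irrelevant.
\<close>

definition viscosity_ivp_solution ::
    "('a \<Rightarrow> real \<Rightarrow> real \<Rightarrow> 'a \<Rightarrow> real) \<Rightarrow> real \<Rightarrow> ('a \<Rightarrow> real) \<Rightarrow>
     ('a::euclidean_space \<Rightarrow> real \<Rightarrow> real) \<Rightarrow> bool" where
  "viscosity_ivp_solution F T u\<^sub>0 u \<longleftrightarrow>
     viscosity_solution F T u \<and>
     continuous_on (UNIV \<times> {0..<T}) (\<lambda>(x, t). u x t) \<and>
     (\<forall>x. u x 0 = u\<^sub>0 x) \<and>
     (\<exists>K>0. \<forall>x. \<forall>t\<in>{0..<T}. u\<^sub>0 x - K * t \<le> u x t \<and> u x t \<le> u\<^sub>0 x + K * t)"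

definition zero_level :: "('a \<Rightarrow> real \<Rightarrow> real) \<Rightarrow> real \<Rightarrow> 'a set" where
  "zero_level w t = {x. w x t = 0}"

definition signed_distance :: "('a::metric_space \<Rightarrow> real \<Rightarrow> real) \<Rightarrow> 'a \<Rightarrow> real \<Rightarrow> real" where
  "signed_distance w x t =
     (if 0 \<le> w x t then infdist x (zero_level w t) else - infdist x (zero_level w t))"

text \<open>Locally uniform convergence on locally compact sets, i.e. uniform convergence on compact subsets.\<close>

definition locally_uniform_limit ::
    "'b::topological_space set \<Rightarrow> ('i \<Rightarrow> 'b \<Rightarrow> 'c::metric_space) \<Rightarrow> ('b \<Rightarrow> 'c) \<Rightarrow> 'i filter \<Rightarrow> bool" where
  "locally_uniform_limit S f l F \<longleftrightarrow> (\<forall>K. compact K \<longrightarrow> K \<subseteq> S \<longrightarrow> uniform_limit K f l F)"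

end

theory Submission
  imports Defs
begin

text \<open>
  Viscosity inequalities are used in the form of superdifferentials.  Doubling the variables shows
  that, uniformly in \<open>\<theta>\<close>, \<open>u\<^sup>\<theta>\<close> is Lipschitz in space, because \<open>\<beta>\<close> is monotone and \<open>h\<close> is negative
  at gradients longer than \<open>1\<close>.  Since the equation of \<open>w\<close> is geometric, \<open>- exp (- \<sigma> w) / \<sigma>\<close> is again
  a subsolution; comparing it with \<open>exp (- k t) u\<^sup>\<theta>\<close> on \<open>{u\<^sup>\<theta> < 0}\<close> shows that \<open>u\<^sup>\<theta> \<ge> 0\<close> wherever \<open>w \<ge> 0\<close>,
  and then \<open>u\<^sup>\<theta> \<ge> \<epsilon> w\<close> there with \<open>\<epsilon>\<close> independent of \<open>\<theta>\<close>.  Cones of slope slightly above and below \<open>1\<close>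
  are then barriers for large \<open>\<theta>\<close>: the first have their apex at a zero of \<open>w\<close>, the second are
  supported in a ball where \<open>w > 0\<close>.  By finite speed of propagation the zero set at time \<open>t\<close> is
  approximated by the zero sets at slightly earlier times, hence the restriction \<open>s \<le> t\<close>.
\<close>

subsection \<open>Superdifferentials and doubling of variables\<close>

text \<open>At slopes below 1 the source \<open>\<theta> * \<beta> r * h p\<close> is nondecreasing
  in \<open>r\<close>, so an ordinary comparison estimate would carry a factor growing exponentially
  in \<theta> and be void in the limit. The steps are therefore arranged so that the source has a
  favourable sign wherever it is tested: slopes above 1 in the Lipschitz bound, slopes at most 1 / 2
  in the bound from below by a multiple of \<open>w\<close>. Only the preservation of signs uses a
  factor depending on \<theta>, and there nothing but the sign is kept. The bound from below then
  holds \<open>\<beta> (u \<theta>)\<close> away from 0 on compact sets where \<open>w\<close> is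
  positive, which makes the source strong there. The restriction on \<open>s\<close> reflects an
  asymmetry in time. Positivity of \<open>w\<close> on a closed ball persists both before and after
  \<open>t\<close>. A zero of \<open>w\<close> has points with \<open>w \<le> 0\<close> nearby at
  slightly earlier times, but the zero set may disappear locally right after \<open>t\<close>;
  continuity of the distance excludes this. Replacing \<open>u\<close> by \<open>- u\<close> gives a
  problem of the same kind, so each estimate is proved on one side only.\<close>

definition supergrad :: "'b::real_inner set \<Rightarrow> ('b \<Rightarrow> real) \<Rightarrow> 'b \<Rightarrow> 'b \<Rightarrow> bool" where
  "supergrad S f z g \<longleftrightarrow> (\<exists>\<phi>. (\<phi> has_derivative (\<lambda>h. g \<bullet> h)) (at z within S) \<and> \<phi> z = f z \<and>
     (\<forall>\<^sub>F y in at z within S. f y \<le> \<phi> y))"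

text \<open>A test function for \<open>supergrad\<close> has to be differentiable only at the
  contact point, so it can be composed with increasing maps, and its set argument allows contact at
  past times only. \<open>D\<close> is a parameter because several inequalities hold, or are needed,
  only where a solution has a given sign.\<close>

definition jetsub :: "('a \<Rightarrow> real \<Rightarrow> real \<Rightarrow> 'a \<Rightarrow> real) \<Rightarrow> ('a::euclidean_space \<times> real) set \<Rightarrow>
    ('a \<times> real \<Rightarrow> real) \<Rightarrow> bool" where
  "jetsub F D U \<longleftrightarrow> (\<forall>x t p a. (x, t) \<in> D \<longrightarrow> supergrad UNIV U (x, t) (p, a) \<longrightarrow> a \<le> F x t (U (x, t)) p)"

lemma jetsubD: "jetsub F D U \<Longrightarrow> (x, t) \<in> D \<Longrightarrow> supergrad UNIV U (x, t) (p, a) \<Longrightarrow> a \<le> F x t (U (x, t)) p"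
  by (simp add: jetsub_def)

lemma supergrad_eps:
  assumes "supergrad S f z g" "e > 0"
  shows "\<exists>r>0. \<forall>y\<in>S. norm (y - z) < r \<longrightarrow> f y \<le> f z + g \<bullet> (y - z) + e * norm (y - z)"
proof -
  obtain \<phi> where d: "(\<phi> has_derivative (\<lambda>h. g \<bullet> h)) (at z within S)" and z: "\<phi> z = f z"
    and le: "\<forall>\<^sub>F y in at z within S. f y \<le> \<phi> y"
    using assms(1) by (auto simp: supergrad_def)
  obtain r1 where r1: "r1 > 0" "\<And>y. y \<in> S \<Longrightarrow> y \<noteq> z \<Longrightarrow> dist y z < r1 \<Longrightarrow> f y \<le> \<phi> y"
    using le by (auto simp: eventually_at)
  obtain r2 where r2: "r2 > 0"
    "\<And>y. y \<in> S \<Longrightarrow> norm (y - z) < r2 \<Longrightarrow> norm (\<phi> y - \<phi> z - g \<bullet> (y - z)) \<le> e * norm (y - z)"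
    using d[unfolded has_derivative_within_alt] assms(2) by blast
  show ?thesis
  proof (intro exI[of _ "min r1 r2"] conjI ballI impI)
    fix y assume y: "y \<in> S" "norm (y - z) < min r1 r2"
    show "f y \<le> f z + g \<bullet> (y - z) + e * norm (y - z)"
    proof (cases "y = z")
      case False
      then show ?thesis using r1(2)[of y] r2(2)[of y] y z by (auto simp: dist_norm abs_le_iff)
    qed simp
  qed (use r1 r2 in auto)
qed

lemma supergrad_cong:
  assumes "supergrad S f z g" "\<forall>\<^sub>F y in nhds z. f y = f' y"
  shows "supergrad S f' z g"
proof -
  obtain \<phi> where \<phi>: "(\<phi> has_derivative (\<lambda>h. g \<bullet> h)) (at z within S)" "\<phi> z = f z"
    and le: "\<forall>\<^sub>F y in at z within S. f y \<le> \<phi> y"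
    using assms(1) by (auto simp: supergrad_def)
  have "\<forall>\<^sub>F y in at z within S. f y = f' y"
    using assms(2) by (simp add: eventually_at_filter eventually_mono)
  with le have "\<forall>\<^sub>F y in at z within S. f' y \<le> \<phi> y" by eventually_elim simp
  with \<phi> eventually_nhds_x_imp_x[OF assms(2)] show ?thesis by (auto simp: supergrad_def)
qed

text \<open>Where \<open>f\<close> is at least \<open>c\<close>, the function \<open>g\<close> is
  positive and by compactness has a positive minimum; \<open>k\<close> only has to outweigh the
  excess of \<open>f\<close> there.\<close>

lemma penalty:
  fixes f g :: "'b::t2_space \<Rightarrow> real"
  assumes "compact S" "continuous_on S f" "continuous_on S g" "\<And>m. m \<in> S \<Longrightarrow> g m \<ge> 0"
    and "\<And>m. m \<in> S \<Longrightarrow> g m = 0 \<Longrightarrow> f m < c"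
  shows "\<exists>k>0. \<forall>m\<in>S. f m - k * g m < c"
proof (cases "{m\<in>S. c \<le> f m} = {}")
  case True
  then show ?thesis using assms(4) by (intro exI[of _ 1]) (force simp: not_le)
next
  case False
  let ?S = "{m\<in>S. c \<le> f m}"
  have "?S = S \<inter> f -` {c..}" by auto
  then have "closedin (top_of_set S) ?S"
    using continuous_closedin_preimage[OF assms(2), of "{c..}"] by simp
  then have cS: "compact ?S" using assms(1) closedin_compact by blast
  obtain m1 where m1: "m1 \<in> ?S" "\<And>m. m \<in> ?S \<Longrightarrow> g m1 \<le> g m"
    using continuous_attains_inf[OF cS False] continuous_on_subset[OF assms(3)] by (metis (no_types, lifting) mem_Collect_eq subsetI)
  obtain m2 where m2: "m2 \<in> ?S" "\<And>m. m \<in> ?S \<Longrightarrow> f m \<le> f m2"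
    using continuous_attains_sup[OF cS False] continuous_on_subset[OF assms(2)] by (metis (no_types, lifting) mem_Collect_eq subsetI)
  have g1: "g m1 > 0" using m1(1) assms(4,5)[of m1] by fastforce
  define k where "k = (f m2 - c) / g m1 + 1"
  have "f m2 \<ge> c" using m2 by auto
  then have k: "k > 0" using g1 by (simp add: k_def add_nonneg_pos)
  have "f m - k * g m < c" if "m \<in> S" for m
  proof (cases "c \<le> f m")
    case True
    have "f m - k * g m \<le> f m2 - k * g m1"
      using m1(2)[of m] m2(2)[of m] True that k by (smt (verit) mem_Collect_eq mult_left_mono)
    also have "\<dots> = c - g m1" using g1 by (simp add: k_def field_simps)
    finally show ?thesis using g1 by simp
  next
    case False then show ?thesis using assms(4)[OF that] k by (smt (verit) mult_nonneg_nonneg)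
  qed
  then show ?thesis using k by blast
qed

lemma max0_square_deriv: "((\<lambda>x::real. (max 0 x)\<^sup>2) has_real_derivative 2 * max 0 x) (at x)"
proof -
  consider "x < 0" | "x = 0" | "x > 0" by linarith
  then show ?thesis
  proof cases
    case 1
    have "((\<lambda>x::real. 0) has_real_derivative 2 * max 0 x) (at x)" using 1 by simp
    then show ?thesis
      by (rule has_field_derivative_transform_within_open[of _ _ _ "{..<0}"]) (use 1 in auto)
  next
    case 3
    have "((\<lambda>x::real. x\<^sup>2) has_real_derivative 2 * max 0 x) (at x)"
      using 3 by (auto intro!: derivative_eq_intros)
    then show ?thesis
      by (rule has_field_derivative_transform_within_open[of _ _ _ "{0<..}"]) (use 3 in auto)
  next
    case 2
    have "((\<lambda>h. (max 0 h)\<^sup>2 / h) \<longlongrightarrow> 0) (at (0::real))"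
    proof (rule tendsto_sandwich[where f = "\<lambda>h. - \<bar>h\<bar>" and h = "\<lambda>h. \<bar>h\<bar>"])
      show "\<forall>\<^sub>F h in at (0::real). - \<bar>h\<bar> \<le> (max 0 h)\<^sup>2 / h"
        by (auto intro!: always_eventually simp: max_def power2_eq_square)
      show "\<forall>\<^sub>F h in at (0::real). (max 0 h)\<^sup>2 / h \<le> \<bar>h\<bar>"
        by (auto intro!: always_eventually simp: max_def power2_eq_square)
      show "((\<lambda>h::real. - \<bar>h\<bar>) \<longlongrightarrow> 0) (at 0)" by (auto intro!: tendsto_eq_intros)
      show "((\<lambda>h::real. \<bar>h\<bar>) \<longlongrightarrow> 0) (at 0)" by (auto intro!: tendsto_eq_intros)
    qed
    then show ?thesis using 2 by (simp add: DERIV_def)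
  qed
qed

lemma penalized_test_derivative:
  fixes x p :: "'a::euclidean_space"
  assumes Q: "\<And>x. (Q has_real_derivative 2 * max 0 x) (at x)"
  shows "((\<lambda>z. u + p \<bullet> (fst z - x) + a * (snd z - t)
         + c * ((norm (fst z - x0))\<^sup>2 - (norm (x - x0))\<^sup>2 + (snd z - t0)\<^sup>2 - (t - t0)\<^sup>2)
         + k * (Q (snd z - t0) - Q (t - t0) + (snd z - s)\<^sup>2 - (t - s)\<^sup>2)) has_derivative
      (\<bullet>) (p + (2 * c) *\<^sub>R (x - x0), a + 2 * c * (t - t0) + 2 * k * max 0 (t - t0) + 2 * k * (t - s))) (at (x, t))"
proof -
  have 1: "((\<lambda>z::'a \<times> real. Q (snd z - t0)) has_derivative (\<lambda>h. 2 * max 0 (t - t0) * snd h)) (at (x, t))"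
    by (rule DERIV_compose_FDERIV[where f = Q, THEN has_derivative_eq_rhs, OF Q])
      (auto intro!: derivative_eq_intros)
  show ?thesis unfolding power2_norm_eq_inner
    by (rule has_derivative_eq_rhs, (rule derivative_eq_intros 1 refl)+)
      (auto simp: fun_eq_iff inner_commute algebra_simps inner_add_left inner_diff_left inner_diff_right)
qed

lemma quadratic_test_derivative:
  fixes y q :: "'a::euclidean_space"
  shows "((\<lambda>z. v + q \<bullet> (fst z - y) + c * ((norm (fst z - y0))\<^sup>2 - (norm (y - y0))\<^sup>2)
         + k * ((t - snd z)\<^sup>2 - (t - s)\<^sup>2)) has_derivative
      (\<bullet>) (q + (2 * c) *\<^sub>R (y - y0), - 2 * k * (t - s))) (at (y, s))"
  unfolding power2_norm_eq_inner
  by (rule has_derivative_eq_rhs, (rule derivative_eq_intros refl)+)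
    (auto simp: fun_eq_iff inner_commute algebra_simps inner_add_left inner_diff_left inner_diff_right)

text \<open>
  The times of \<open>U\<close> and \<open>V\<close> are doubled with the penalty \<open>k (t - s)\<^sup>2\<close>.  The extra penalty
  \<open>k (max 0 (t - t0))\<^sup>2\<close> makes a supergradient from the past sufficient, since its time derivative
  has the good sign; so terminal times need no special treatment below.
\<close>

lemma jetsub_add_supergrad:
  fixes U V :: "'a::euclidean_space \<times> real \<Rightarrow> real"
  assumes U: "jetsub F D U" "continuous_on D U" "open D" "(x0, t0) \<in> D"
    and V: "jetsub G E V" "continuous_on E V" "open E" "(y0, t0) \<in> E"
    and F: "continuous_on {(x, t, r, p). (x, t) \<in> D} (\<lambda>(x, t, r, p). F x t r p)"
    and G: "continuous_on {(x, t, r, p). (x, t) \<in> E} (\<lambda>(x, t, r, p). G x t r p)"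
    and j: "supergrad {m. snd (snd m) \<le> t0} (\<lambda>(x, y, t). U (x, t) + V (y, t)) (x0, y0, t0) (p, q, a)"
  shows "a \<le> F x0 t0 (U (x0, t0)) p + G y0 t0 (V (y0, t0)) q"
proof -
  \<comment> \<open>The inequality is first obtained at nearby points, with gradients and values
    disturbed by multiples of \<open>e\<close>; continuity of \<open>F\<close>, \<open>G\<close>,
    \<open>U\<close> and \<open>V\<close> then gives the claim in the limit.\<close>
  have step: "\<exists>x t y s p' q'. (x, t) \<in> D \<and> (y, s) \<in> E \<and> norm (x - x0) \<le> e \<and> \<bar>t - t0\<bar> \<le> e \<and>
     norm (y - y0) \<le> e \<and> \<bar>s - t0\<bar> \<le> e \<and> norm (p' - p) \<le> 8 * e \<and> norm (q' - q) \<le> 8 * e \<and>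
     a - 8 * e \<le> F x t (U (x, t)) p' + G y s (V (y, s)) q'" if e: "e > 0" for e
  proof -
    define c where "c = U (x0, t0) + V (y0, t0)"
    obtain r1 where r1: "r1 > 0" "\<And>x y t. t \<le> t0 \<Longrightarrow> norm (x - x0, y - y0, t - t0) < r1 \<Longrightarrow>
       U (x, t) + V (y, t) \<le> c + p \<bullet> (x - x0) + q \<bullet> (y - y0) + a * (t - t0) + e * norm (x - x0, y - y0, t - t0)"
      using supergrad_eps[OF j e] by (force simp: c_def)
    obtain A1 A2 where A: "open A1" "open A2" "x0 \<in> A1" "t0 \<in> A2" "A1 \<times> A2 \<subseteq> D"
      by (rule open_prod_elim[OF U(3,4)]) auto
    obtain B1 B2 where B: "open B1" "open B2" "y0 \<in> B1" "t0 \<in> B2" "B1 \<times> B2 \<subseteq> E"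
      by (rule open_prod_elim[OF V(3,4)]) auto
    obtain a1 where a1: "a1 > 0" "cball x0 a1 \<subseteq> A1" using A by (meson open_contains_cball)
    obtain a2 where a2: "a2 > 0" "cball t0 a2 \<subseteq> A2" using A by (meson open_contains_cball)
    obtain b1 where b1: "b1 > 0" "cball y0 b1 \<subseteq> B1" using B by (meson open_contains_cball)
    obtain b2 where b2: "b2 > 0" "cball t0 b2 \<subseteq> B2" using B by (meson open_contains_cball)
    define r where "r = Min {r1 / 4, a1, a2, b1, b2, e}"
    have r: "r > 0" "r \<le> r1 / 4" "r \<le> a1" "r \<le> a2" "r \<le> b1" "r \<le> b2" "r \<le> e"
      using r1 a1 a2 b1 b2 e by (auto simp: r_def)
    have inD: "(x, t) \<in> D" if "x \<in> cball x0 r" "t \<in> cball t0 r" for x t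
    proof -
      have "x \<in> cball x0 a1" "t \<in> cball t0 a2" using that r(3,4) by simp_all
      then show ?thesis using A(5) a1(2) a2(2) by blast
    qed
    have inE: "(x, t) \<in> E" if "x \<in> cball y0 r" "t \<in> cball t0 r" for x t
    proof -
      have "x \<in> cball y0 b1" "t \<in> cball t0 b2" using that r(5,6) by simp_all
      then show ?thesis using B(5) b1(2) b2(2) by blast
    qed
    define K where "K = cball x0 r \<times> cball y0 r \<times> cball t0 r \<times> cball t0 r"
    define I where "I = ball x0 r \<times> ball y0 r \<times> ball t0 r \<times> ball t0 r"
    \<comment> \<open>On the boundary of the box the linear error is at most
      \<open>3 * e * r\<close>, while the quadratic term is at least
      \<open>C * r * r = 4 * e * r\<close>. The price is a change of the gradients by at most
      \<open>2 * C * r = 8 * e\<close>.\<close>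
    define C where "C = 4 * e / r"
    have C: "C > 0" "C * r = 4 * e" using r e by (auto simp: C_def)
    define f where "f = (\<lambda>(x, y, t, s). U (x, t) + V (y, s) - p \<bullet> (x - x0) - q \<bullet> (y - y0) - a * (t - t0)
       - C * ((norm (x - x0))\<^sup>2 + (norm (y - y0))\<^sup>2 + (t - t0)\<^sup>2))"
    define Q where "Q = (\<lambda>x::real. (max 0 x)\<^sup>2)"
    have dQ: "(Q has_real_derivative 2 * max 0 x) (at x)" for x
      unfolding Q_def by (rule max0_square_deriv)
    define g where "g = (\<lambda>(x::'a, y::'a, t, s). Q (t - t0) + (t - s)\<^sup>2)"
    have K: "compact K" unfolding K_def by (intro compact_Times compact_cball)
    have cU: "continuous_on K (\<lambda>m. U (fst m, fst (snd (snd m))))"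
      by (rule continuous_on_compose2[OF U(2)]) (auto intro!: continuous_intros inD simp: K_def)
    have cV: "continuous_on K (\<lambda>m. V (fst (snd m), snd (snd (snd m))))"
      by (rule continuous_on_compose2[OF V(2)]) (auto intro!: continuous_intros inE simp: K_def)
    have cf: "continuous_on K f"
      unfolding f_def case_prod_unfold by (intro continuous_intros cU cV)
    have cg: "continuous_on K g" unfolding g_def Q_def case_prod_unfold by (intro continuous_intros)
    \<comment> \<open>The zeros of \<open>g\<close> are the points with
      \<open>s = t \<le> t0\<close>, where the supergradient from the past applies. Hence for large
      \<open>k\<close> the penalized maximum over \<open>K\<close> lies in the open box
      \<open>I\<close>.\<close>
    have "compact (K - I)" using K by (intro compact_diff) (auto simp: I_def open_Times)
    then have "\<exists>k>0. \<forall>m\<in>K - I. f m - k * g m < c"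
    proof (rule penalty)
      show "continuous_on (K - I) f" "continuous_on (K - I) g"
        using cf cg continuous_on_subset by blast+
      show "0 \<le> g m" for m by (auto simp: g_def Q_def split: prod.splits)
      fix m assume m: "m \<in> K - I" "g m = 0"
      obtain x y t s where mm: "m = (x, y, t, s)" by (metis prod_cases4)
      have st: "s = t" "t \<le> t0" using m(2) by (auto simp: mm g_def Q_def add_nonneg_eq_0_iff max_def split: if_splits)
      define X Y Z where "X = norm (x - x0)" and "Y = norm (y - y0)" and "Z = \<bar>t - t0\<bar>"
      have b: "0 \<le> X" "0 \<le> Y" "0 \<le> Z" "X \<le> r" "Y \<le> r" "Z \<le> r" "X = r \<or> Y = r \<or> Z = r"
        using m(1) st by (auto simp: mm K_def I_def X_def Y_def Z_def dist_norm norm_minus_commute)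
      have n: "norm (x - x0, y - y0, t - t0) \<le> X + Y + Z"
        unfolding X_def Y_def Z_def
        using norm_Pair_le[of "x - x0" "(y - y0, t - t0)"] norm_Pair_le[of "y - y0" "t - t0"] by simp
      have "norm (x - x0, y - y0, t - t0) < r1" using n b r by linarith
      from r1(2)[OF st(2) this]
      moreover have "f m = U (x, t) + V (y, t) - p \<bullet> (x - x0) - q \<bullet> (y - y0) - a * (t - t0) - C * (X\<^sup>2 + Y\<^sup>2 + Z\<^sup>2)"
        unfolding f_def mm st X_def Y_def Z_def by (simp only: prod.case power2_abs)
      ultimately have "f m \<le> c + e * norm (x - x0, y - y0, t - t0) - C * (X\<^sup>2 + Y\<^sup>2 + Z\<^sup>2)"
        by linarith
      also have "\<dots> \<le> c + e * (X + Y + Z) - C * (X\<^sup>2 + Y\<^sup>2 + Z\<^sup>2)"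
        using n e by (simp add: mult_left_mono)
      also have "\<dots> < c"
      proof -
        have sq: "X\<^sup>2 + Y\<^sup>2 + Z\<^sup>2 \<ge> r\<^sup>2" using b(7) by (auto)
        have "e * (X + Y + Z) \<le> e * (3 * r)" using b e by (intro mult_left_mono) auto
        also have "\<dots> < C * r\<^sup>2" using r e C(2) by (simp add: power2_eq_square mult.assoc[symmetric])
        also have "\<dots> \<le> C * (X\<^sup>2 + Y\<^sup>2 + Z\<^sup>2)" using sq C by (intro mult_left_mono) auto
        finally show ?thesis by simp
      qed
      finally show "f m < c" .
    qed
    then obtain k where k: "k > 0" "\<And>m. m \<in> K - I \<Longrightarrow> f m - k * g m < c" by blast
    have m0: "(x0, y0, t0, t0) \<in> K" using r by (simp add: K_def)
    have "continuous_on K (\<lambda>m. f m - k * g m)" by (intro continuous_intros cf cg)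
    then obtain m where m: "m \<in> K" "\<And>n. n \<in> K \<Longrightarrow> f n - k * g n \<le> f m - k * g m"
      using continuous_attains_sup[OF K] m0 by blast
    have "f (x0, y0, t0, t0) - k * g (x0, y0, t0, t0) = c" by (simp add: f_def g_def c_def Q_def)
    with m(2)[OF m0] k(2)[of m] m(1) have mI: "m \<in> I" by force
    obtain x y t s where mm: "m = (x, y, t, s)" by (metis prod_cases4)
    have box: "x \<in> ball x0 r" "y \<in> ball y0 r" "t \<in> ball t0 r" "s \<in> ball t0 r"
      using mI by (auto simp: mm I_def)
    let ?p = "p + (2 * C) *\<^sub>R (x - x0)" and ?q = "q + (2 * C) *\<^sub>R (y - y0)"
    have sU: "supergrad UNIV U (x, t) (?p, a + 2 * C * (t - t0) + 2 * k * max 0 (t - t0) + 2 * k * (t - s))"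
      unfolding supergrad_def
    proof (intro exI conjI)
      let ?\<phi> = "\<lambda>z. U (x, t) + p \<bullet> (fst z - x) + a * (snd z - t)
         + C * ((norm (fst z - x0))\<^sup>2 - (norm (x - x0))\<^sup>2 + (snd z - t0)\<^sup>2 - (t - t0)\<^sup>2)
         + k * (Q (snd z - t0) - Q (t - t0) + (snd z - s)\<^sup>2 - (t - s)\<^sup>2)"
      show "(?\<phi> has_derivative (\<bullet>) (?p, a + 2 * C * (t - t0) + 2 * k * max 0 (t - t0) + 2 * k * (t - s))) (at (x, t))"
        by (rule penalized_test_derivative[OF dQ])
      show "?\<phi> (x, t) = U (x, t)" by simp
      have "open (ball x0 r \<times> ball t0 r)" "(x, t) \<in> ball x0 r \<times> ball t0 r" using box by (auto simp: open_Times)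
      then have "\<forall>\<^sub>F z in at (x, t). z \<in> ball x0 r \<times> ball t0 r" using eventually_at_topological by blast
      then show "\<forall>\<^sub>F z in at (x, t). U z \<le> ?\<phi> z"
      proof eventually_elim
        case (elim z)
        obtain x' t' where z: "z = (x', t')" by fastforce
        have "(x', y, t', s) \<in> K" using elim box by (auto simp: z K_def)
        from m(2)[OF this] show ?case by (simp add: z mm f_def g_def algebra_simps)
      qed
    qed
    have sV: "supergrad UNIV V (y, s) (?q, - 2 * k * (t - s))"
      unfolding supergrad_def
    proof (intro exI conjI)
      let ?\<phi> = "\<lambda>z. V (y, s) + q \<bullet> (fst z - y)
         + C * ((norm (fst z - y0))\<^sup>2 - (norm (y - y0))\<^sup>2)
         + k * ((t - snd z)\<^sup>2 - (t - s)\<^sup>2)"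
      show "(?\<phi> has_derivative (\<bullet>) (?q, - 2 * k * (t - s))) (at (y, s))"
        by (rule quadratic_test_derivative)
      show "?\<phi> (y, s) = V (y, s)" by simp
      have "open (ball y0 r \<times> ball t0 r)" "(y, s) \<in> ball y0 r \<times> ball t0 r" using box by (auto simp: open_Times)
      then have "\<forall>\<^sub>F z in at (y, s). z \<in> ball y0 r \<times> ball t0 r" using eventually_at_topological by blast
      then show "\<forall>\<^sub>F z in at (y, s). V z \<le> ?\<phi> z"
      proof eventually_elim
        case (elim z)
        obtain x' t' where z: "z = (x', t')" by fastforce
        have "(x, x', t, t') \<in> K" using elim box by (auto simp: z K_def)
        from m(2)[OF this] show ?case by (simp add: z mm f_def g_def algebra_simps)
      qed
    qed
    have D: "(x, t) \<in> D" "(y, s) \<in> E" using box inD inE by auto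
    have sm: "2 * C * \<rho> \<le> 8 * e" if "\<rho> \<le> r" for \<rho> 
    proof -
      have "2 * C * \<rho> \<le> 2 * C * r" using that C by (intro mult_left_mono) auto
      then show ?thesis using C by simp
    qed
    \<comment> \<open>The terms \<open>2 * k * (t - s)\<close> of the two time derivatives cancel
      and the term with \<open>max 0 (t - t0)\<close> is nonnegative, so the size of
      \<open>k\<close> does not enter the result.\<close>
    have "a + 2 * C * (t - t0) + 2 * k * max 0 (t - t0) + 2 * k * (t - s) - 2 * k * (t - s)
        \<le> F x t (U (x, t)) ?p + G y s (V (y, s)) ?q"
      using jetsubD[OF U(1) D(1) sU] jetsubD[OF V(1) D(2) sV] by linarith
    moreover have "2 * C * (t0 - t) \<le> 8 * e" using box by (intro sm) (auto simp: dist_norm)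
    moreover have "2 * k * max 0 (t - t0) \<ge> 0" using k by simp
    moreover have "2 * C * (t0 - t) = - (2 * C * (t - t0))" by (simp add: algebra_simps)
    ultimately have "a - 8 * e \<le> F x t (U (x, t)) ?p + G y s (V (y, s)) ?q" by linarith
    moreover have "norm (?p - p) \<le> 8 * e" "norm (?q - q) \<le> 8 * e"
      using sm[of "norm (x - x0)"] sm[of "norm (y - y0)"] box C by (auto simp: dist_norm norm_minus_commute)
    moreover have "norm (x - x0) \<le> e" "\<bar>t - t0\<bar> \<le> e" "norm (y - y0) \<le> e" "\<bar>s - t0\<bar> \<le> e"
      using box r by (auto simp: dist_norm norm_minus_commute)
    ultimately show ?thesis using D by blast
  qed
  have "\<forall>n. \<exists>x t y s p' q'. (x, t) \<in> D \<and> (y, s) \<in> E \<and> norm (x - x0) \<le> inverse (Suc n) \<and> \<bar>t - t0\<bar> \<le> inverse (Suc n) \<and>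
     norm (y - y0) \<le> inverse (Suc n) \<and> \<bar>s - t0\<bar> \<le> inverse (Suc n) \<and> norm (p' - p) \<le> 8 * inverse (Suc n) \<and> norm (q' - q) \<le> 8 * inverse (Suc n) \<and>
     a - 8 * inverse (Suc n) \<le> F x t (U (x, t)) p' + G y s (V (y, s)) q'"
    using step by auto
  then obtain x t y s p' q' where sq: "\<And>n. (x n, t n) \<in> D" "\<And>n. (y n, s n) \<in> E"
    "\<And>n. norm (x n - x0) \<le> inverse (Suc n)" "\<And>n. norm (t n - t0) \<le> inverse (Suc n)"
    "\<And>n. norm (y n - y0) \<le> inverse (Suc n)" "\<And>n. norm (s n - t0) \<le> inverse (Suc n)"
    "\<And>n. norm (p' n - p) \<le> 8 * inverse (Suc n)" "\<And>n. norm (q' n - q) \<le> 8 * inverse (Suc n)"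
    "\<And>n. a - 8 * inverse (Suc n) \<le> F (x n) (t n) (U (x n, t n)) (p' n) + G (y n) (s n) (V (y n, s n)) (q' n)"
    unfolding real_norm_def by metis
  have lim0: "(\<lambda>n. inverse (real (Suc n))) \<longlonglongrightarrow> 0" by (rule LIMSEQ_inverse_real_of_nat)
  have lim8: "(\<lambda>n. 8 * inverse (real (Suc n))) \<longlonglongrightarrow> 0" using tendsto_mult_left[OF lim0, of 8] by simp
  have L1: "x \<longlonglongrightarrow> x0" "t \<longlonglongrightarrow> t0" "y \<longlonglongrightarrow> y0" "s \<longlonglongrightarrow> t0"
    using Lim_null_comparison[OF always_eventually[OF allI[OF sq(3)]] lim0]
      Lim_null_comparison[OF always_eventually[OF allI[OF sq(4)]] lim0]
      Lim_null_comparison[OF always_eventually[OF allI[OF sq(5)]] lim0]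
      Lim_null_comparison[OF always_eventually[OF allI[OF sq(6)]] lim0]
    by (simp_all add: LIM_zero_iff)
  have L2: "p' \<longlonglongrightarrow> p" "q' \<longlonglongrightarrow> q"
    using Lim_null_comparison[OF always_eventually[OF allI[OF sq(7)]] lim8]
      Lim_null_comparison[OF always_eventually[OF allI[OF sq(8)]] lim8]
    by (simp_all add: LIM_zero_iff)
  have LU: "(\<lambda>n. U (x n, t n)) \<longlonglongrightarrow> U (x0, t0)"
    by (rule continuous_on_tendsto_compose[OF U(2)]) (use L1 sq U(4) in \<open>auto intro!: tendsto_Pair\<close>)
  have LV: "(\<lambda>n. V (y n, s n)) \<longlonglongrightarrow> V (y0, t0)"
    by (rule continuous_on_tendsto_compose[OF V(2)]) (use L1 sq V(4) in \<open>auto intro!: tendsto_Pair\<close>)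
  have LF: "(\<lambda>n. F (x n) (t n) (U (x n, t n)) (p' n)) \<longlonglongrightarrow> F x0 t0 (U (x0, t0)) p"
    using continuous_on_tendsto_compose[OF F, of "\<lambda>n. (x n, t n, U (x n, t n), p' n)" "(x0, t0, U (x0, t0), p)" sequentially]
      tendsto_Pair[OF L1(1) tendsto_Pair[OF L1(2) tendsto_Pair[OF LU L2(1)]]] sq(1) U(4) by simp
  have LG: "(\<lambda>n. G (y n) (s n) (V (y n, s n)) (q' n)) \<longlonglongrightarrow> G y0 t0 (V (y0, t0)) q"
    using continuous_on_tendsto_compose[OF G, of "\<lambda>n. (y n, s n, V (y n, s n), q' n)" "(y0, t0, V (y0, t0), q)" sequentially]
      tendsto_Pair[OF L1(3) tendsto_Pair[OF L1(4) tendsto_Pair[OF LV L2(2)]]] sq(2) V(4) by simp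
  have "(\<lambda>n. a - 8 * inverse (real (Suc n))) \<longlonglongrightarrow> a - 0" by (intro tendsto_intros lim8)
  from LIMSEQ_le[OF this tendsto_add[OF LF LG]] sq(9) show ?thesis by auto
qed

section \<open>Maximum principles: barriers and comparison of two functions\<close>

lemma jetsub_zero: "jetsub (\<lambda>_ _ _ _. 0) UNIV (\<lambda>_. 0)"
  unfolding jetsub_def
proof (intro allI impI, rule ccontr)
  fix x :: "'a::euclidean_space" and t a :: real and p :: 'a
  assume s: "supergrad UNIV (\<lambda>_. 0) (x, t) (p, a)" and a: "\<not> a \<le> 0"
  obtain r where r: "r > 0" "\<And>y. norm (y - (x, t)) < r \<Longrightarrow> 0 \<le> (p, a) \<bullet> (y - (x, t)) + a / 2 * norm (y - (x, t))"
    using supergrad_eps[OF s, of "a / 2"] a by auto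
  have "0 \<le> - a * (r / 2) + a / 2 * (r / 2)"
    using r(2)[of "(x, t - r / 2)"] r(1) by (simp add: norm_Pair)
  moreover have "a * r > 0" using a r by simp
  ultimately show False by simp
qed

text \<open>At a positive maximum of \<open>U - \<phi>\<close> over the cylinder,
  \<open>crit\<close> excludes the initial time and the lateral boundary, and contradicts the
  inequality for \<open>U\<close>. A maximum at the final time is covered by
  \<open>jetsub_add_supergrad\<close>, applied with second function 0. Since \<open>crit\<close>
  speaks only of points where \<open>\<phi>\<close> is exceeded, bounds on \<open>U\<close>
  available there may be used to verify it.\<close>

lemma barrier:
  fixes U \<phi> :: "'a::euclidean_space \<times> real \<Rightarrow> real"
  assumes U: "jetsub F D U" "continuous_on D U" "open D"
    and F: "continuous_on {(x, t, r, p). (x, t) \<in> D} (\<lambda>(x, t, r, p). F x t r p)"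
    and K: "compact K" "K \<times> {s..t} \<subseteq> D" and \<phi>: "continuous_on (K \<times> {s..t}) \<phi>"
    and crit: "\<And>x \<tau>. x \<in> K \<Longrightarrow> s \<le> \<tau> \<Longrightarrow> \<tau> \<le> t \<Longrightarrow> \<phi> (x, \<tau>) < U (x, \<tau>) \<Longrightarrow> s < \<tau> \<and> x \<in> interior K \<and>
       (\<exists>p b. (\<phi> has_derivative (\<bullet>) (p, b)) (at (x, \<tau>)) \<and> F x \<tau> (U (x, \<tau>)) p < b)"
    and x: "x \<in> K" "s \<le> \<tau>" "\<tau> \<le> t"
  shows "U (x, \<tau>) \<le> \<phi> (x, \<tau>)"
proof (rule ccontr)
  assume neg: "\<not> ?thesis"
  have "continuous_on (K \<times> {s..t}) (\<lambda>z. U z - \<phi> z)"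
    using U(2) K(2) \<phi> by (intro continuous_intros) (auto intro: continuous_on_subset)
  then obtain m where m: "m \<in> K \<times> {s..t}" "\<And>z. z \<in> K \<times> {s..t} \<Longrightarrow> U z - \<phi> z \<le> U m - \<phi> m"
    using continuous_attains_sup[of "K \<times> {s..t}" "\<lambda>z. U z - \<phi> z"] K(1) x by (force simp: compact_Times)
  obtain x0 t0 where mm: "m = (x0, t0)" by fastforce
  have x0: "x0 \<in> K" "s \<le> t0" "t0 \<le> t" using m(1) by (auto simp: mm)
  have pos: "\<phi> (x0, t0) < U (x0, t0)"
    using m(2)[of "(x, \<tau>)"] x neg by (auto simp: mm)
  obtain p b where c: "s < t0" "x0 \<in> interior K" "(\<phi> has_derivative (\<bullet>) (p, b)) (at (x0, t0))"
    "F x0 t0 (U (x0, t0)) p < b"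
    using crit[OF x0 pos] by blast
  have "b \<le> F x0 t0 (U (x0, t0)) p + (\<lambda>_ _ _ _. 0) x0 t0 ((\<lambda>_. 0) (x0, t0)) (0::'a)"
  proof (rule jetsub_add_supergrad[where U = U and F = F and D = D and V = "\<lambda>_. 0" and G = "\<lambda>_ _ _ _. 0" and E = UNIV])
    show "supergrad {m. snd (snd m) \<le> t0} (\<lambda>(x, y, t). U (x, t) + 0) (x0, x0, t0) (p, 0, b)"
      unfolding supergrad_def
    proof (intro exI[of _ "\<lambda>m. U (x0, t0) + (\<phi> (fst m, snd (snd m)) - \<phi> (x0, t0))"] conjI)
      have "((\<lambda>m. \<phi> (fst m, snd (snd m))) has_derivative (\<lambda>h. (p, b) \<bullet> (fst h, snd (snd h))))
         (at (x0, x0, t0) within {m. snd (snd m) \<le> t0})"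
        by (rule has_derivative_compose[where g = \<phi>])
          (use c(3) in \<open>auto intro!: derivative_eq_intros\<close>)
      then show "((\<lambda>m. U (x0, t0) + (\<phi> (fst m, snd (snd m)) - \<phi> (x0, t0))) has_derivative (\<bullet>) (p, 0, b))
         (at (x0, x0, t0) within {m. snd (snd m) \<le> t0})"
        by (auto intro!: derivative_eq_intros simp: fun_eq_iff)
      have "open (interior K \<times> (UNIV::'a set) \<times> {s<..})" "(x0, x0, t0) \<in> interior K \<times> UNIV \<times> {s<..}"
        using c by (auto intro!: open_Times)
      then have "\<forall>\<^sub>F m in at (x0, x0, t0) within {m. snd (snd m) \<le> t0}. m \<in> interior K \<times> UNIV \<times> {s<..}"
        by (rule topological_tendstoD[OF tendsto_ident_at])
      moreover have "\<forall>\<^sub>F m in at (x0, x0, t0) within {m. snd (snd m) \<le> t0}. snd (snd m) \<le> t0"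
        by (auto simp: eventually_at_filter)
      ultimately show "\<forall>\<^sub>F m in at (x0, x0, t0) within {m. snd (snd m) \<le> t0}.
         (case m of (x, y, t) \<Rightarrow> U (x, t) + 0) \<le> U (x0, t0) + (\<phi> (fst m, snd (snd m)) - \<phi> (x0, t0))"
      proof eventually_elim
        case (elim m)
        then show ?case using m(2)[of "(fst m, snd (snd m))"] x0 interior_subset[of K]
          by (auto simp: mm split: prod.splits)
      qed
    qed auto
    show "(x0, t0) \<in> D" using x0 K(2) by auto
  qed (use U F jetsub_zero in auto)
  with c(4) show False by simp
qed

text \<open>\<open>V\<close> stands for minus a supersolution. At a positive maximum of the
  difference minus \<open>\<eta> * t\<close> and a small multiple of the square of
  \<open>norm x\<close>, the time derivative is at least \<open>b + \<eta>\<close>, against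
  \<open>strict\<close>; there \<open>\<delta>\<close> is the gradient of the quadratic term. All
  conditions are imposed only where the difference exceeds \<open>\<psi>\<close>, so that
  \<open>D\<close> and \<open>E\<close> may be sets on which a sign is known.\<close>

lemma doubling_principle:
  fixes U V :: "'a::euclidean_space \<times> real \<Rightarrow> real" and \<psi> :: "'a \<times> real \<Rightarrow> real"
  assumes U: "jetsub F D U" "continuous_on (UNIV \<times> {0..<T}) U" "open D" "D \<subseteq> UNIV \<times> {0<..<T}"
    and V: "jetsub G E V" "continuous_on (UNIV \<times> {0..<T}) V" "open E" "E \<subseteq> UNIV \<times> {0<..<T}"
    and F: "continuous_on {(x, t, r, p). (x, t) \<in> D} (\<lambda>(x, t, r, p). F x t r p)"
    and G: "continuous_on {(x, t, r, p). (x, t) \<in> E} (\<lambda>(x, t, r, p). G x t r p)"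
    and \<psi>: "continuous_on UNIV \<psi>"
    and init: "\<And>x y. U (x, 0) + V (y, 0) \<le> \<psi> (x - y, 0)"
    and bd: "\<And>x y t. 0 \<le> t \<Longrightarrow> t < T \<Longrightarrow> \<psi> (x - y, t) < U (x, t) + V (y, t) \<Longrightarrow>
       U (x, t) + V (y, t) - \<psi> (x - y, t) \<le> C \<and> norm (x - y) \<le> C"
    and pos: "\<And>x y t. 0 < t \<Longrightarrow> t < T \<Longrightarrow> \<psi> (x - y, t) < U (x, t) + V (y, t) \<Longrightarrow>
       (x, t) \<in> D \<and> (y, t) \<in> E \<and> (\<psi> has_derivative (\<bullet>) (g (x - y) t, b (x - y) t)) (at (x - y, t))"
    and strict: "\<And>\<eta>. \<eta> > 0 \<Longrightarrow> \<exists>\<gamma>>0. \<forall>x y t \<delta>. 0 < t \<longrightarrow> t < T \<longrightarrow> \<psi> (x - y, t) < U (x, t) + V (y, t) \<longrightarrow>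
       norm \<delta> \<le> \<gamma> \<longrightarrow> F x t (U (x, t)) (g (x - y) t + \<delta>) + G y t (V (y, t)) (- g (x - y) t) < b (x - y) t + \<eta>"
    and t: "0 \<le> t1" "t1 < T"
  shows "U (x1, t1) + V (y1, t1) \<le> \<psi> (x1 - y1, t1)"
proof (rule ccontr)
  define Z where "Z = (\<lambda>x y t. U (x, t) + V (y, t) - \<psi> (x - y, t))"
  define z1 where "z1 = Z x1 y1 t1"
  assume "\<not> ?thesis"
  then have z1: "z1 > 0" by (simp add: z1_def Z_def)
  have t1: "t1 > 0" using init[of x1 y1] z1 t by (cases "t1 = 0") (auto simp: z1_def Z_def)
  have C: "C \<ge> z1" using bd[OF t, of x1 y1] z1 by (simp add: z1_def Z_def)
  \<comment> \<open>The term \<open>\<eta> * t1\<close> uses up a quarter of the gap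
    \<open>z1\<close>, and the quadratic term below another quarter, so \<open>\<Phi>\<close> is
    still positive at the starting point.\<close>
  define \<eta> where "\<eta> = z1 / (4 * t1)"
  have \<eta>: "\<eta> > 0" using z1 t1 by (simp add: \<eta>_def)
  obtain \<gamma> where \<gamma>: "\<gamma> > 0" "\<And>x y t \<delta>. 0 < t \<Longrightarrow> t < T \<Longrightarrow> \<psi> (x - y, t) < U (x, t) + V (y, t) \<Longrightarrow>
       norm \<delta> \<le> \<gamma> \<Longrightarrow> F x t (U (x, t)) (g (x - y) t + \<delta>) + G y t (V (y, t)) (- g (x - y) t) < b (x - y) t + \<eta>"
    using strict[OF \<eta>] by blast
  \<comment> \<open>Since \<open>\<alpha> * (norm x0)\<^sup>2 \<le> C\<close> at the maximum, the
    second bound gives \<open>norm ((2 * \<alpha>) *\<^sub>R x0) \<le> \<gamma>\<close>.\<close>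
  define \<alpha> where "\<alpha> = min (z1 / (4 * ((norm x1)\<^sup>2 + 1))) (\<gamma>\<^sup>2 / (4 * C))"
  have \<alpha>: "\<alpha> > 0" using z1 C \<gamma> by (simp add: \<alpha>_def add_nonneg_pos)
  have \<alpha>1: "\<alpha> * (norm x1)\<^sup>2 \<le> z1 / 4"
  proof -
    have "\<alpha> * (norm x1)\<^sup>2 \<le> z1 / (4 * ((norm x1)\<^sup>2 + 1)) * ((norm x1)\<^sup>2 + 1)"
      using z1 \<alpha> by (intro mult_mono) (auto simp: \<alpha>_def)
    also have "\<dots> = z1 / 4" by (simp add: field_simps add_nonneg_eq_0_iff)
    finally show ?thesis .
  qed
  have \<alpha>2: "\<alpha> * C * 4 \<le> \<gamma>\<^sup>2" 
  proof -
    have "\<alpha> * (4 * C) \<le> \<gamma>\<^sup>2 / (4 * C) * (4 * C)" using z1 C by (intro mult_right_mono) (auto simp: \<alpha>_def)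
    then show ?thesis using z1 C by (simp add: mult.commute mult.left_commute)
  qed
  define \<Phi> where "\<Phi> = (\<lambda>(x, y, t). Z x y t - \<eta> * t - \<alpha> * (norm x)\<^sup>2)"
  \<comment> \<open>Positivity of \<open>\<Phi>\<close> bounds \<open>norm x\<close> by
    \<open>sqrt (C / \<alpha>)\<close> and \<open>norm (x - y)\<close> by \<open>C\<close>, so the
    maximum over \<open>K\<close> is a maximum over all of space up to time
    \<open>t1\<close>.\<close>
  define R where "R = sqrt (C / \<alpha>) + C + norm x1 + norm y1"
  define K where "K = cball (0::'a) R \<times> cball (0::'a) R \<times> {0..t1}"
  have "compact K" by (auto simp: K_def intro!: compact_Times)
  have cU: "continuous_on K (\<lambda>m. U (fst m, snd (snd m)))"
    by (rule continuous_on_compose2[OF U(2)]) (use t in \<open>auto intro!: continuous_intros simp: K_def\<close>)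
  have cV: "continuous_on K (\<lambda>m. V (fst (snd m), snd (snd m)))"
    by (rule continuous_on_compose2[OF V(2)]) (use t in \<open>auto intro!: continuous_intros simp: K_def\<close>)
  have c\<psi>: "continuous_on K (\<lambda>m. \<psi> (fst m - fst (snd m), snd (snd m)))"
    by (rule continuous_on_compose2[OF \<psi>]) (auto intro!: continuous_intros)
  have "continuous_on K \<Phi>"
    unfolding \<Phi>_def Z_def case_prod_unfold by (intro continuous_intros cU cV c\<psi>)
  have R: "R \<ge> 0" "norm x1 \<le> R" "norm y1 \<le> R" using C z1 \<alpha> by (auto simp: R_def)
  have m1: "(x1, y1, t1) \<in> K" using R t by (auto simp: K_def)
  obtain m where m: "m \<in> K" "\<And>n. n \<in> K \<Longrightarrow> \<Phi> n \<le> \<Phi> m"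
    using continuous_attains_sup[OF \<open>compact K\<close> _ \<open>continuous_on K \<Phi>\<close>] m1 by blast
  have "\<Phi> (x1, y1, t1) \<ge> z1 / 2"
    using \<alpha>1 t1 by (simp add: \<Phi>_def z1_def[symmetric] \<eta>_def)
  then have Pm: "\<Phi> m > 0" using m(2)[OF m1] z1 by linarith
  have small: "\<alpha> * (norm x)\<^sup>2 \<le> C \<and> norm (x - y) \<le> C" if "\<Phi> (x, y, t) > 0" "0 \<le> t" "t < T" for x y t
  proof -
    have "\<eta> * t \<ge> 0" "\<alpha> * (norm x)\<^sup>2 \<ge> 0" using \<eta> \<alpha> that by auto
    then have "Z x y t > 0" "Z x y t > \<alpha> * (norm x)\<^sup>2" using that(1) by (auto simp: \<Phi>_def)
    then show ?thesis using bd[OF that(2,3), of x y] by (auto simp: Z_def)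
  qed
  have glob: "\<Phi> (x, y, t) \<le> \<Phi> m" if "0 \<le> t" "t \<le> t1" for x y t
  proof (cases "\<Phi> (x, y, t) > 0")
    case True
    have s: "\<alpha> * (norm x)\<^sup>2 \<le> C" "norm (x - y) \<le> C" using small[OF True] that t by auto
    have "(norm x)\<^sup>2 \<le> C / \<alpha>" using s(1) \<alpha> by (simp add: field_simps)
    then have "norm x \<le> sqrt (C / \<alpha>)" by (rule real_le_rsqrt)
    moreover have "norm y \<le> norm x + norm (x - y)" by (metis norm_triangle_sub norm_minus_commute)
    ultimately have "(x, y, t) \<in> K" using s that z1 C unfolding K_def R_def
      by simp (smt (verit) norm_ge_zero)
    then show ?thesis by (rule m(2))
  qed (use Pm in simp)
  obtain x0 y0 t0 where mm: "m = (x0, y0, t0)" by (metis prod_cases3)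
  have t0: "0 \<le> t0" "t0 \<le> t1" "t0 < T" using m(1) t by (auto simp: K_def mm)
  have Z0: "Z x0 y0 t0 > 0"
  proof -
    have "\<eta> * t0 \<ge> 0" "\<alpha> * (norm x0)\<^sup>2 \<ge> 0" using \<eta> \<alpha> t0 by auto
    then show ?thesis using Pm by (auto simp: mm \<Phi>_def)
  qed
  then have psl: "\<psi> (x0 - y0, t0) < U (x0, t0) + V (y0, t0)" by (simp add: Z_def)
  have t0p: "t0 > 0" using init[of x0 y0] psl t0 by (cases "t0 = 0") auto
  note P = pos[OF t0p t0(3) psl]
  let ?g = "g (x0 - y0) t0" and ?b = "b (x0 - y0) t0"
  have main: "?b + \<eta> \<le> F x0 t0 (U (x0, t0)) (?g + (2 * \<alpha>) *\<^sub>R x0) + G y0 t0 (V (y0, t0)) (- ?g)"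
  proof (rule jetsub_add_supergrad[where U = U and V = V and F = F and G = G and D = D and E = E])
    show "jetsub F D U" "open D" "jetsub G E V" "open E" "(x0, t0) \<in> D" "(y0, t0) \<in> E"
      using U V P by auto
    show "continuous_on D U" "continuous_on E V" using U V by (auto elim!: continuous_on_subset)
    show "supergrad {m. snd (snd m) \<le> t0} (\<lambda>(x, y, t). U (x, t) + V (y, t)) (x0, y0, t0)
      (?g + (2 * \<alpha>) *\<^sub>R x0, - ?g, ?b + \<eta>)"
      unfolding supergrad_def
    proof (intro exI[of _ "\<lambda>m. \<Phi> (x0, y0, t0) + \<psi> (fst m - fst (snd m), snd (snd m)) + \<eta> * snd (snd m) + \<alpha> * (fst m \<bullet> fst m)"] conjI)
      have "((\<lambda>m. \<psi> (fst m - fst (snd m), snd (snd m))) has_derivative (\<lambda>h. (?g, ?b) \<bullet> (fst h - fst (snd h), snd (snd h))))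
         (at (x0, y0, t0) within {m. snd (snd m) \<le> t0})"
        by (rule has_derivative_compose[where g = \<psi>])
          (use P in \<open>auto intro!: derivative_eq_intros\<close>)
      then show "((\<lambda>m. \<Phi> (x0, y0, t0) + \<psi> (fst m - fst (snd m), snd (snd m)) + \<eta> * snd (snd m) + \<alpha> * (fst m \<bullet> fst m)) has_derivative
         (\<bullet>) (?g + (2 * \<alpha>) *\<^sub>R x0, - ?g, ?b + \<eta>)) (at (x0, y0, t0) within {m. snd (snd m) \<le> t0})"
        by (auto intro!: derivative_eq_intros simp: fun_eq_iff inner_diff_right inner_add_left inner_commute algebra_simps)
      show "\<Phi> (x0, y0, t0) + \<psi> (fst (x0, y0, t0) - fst (snd (x0, y0, t0)), snd (snd (x0, y0, t0))) +
         \<eta> * snd (snd (x0, y0, t0)) + \<alpha> * (fst (x0, y0, t0) \<bullet> fst (x0, y0, t0)) = (case (x0, y0, t0) of (x, y, t) \<Rightarrow> U (x, t) + V (y, t))"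
        by (simp add: \<Phi>_def Z_def power2_norm_eq_inner)
      have "open ((UNIV::'a set) \<times> (UNIV::'a set) \<times> {0::real<..})" "(x0, y0, t0) \<in> UNIV \<times> UNIV \<times> {0<..}"
        using t0p by (auto intro!: open_Times)
      then have "\<forall>\<^sub>F m in at (x0, y0, t0) within {m. snd (snd m) \<le> t0}. m \<in> UNIV \<times> UNIV \<times> {0<..}"
        by (rule topological_tendstoD[OF tendsto_ident_at])
      moreover have "\<forall>\<^sub>F m in at (x0, y0, t0) within {m. snd (snd m) \<le> t0}. snd (snd m) \<le> t0"
        by (auto simp: eventually_at_filter)
      ultimately show "\<forall>\<^sub>F m in at (x0, y0, t0) within {m. snd (snd m) \<le> t0}.
         (case m of (x, y, t) \<Rightarrow> U (x, t) + V (y, t)) \<le> \<Phi> (x0, y0, t0) + \<psi> (fst m - fst (snd m), snd (snd m)) + \<eta> * snd (snd m) + \<alpha> * (fst m \<bullet> fst m)"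
      proof eventually_elim
        case (elim m)
        obtain x y t where e: "m = (x, y, t)" by (metis prod_cases3)
        have "0 \<le> t" "t \<le> t1" using elim t0 by (auto simp: e)
        from glob[OF this, of x y] show ?case by (simp add: e mm \<Phi>_def[of] Z_def power2_norm_eq_inner)
      qed
    qed
  qed (use F G in auto)
  have "norm ((2 * \<alpha>) *\<^sub>R x0) \<le> \<gamma>"
  proof -
    have "\<alpha> * (norm x0)\<^sup>2 \<le> C" using small[of x0 y0 t0] Pm t0 by (auto simp: mm)
    then have "4 * \<alpha> * (\<alpha> * (norm x0)\<^sup>2) \<le> 4 * \<alpha> * C" using \<alpha> by (intro mult_left_mono) auto
    also have "\<dots> \<le> \<gamma>\<^sup>2" using \<alpha>2 by (simp add: mult_ac)
    finally have "(2 * \<alpha> * norm x0)\<^sup>2 \<le> \<gamma>\<^sup>2" by (simp add: power2_eq_square mult_ac)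
    then show ?thesis using \<alpha> \<gamma>(1) by (simp add: power2_le_iff_abs_le)
  qed
  from \<gamma>(2)[OF t0p t0(3) psl this] main show False by linarith
qed

subsection \<open>Changes of the unknown\<close>

text \<open>This is the operator in the equation of \<open>- u\<close>; supersolutions are always
  handled as subsolutions of the dual equation.\<close>

definition dual :: "('a::real_vector \<Rightarrow> real \<Rightarrow> real \<Rightarrow> 'a \<Rightarrow> real) \<Rightarrow> 'a \<Rightarrow> real \<Rightarrow> real \<Rightarrow> 'a \<Rightarrow> real" where
  "dual F x t r p = - F x t (- r) (- p)"

lemma dual_dual [simp]: "dual (dual F) = F"
  by (simp add: dual_def fun_eq_iff)

definition jet_ivp :: "('a::euclidean_space \<Rightarrow> real \<Rightarrow> real \<Rightarrow> 'a \<Rightarrow> real) \<Rightarrow> real \<Rightarrow> ('a \<Rightarrow> real) \<Rightarrow> ('a \<times> real \<Rightarrow> real) \<Rightarrow> bool" where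
  "jet_ivp F T u0 U \<longleftrightarrow> jetsub F (UNIV \<times> {0<..<T}) U \<and> jetsub (dual F) (UNIV \<times> {0<..<T}) (\<lambda>z. - U z) \<and>
     continuous_on (UNIV \<times> {0..<T}) U \<and> (\<forall>x. U (x, 0) = u0 x) \<and>
     (\<exists>K>0. \<forall>x t. 0 \<le> t \<longrightarrow> t < T \<longrightarrow> \<bar>U (x, t) - u0 x\<bar> \<le> K * t)"

lemma jet_ivp_dual: "jet_ivp F T u0 U \<Longrightarrow> jet_ivp (dual F) T (\<lambda>x. - u0 x) (\<lambda>z. - U z)"
  unfolding jet_ivp_def by (auto intro!: continuous_intros simp: abs_minus_commute)

text \<open>The value \<open>\<theta> = 0\<close> is the equation of \<open>w\<close>, so a result
  for all \<open>\<theta> \<ge> 0\<close> covers both equations.\<close>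

definition reinit_op :: "('a::real_vector \<Rightarrow> real \<Rightarrow> 'a \<Rightarrow> real) \<Rightarrow> (real \<Rightarrow> real) \<Rightarrow> ('a \<Rightarrow> real) \<Rightarrow> real \<Rightarrow>
    'a \<Rightarrow> real \<Rightarrow> real \<Rightarrow> 'a \<Rightarrow> real" where
  "reinit_op H \<beta> h \<theta> x t r p = H x t p + \<theta> * \<beta> r * h p"

lemma dual_reinit_op:
  "dual (reinit_op H \<beta> h \<theta>) = reinit_op (\<lambda>x t p. - H x t (- p)) (\<lambda>r. - \<beta> (- r)) (\<lambda>p. h (- p)) \<theta>"
  by (simp add: dual_def reinit_op_def fun_eq_iff)

lemma reinit_op_continuous:
  assumes "continuous_on (UNIV \<times> {0..T} \<times> UNIV) (\<lambda>(x, t, p). H x t p)" "continuous_on UNIV \<beta>"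
    "continuous_on UNIV h" "D \<subseteq> UNIV \<times> {0..T}"
  shows "continuous_on {(x, t, r, p). (x, t) \<in> D} (\<lambda>(x, t, r, p). reinit_op H \<beta> h \<theta> x t r p)"
proof -
  let ?S = "{(x, t, r, p). (x, t) \<in> D}"
  have "continuous_on ?S (\<lambda>m. (\<lambda>(x, t, p). H x t p) (fst m, fst (snd m), snd (snd (snd m))))"
    by (rule continuous_on_compose2[OF assms(1)]) (use assms(4) in \<open>auto intro!: continuous_intros\<close>)
  moreover have "continuous_on ?S (\<lambda>m. \<beta> (fst (snd (snd m))))"
    by (rule continuous_on_compose2[OF assms(2)]) (auto intro!: continuous_intros)
  moreover have "continuous_on ?S (\<lambda>m. h (snd (snd (snd m))))"
    by (rule continuous_on_compose2[OF assms(3)]) (auto intro!: continuous_intros)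
  ultimately show ?thesis
    unfolding reinit_op_def case_prod_unfold by (auto intro!: continuous_intros)
qed

text \<open>The change of the unknown is increasing, so its inverse turns a test function into a
  test function; the logarithm makes sense near \<open>z\<close> because the test function is
  negative there. Only the sign of \<open>c\<close> matters later, by homogeneity of
  \<open>H\<close>.\<close>

lemma supergrad_exp_change:
  assumes "supergrad UNIV (\<lambda>z. - exp (- \<sigma> * f z) / \<sigma>) z g" "\<sigma> > 0"
  shows "\<exists>c>0. supergrad UNIV f z (c *\<^sub>R g)"
proof -
  obtain \<phi> where \<phi>: "(\<phi> has_derivative (\<lambda>h. g \<bullet> h)) (at z)" "\<phi> z = - exp (- \<sigma> * f z) / \<sigma>"
    "\<forall>\<^sub>F y in at z. - exp (- \<sigma> * f y) / \<sigma> \<le> \<phi> y"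
    using assms(1) by (auto simp: supergrad_def)
  define c where "c = 1 / exp (- \<sigma> * f z)"
  have neg: "\<phi> z < 0" using \<phi>(2) assms(2) by simp
  have "(\<phi> \<longlongrightarrow> \<phi> z) (at z)" using has_derivative_continuous[OF \<phi>(1)] by (simp add: continuous_within)
  then have ev: "\<forall>\<^sub>F y in at z. \<phi> y < 0" using neg by (rule order_tendstoD)
  have "supergrad UNIV f z (c *\<^sub>R g)"
    unfolding supergrad_def
  proof (intro exI[of _ "\<lambda>y. - ln (- \<sigma> * \<phi> y) / \<sigma>"] conjI)
    show "((\<lambda>y. - ln (- \<sigma> * \<phi> y) / \<sigma>) has_derivative (\<bullet>) (c *\<^sub>R g)) (at z)"
      using neg assms(2) by (auto intro!: derivative_eq_intros \<phi>(1) simp: fun_eq_iff mult_pos_neg \<phi>(2) c_def divide_inverse)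
    show "- ln (- \<sigma> * \<phi> z) / \<sigma> = f z" using assms(2) by (simp add: \<phi>(2))
    show "\<forall>\<^sub>F y in at z. f y \<le> - ln (- \<sigma> * \<phi> y) / \<sigma>"
      using \<phi>(3) ev
    proof eventually_elim
      case (elim y)
      have "- \<sigma> * \<phi> y \<le> exp (- \<sigma> * f y)" "- \<sigma> * \<phi> y > 0"
        using elim assms(2) by (auto simp: field_simps mult_pos_neg)
      then have "ln (- \<sigma> * \<phi> y) \<le> - \<sigma> * f y" by (metis ln_exp ln_mono exp_gt_zero)
      then show ?case using assms(2) by (simp add: field_simps)
    qed
  qed
  then show ?thesis by (intro exI[of _ c]) (simp add: c_def)
qed

lemma supergrad_scale:
  assumes "supergrad UNIV (\<lambda>z. c * f z) z g" "c > 0"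
  shows "supergrad UNIV f z ((1 / c) *\<^sub>R g)"
proof -
  obtain \<phi> where \<phi>: "(\<phi> has_derivative (\<lambda>h. g \<bullet> h)) (at z)" "\<phi> z = c * f z"
    "\<forall>\<^sub>F y in at z. c * f y \<le> \<phi> y"
    using assms(1) by (auto simp: supergrad_def)
  show ?thesis unfolding supergrad_def
  proof (intro exI[of _ "\<lambda>y. \<phi> y / c"] conjI)
    show "((\<lambda>y. \<phi> y / c) has_derivative (\<bullet>) ((1 / c) *\<^sub>R g)) (at z)"
      using assms(2) by (auto intro!: derivative_eq_intros \<phi>(1) simp: fun_eq_iff)
    show "\<phi> z / c = f z" using assms(2) \<phi>(2) by simp
    show "\<forall>\<^sub>F y in at z. f y \<le> \<phi> y / c" using \<phi>(3) by eventually_elim (use assms(2) in \<open>simp add: field_simps\<close>)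
  qed
qed

lemma supergrad_exp_time:
  fixes f :: "'a::euclidean_space \<times> real \<Rightarrow> real"
  assumes "supergrad UNIV (\<lambda>z. exp (- k * snd z) * f z) (x, t) (p, a)"
  shows "supergrad UNIV f (x, t) (exp (k * t) *\<^sub>R p, exp (k * t) * a + k * f (x, t))"
proof -
  obtain \<phi> where \<phi>: "(\<phi> has_derivative (\<lambda>h. (p, a) \<bullet> h)) (at (x, t))" "\<phi> (x, t) = exp (- k * t) * f (x, t)"
    "\<forall>\<^sub>F z in at (x, t). exp (- k * snd z) * f z \<le> \<phi> z"
    using assms(1) by (auto simp: supergrad_def)
  have v: "exp (k * t) * \<phi> (x, t) = f (x, t)" by (simp add: \<phi>(2) mult.assoc[symmetric] flip: exp_add)
  show ?thesis unfolding supergrad_def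
  proof (intro exI[of _ "\<lambda>z. exp (k * snd z) * \<phi> z"] conjI)
    show "((\<lambda>z. exp (k * snd z) * \<phi> z) has_derivative (\<bullet>) (exp (k * t) *\<^sub>R p, exp (k * t) * a + k * f (x, t))) (at (x, t))"
      unfolding v[symmetric] by (auto intro!: derivative_eq_intros \<phi>(1) simp: fun_eq_iff algebra_simps)
    show "exp (k * snd (x, t)) * \<phi> (x, t) = f (x, t)" by (simp add: v)
    show "\<forall>\<^sub>F z in at (x, t). f z \<le> exp (k * snd z) * \<phi> z" using \<phi>(3)
    proof eventually_elim
      case (elim z)
      then have "exp (k * snd z) * (exp (- k * snd z) * f z) \<le> exp (k * snd z) * \<phi> z" by (intro mult_left_mono) auto
      then show ?case by (simp add: mult.assoc[symmetric] flip: exp_add)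
    qed
  qed
qed

section \<open>Weights used in the comparisons\<close>

lemma norm_weight_derivative:
  fixes z :: "'a::euclidean_space"
  assumes "z \<noteq> 0"
  shows "((\<lambda>z. N * exp (l * snd z) * norm (fst z)) has_derivative
     (\<bullet>) ((N * exp (l * t) / norm z) *\<^sub>R z, l * N * exp (l * t) * norm z)) (at (z, t))"
proof -
  have "((\<lambda>z::'a \<times> real. norm (fst z)) has_derivative (\<lambda>h. (z /\<^sub>R norm z) \<bullet> fst h)) (at (z, t))"
    by (rule has_derivative_compose[where g = norm and f = fst, OF has_derivative_fst[OF has_derivative_ident]])
      (use has_derivative_norm[OF assms] in \<open>simp add: sgn_div_norm inner_commute\<close>)
  from has_derivative_mult[OF _ this, of "\<lambda>z. N * exp (l * snd z)"] show ?thesis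
    by (rule has_derivative_eq_rhs) (auto intro!: derivative_eq_intros simp: fun_eq_iff algebra_simps divide_inverse)
qed

text \<open>The smoothed norm is for comparisons of two different functions, where a maximum on the
  diagonal \<open>x = y\<close> cannot be excluded.\<close>

lemma sqrt_weight_derivative:
  fixes z :: "'a::euclidean_space"
  assumes "e > 0"
  shows "((\<lambda>z. N * exp (l * snd z) * sqrt (fst z \<bullet> fst z + e\<^sup>2)) has_derivative
     (\<bullet>) ((N * exp (l * t) / sqrt (z \<bullet> z + e\<^sup>2)) *\<^sub>R z, l * N * exp (l * t) * sqrt (z \<bullet> z + e\<^sup>2))) (at (z, t))"
proof -
  have p: "z \<bullet> z + e\<^sup>2 > 0" using assms by (simp add: add_nonneg_pos)
  have d1: "((\<lambda>z::'a \<times> real. sqrt (fst z \<bullet> fst z + e\<^sup>2)) has_derivative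
      (\<lambda>h. 2 * (z \<bullet> fst h) * (inverse (sqrt (z \<bullet> z + e\<^sup>2)) / 2))) (at (z, t))"
    by (rule has_derivative_eq_rhs[OF DERIV_compose_FDERIV[where f = sqrt and
          g = "\<lambda>z::'a \<times> real. fst z \<bullet> fst z + e\<^sup>2", OF DERIV_real_sqrt]])
      (use p in \<open>auto intro!: derivative_eq_intros simp: inner_commute fun_eq_iff\<close>)
  have d2: "((\<lambda>z::'a \<times> real. N * exp (l * snd z)) has_derivative (\<lambda>h. N * (l * snd h * exp (l * t)))) (at (z, t))"
    by (auto intro!: derivative_eq_intros)
  have key: "N * E * (2 * i * (inverse s / 2)) + N * (l * k * E) * s = N * E / s * i + l * N * E * s * k"
    for E i s k :: real by (simp add: inverse_eq_divide algebra_simps)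
  show ?thesis
    by (rule has_derivative_eq_rhs[OF has_derivative_mult[OF d2 d1]], rule ext)
      (simp only: fst_conv snd_conv inner_prod_def inner_scaleR_left inner_real_def key)
qed

lemma norm_le_sqrt_weight: "norm z \<le> sqrt (z \<bullet> z + e\<^sup>2)"
  unfolding norm_eq_sqrt_inner by (rule real_sqrt_le_mono) simp

lemma signed_distance_uminus: "signed_distance (\<lambda>x t. - w x t) x t = - signed_distance w x t"
proof -
  have z: "zero_level (\<lambda>x t. - w x t) t = zero_level w t" by (simp add: zero_level_def)
  have "infdist x (zero_level w t) = 0" if "w x t = 0" using that by (intro infdist_zero) (simp add: zero_level_def)
  then show ?thesis by (auto simp: signed_distance_def z)
qed

subsection \<open>The reinitialization equation\<close>

text \<open>The hypotheses are put in a form invariant under the change of sign of all unknowns, so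
  that every one-sided estimate has a mirror image by interpreting the locale again.\<close>

locale reinit =
  fixes T L L1 L2 bL B :: real and u0 :: "'a::euclidean_space \<Rightarrow> real"
    and H :: "'a \<Rightarrow> real \<Rightarrow> 'a \<Rightarrow> real" and \<beta> :: "real \<Rightarrow> real" and h :: "'a \<Rightarrow> real"
    and w :: "'a \<times> real \<Rightarrow> real" and u :: "real \<Rightarrow> 'a \<times> real \<Rightarrow> real"
  assumes T: "T > 0" and L: "L \<ge> 0" and L1: "L1 > 0" and L2: "L2 > 0" and bL: "bL > 0"
    and u0: "\<And>x y. \<bar>u0 x - u0 y\<bar> \<le> L * norm (x - y)"
    and H_cont: "continuous_on (UNIV \<times> {0..T} \<times> UNIV) (\<lambda>(x, t, p). H x t p)"
    and H_hom: "\<And>c x t p. c > 0 \<Longrightarrow> 0 \<le> t \<Longrightarrow> t \<le> T \<Longrightarrow> H x t (c *\<^sub>R p) = c * H x t p"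
    and H_x: "\<And>x y t p. 0 \<le> t \<Longrightarrow> t \<le> T \<Longrightarrow> \<bar>H x t p - H y t p\<bar> \<le> L1 * norm (x - y) * norm p"
    and H_p: "\<And>x t p q. 0 \<le> t \<Longrightarrow> t \<le> T \<Longrightarrow> \<bar>H x t p - H x t q\<bar> \<le> L2 * norm (p - q)"
    and \<beta>_lip: "\<And>r s. \<bar>\<beta> r - \<beta> s\<bar> \<le> bL * \<bar>r - s\<bar>"
    and \<beta>_mono: "mono \<beta>" and \<beta>_bd: "\<And>r. \<bar>\<beta> r\<bar> \<le> B" and \<beta>_0: "\<beta> 0 = 0"
    and \<beta>_pos: "\<And>r. r > 0 \<Longrightarrow> \<beta> r > 0" and \<beta>_neg: "\<And>r. r < 0 \<Longrightarrow> \<beta> r < 0"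
    and h_uc: "uniformly_continuous_on UNIV h"
    and h_pos: "\<And>p. norm p < 1 \<Longrightarrow> h p > 0" and h_neg: "\<And>p. norm p > 1 \<Longrightarrow> h p < 0"
    and w: "jet_ivp (reinit_op H \<beta> h 0) T u0 w"
    and u: "\<And>\<theta>. \<theta> > 0 \<Longrightarrow> jet_ivp (reinit_op H \<beta> h \<theta>) T u0 (u \<theta>)"
begin

text \<open>The conditions on the signs of \<open>\<beta>\<close> and on the level 1 of
  \<open>norm p\<close> are symmetric, so \<open>- u\<close> solves an equation of the same type
  with reflected coefficients.\<close>

lemma dual: "reinit T L L1 L2 bL B (\<lambda>x. - u0 x) (\<lambda>x t p. - H x t (- p)) (\<lambda>r. - \<beta> (- r)) (\<lambda>p. h (- p))
  (\<lambda>z. - w z) (\<lambda>\<theta> z. - u \<theta> z)"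
proof unfold_locales
  show "continuous_on (UNIV \<times> {0..T} \<times> UNIV) (\<lambda>(x, t, p). - H x t (- p))"
  proof -
    have "continuous_on (UNIV \<times> {0..T} \<times> UNIV) (\<lambda>m. (\<lambda>(x, t, p). H x t p) (fst m, fst (snd m), - snd (snd m)))"
      by (rule continuous_on_compose2[OF H_cont]) (auto intro!: continuous_intros)
    then show ?thesis by (auto simp: case_prod_unfold intro!: continuous_intros)
  qed
  show "- H x t (- (c *\<^sub>R p)) = c * - H x t (- p)" if "c > 0" "0 \<le> t" "t \<le> T" for c x t p
    using H_hom[of c t x "- p"] that by simp
  show "\<bar>- H x t (- p) - - H y t (- p)\<bar> \<le> L1 * norm (x - y) * norm p" if "0 \<le> t" "t \<le> T" for x y t p
    using H_x[OF that, of x "- p" y] by (simp add: abs_minus_commute)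
  show "\<bar>- H x t (- p) - - H x t (- q)\<bar> \<le> L2 * norm (p - q)" if "0 \<le> t" "t \<le> T" for x t p q
    using H_p[OF that, of x "- p" "- q"] by (simp add: abs_minus_commute norm_minus_commute)
  show "uniformly_continuous_on UNIV (\<lambda>p. h (- p))"
    unfolding uniformly_continuous_on_def dist_norm
  proof (intro allI impI)
    fix e :: real assume "e > 0"
    then obtain d where "d > 0" "\<And>p q. norm (q - p) < d \<Longrightarrow> norm (h q - h p) < e"
      using h_uc unfolding uniformly_continuous_on_def dist_norm by auto
    then show "\<exists>d>0. \<forall>p\<in>UNIV. \<forall>q\<in>UNIV. norm (q - p) < d \<longrightarrow> norm (h (- q) - h (- p)) < e"
      by (intro exI[of _ d]) (auto simp: norm_minus_commute)
  qed
  show "mono (\<lambda>r. - \<beta> (- r))" using \<beta>_mono by (auto simp: mono_def)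
  show "\<bar>- \<beta> (- r) - - \<beta> (- s)\<bar> \<le> bL * \<bar>r - s\<bar>" for r s
    using \<beta>_lip[of "- r" "- s"] by (simp add: abs_minus_commute)
  show "jet_ivp (reinit_op (\<lambda>x t p. - H x t (- p)) (\<lambda>r. - \<beta> (- r)) (\<lambda>p. h (- p)) 0) T (\<lambda>x. - u0 x) (\<lambda>z. - w z)"
    using jet_ivp_dual[OF w] by (simp add: dual_reinit_op)
  show "jet_ivp (reinit_op (\<lambda>x t p. - H x t (- p)) (\<lambda>r. - \<beta> (- r)) (\<lambda>p. h (- p)) \<theta>) T (\<lambda>x. - u0 x) (\<lambda>z. - u \<theta> z)"
    if "\<theta> > 0" for \<theta> using jet_ivp_dual[OF u[OF that]] by (simp add: dual_reinit_op)
  show "\<bar>- u0 x - - u0 y\<bar> \<le> L * norm (x - y)" for x y using u0[of x y] by (simp add: abs_minus_commute)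
qed (use T L L1 L2 bL \<beta>_bd \<beta>_0 \<beta>_pos \<beta>_neg h_pos h_neg in auto)

abbreviation "Q \<equiv> (UNIV :: 'a set) \<times> {0<..<T}"
abbreviation "op \<equiv> reinit_op H \<beta> h"

lemma open_Q: "open Q"
  by (auto intro!: open_Times)

lemma \<beta>_cont: "continuous_on A \<beta>"
  by (rule lipschitz_on_continuous_on[of bL]) (use \<beta>_lip bL in \<open>auto intro!: lipschitz_onI simp: dist_real_def\<close>)

lemma h_cont: "continuous_on A h"
  using uniformly_continuous_imp_continuous[OF h_uc] continuous_on_subset by blast

lemma op_cont:
  assumes "D \<subseteq> Q"
  shows "continuous_on {(x, t, r, p). (x, t) \<in> D} (\<lambda>(x, t, r, p). op \<theta> x t r p)"
  using assms by (intro reinit_op_continuous[OF H_cont \<beta>_cont h_cont]) auto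

lemma dual_op_cont:
  assumes "D \<subseteq> Q"
  shows "continuous_on {(x, t, r, p). (x, t) \<in> D} (\<lambda>(x, t, r, p). dual (op \<theta>) x t r p)"
  unfolding dual_reinit_op by (rule reinit.op_cont[OF dual assms])

section \<open>Elementary bounds on the coefficients\<close>

lemma H_diff:
  assumes "0 \<le> t" "t \<le> T"
  shows "H x t (g + \<delta>) - H y t g \<le> L2 * norm \<delta> + L1 * norm (x - y) * norm g"
  using H_p[OF assms, of x "g + \<delta>" g] H_x[OF assms, of x g y] by simp

lemma H_0: "0 \<le> t \<Longrightarrow> t \<le> T \<Longrightarrow> H x t 0 = 0"
  using H_hom[of 2 t x 0] by simp

lemma H_bound: "0 \<le> t \<Longrightarrow> t \<le> T \<Longrightarrow> \<bar>H x t p\<bar> \<le> L2 * norm p"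
  using H_p[of t x p 0] H_0[of t x] by simp

lemma B_nonneg: "B \<ge> 0"
  using \<beta>_bd[of 0] by simp

lemma h_uc': "e > 0 \<Longrightarrow> \<exists>\<gamma>>0. \<forall>p \<delta>. norm \<delta> \<le> \<gamma> \<longrightarrow> \<bar>h (p + \<delta>) - h p\<bar> \<le> e"
proof -
  assume "e > 0"
  then obtain d where d: "d > 0" "\<And>p q. norm (q - p) < d \<Longrightarrow> \<bar>h q - h p\<bar> < e"
    using h_uc unfolding uniformly_continuous_on_def dist_norm real_norm_def by auto
  then show ?thesis by (intro exI[of _ "d / 2"]) (auto intro!: less_imp_le d(2))
qed

text \<open>Outside the closed unit ball \<open>h\<close> is negative, and on the ball it is bounded
  by compactness.\<close>

lemma h_upper: "\<exists>M>0. \<forall>p. h p \<le> M"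
proof -
  obtain p where p: "\<And>q. q \<in> cball 0 1 \<Longrightarrow> h q \<le> h p"
    using continuous_attains_sup[OF compact_cball _ h_cont, of "0::'a" 1] by (metis cball_eq_empty not_one_less_zero)
  have "h q \<le> max (h p) 1" for q
    using p[of q] h_neg[of q] by (cases "norm q \<le> 1") auto
  then show ?thesis by (intro exI[of _ "max (h p) 1"]) auto
qed

text \<open>A Lipschitz constant in space for \<open>w\<close> and all \<open>u \<theta>\<close>.
  The summand 2 makes the initial slope exceed 1, where \<open>h\<close> is negative, and also
  exceed \<open>L\<close>, which confines \<open>norm (x - y)\<close> in the doubling. The
  exponential pays for the dependence of \<open>H\<close> on \<open>x\<close>.\<close>

definition "M = (L + 2) * exp (L1 * T)"

lemma M_ge: "M \<ge> L + 2" "M \<ge> 2" "M > 0"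
proof -
  have "exp (L1 * T) \<ge> 1" using L1 T by simp
  then show "M \<ge> L + 2" using L by (simp add: M_def mult_le_cancel_left1)
  then show "M \<ge> 2" "M > 0" using L by auto
qed

text \<open>Both points are tested with the same gradient \<open>g\<close> up to a small error, so
  the source contributes \<open>(\<beta> (U (x, t)) - \<beta> (U (y, t))) * h g\<close>, which is
  nonpositive. The variation of \<open>H\<close> in \<open>x\<close> costs
  \<open>L1 * norm (x - y) * norm g\<close>, exactly the time derivative of the weight. The
  difference vanishes on the diagonal, so the weight is differentiable wherever it is
  exceeded.\<close>

lemma space_lipschitz:
  assumes U: "jet_ivp (op \<theta>) T u0 U" and \<theta>: "\<theta> \<ge> 0" and t: "0 \<le> t" "t < T"
  shows "\<bar>U (x, t) - U (y, t)\<bar> \<le> M * norm (x - y)"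
proof -
  obtain K where K: "K > 0" "\<And>x t. 0 \<le> t \<Longrightarrow> t < T \<Longrightarrow> \<bar>U (x, t) - u0 x\<bar> \<le> K * t"
    using U by (auto simp: jet_ivp_def)
  have cU: "continuous_on (UNIV \<times> {0..<T}) U" and i: "\<And>x. U (x, 0) = u0 x" using U by (auto simp: jet_ivp_def)
  let ?\<psi> = "\<lambda>z::'a \<times> real. (L + 2) * exp (L1 * snd z) * norm (fst z)"
  let ?g = "\<lambda>(z::'a) t. ((L + 2) * exp (L1 * t) / norm z) *\<^sub>R z"
  let ?b = "\<lambda>(z::'a) t. L1 * (L + 2) * exp (L1 * t) * norm z"
  have \<psi>: "(L + 2) * norm z \<le> ?\<psi> (z, t)" if "t \<ge> 0" for z t
  proof -
    have "(L + 2) * 1 \<le> (L + 2) * exp (L1 * t)" using that L1 L by (intro mult_left_mono) auto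
    then show ?thesis by (simp add: mult_right_mono)
  qed
  have ng: "norm (?g z t) = (L + 2) * exp (L1 * t)" if "z \<noteq> 0" for z t using that L by simp
  have est: "U (x, t) + - U (y, t) \<le> ?\<psi> (x - y, t)" for x y
  proof (rule doubling_principle[where U = U and V = "\<lambda>z. - U z" and F = "op \<theta>" and G = "dual (op \<theta>)" and D = Q and E = Q
        and T = T and \<psi> = ?\<psi> and g = ?g and b = ?b and C = "2 * K * T"])
    show "jetsub (op \<theta>) Q U" "jetsub (dual (op \<theta>)) Q (\<lambda>z. - U z)" using U by (auto simp: jet_ivp_def)
    show "continuous_on (UNIV \<times> {0..<T}) U" "continuous_on (UNIV \<times> {0..<T}) (\<lambda>z. - U z)"
      using cU by (auto intro!: continuous_intros)
    show "continuous_on UNIV ?\<psi>" by (intro continuous_intros)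
    show "U (x, 0) + - U (y, 0) \<le> ?\<psi> (x - y, 0)" for x y
      using u0[of x y] by (simp add: i algebra_simps) (smt (verit) norm_ge_zero)
    fix x y t assume t: "t < T"
    {
      assume t0: "0 \<le> t" and "?\<psi> (x - y, t) < U (x, t) + - U (y, t)"
      have KT: "K * t \<le> K * T" using t t0 K by simp
      have "U (x, t) + - U (y, t) \<le> L * norm (x - y) + 2 * K * T"
        using K(2)[OF t0 t, of x] K(2)[OF t0 t, of y] u0[of x y] KT by linarith
      moreover have "?\<psi> (x - y, t) \<ge> L * norm (x - y) + 2 * norm (x - y)" using \<psi>[OF t0, of "x - y"] by (simp add: algebra_simps)
      ultimately have "U (x, t) + - U (y, t) - ?\<psi> (x - y, t) \<le> 2 * K * T - 2 * norm (x - y)" by linarith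
      then show "U (x, t) + - U (y, t) - ?\<psi> (x - y, t) \<le> 2 * K * T \<and> norm (x - y) \<le> 2 * K * T"
        using \<open>?\<psi> (x - y, t) < U (x, t) + - U (y, t)\<close> norm_ge_zero[of "x - y"] by linarith
    next
      assume t0: "0 < t" and "?\<psi> (x - y, t) < U (x, t) + - U (y, t)"
      then have "x - y \<noteq> 0" by auto
      then show "(x, t) \<in> Q \<and> (y, t) \<in> Q \<and> (?\<psi> has_derivative (\<bullet>) (?g (x - y) t, ?b (x - y) t)) (at (x - y, t))"
        using t t0 norm_weight_derivative[of "x - y" "L + 2" L1 t] by auto
    }
  next
    fix \<eta> :: real assume \<eta>: "\<eta> > 0"
    \<comment> \<open>The error \<open>\<delta>\<close> in the gradient changes the source by at
      most \<open>\<theta> * B * e\<close>. The resulting \<open>\<gamma>\<close> depends on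
      \<theta>, but it disappears from the final bound.\<close>
    define e where "e = \<eta> / (3 * (\<theta> * B + 1))"
    have p: "\<theta> * B + 1 > 0" using \<theta> B_nonneg by (simp add: add_nonneg_pos)
    then have e: "e > 0" using \<eta> by (simp add: e_def)
    have eB: "\<theta> * B * e \<le> \<eta> / 3"
    proof -
      have "(\<theta> * B + 1) * e = \<eta> / 3" using p unfolding e_def by (simp only: times_divide_eq_right) (simp add: divide_eq_eq)
      then show ?thesis using e by (simp add: algebra_simps)
    qed
    obtain \<gamma> where \<gamma>: "\<gamma> > 0" "\<And>p \<delta>. norm \<delta> \<le> \<gamma> \<Longrightarrow> \<bar>h (p + \<delta>) - h p\<bar> \<le> e" using h_uc'[OF e] by blast
    have "op \<theta> x t (U (x, t)) (?g (x - y) t + \<delta>) + dual (op \<theta>) y t (- U (y, t)) (- ?g (x - y) t) < ?b (x - y) t + \<eta>"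
      if t: "0 < t" "t < T" and gt: "?\<psi> (x - y, t) < U (x, t) + - U (y, t)" and \<delta>: "norm \<delta> \<le> min \<gamma> (\<eta> / (3 * L2))" for x y t \<delta>
    proof -
      have ne: "x - y \<noteq> 0" using gt by auto
      have Ug: "U (x, t) > U (y, t)" using gt \<psi>[of t "x - y"] t L by (smt (verit) mult_nonneg_nonneg norm_ge_zero)
      define g where "g = ?g (x - y) t"
      have gn: "norm g = (L + 2) * exp (L1 * t)" using ng[OF ne] by (simp add: g_def)
      have "norm g \<ge> (L + 2) * 1" unfolding gn using L L1 t by (intro mult_left_mono) auto
      moreover have "(L + 2) * 1 > 1" using L by simp
      ultimately have "norm g > 1" by (rule less_le_trans[rotated])
      then have hg: "h g < 0" by (rule h_neg)
      have tt: "0 \<le> t" "t \<le> T" using t by auto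
      have "L2 * norm \<delta> \<le> L2 * (\<eta> / (3 * L2))" using \<delta> L2 by (intro mult_left_mono) auto
      also have "\<dots> = \<eta> / 3" using L2 by simp
      finally have 1: "L2 * norm \<delta> \<le> \<eta> / 3" .
      have 2: "L1 * norm (x - y) * norm g = ?b (x - y) t" by (simp add: gn)
      have "\<beta> (U (x, t)) * (h (g + \<delta>) - h g) \<le> \<bar>\<beta> (U (x, t))\<bar> * \<bar>h (g + \<delta>) - h g\<bar>"
        by (metis abs_ge_self abs_mult)
      also have "\<dots> \<le> B * e" using \<beta>_bd \<gamma>(2) \<delta> B_nonneg by (intro mult_mono) auto
      finally have "\<theta> * (\<beta> (U (x, t)) * (h (g + \<delta>) - h g)) \<le> \<theta> * (B * e)" using \<theta> by (rule mult_left_mono)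
      then have 3: "\<theta> * (\<beta> (U (x, t)) * (h (g + \<delta>) - h g)) \<le> \<eta> / 3" using eB unfolding mult.assoc by linarith
      have "\<beta> (U (y, t)) \<le> \<beta> (U (x, t))" using \<beta>_mono Ug by (simp add: monoD)
      then have 4: "\<theta> * ((\<beta> (U (x, t)) - \<beta> (U (y, t))) * h g) \<le> 0" using \<theta> hg by (simp add: mult_nonneg_nonpos)
      have "op \<theta> x t (U (x, t)) (g + \<delta>) + dual (op \<theta>) y t (- U (y, t)) (- g) =
        (H x t (g + \<delta>) - H y t g) + \<theta> * (\<beta> (U (x, t)) * (h (g + \<delta>) - h g)) + \<theta> * ((\<beta> (U (x, t)) - \<beta> (U (y, t))) * h g)"
        by (simp add: reinit_op_def dual_def algebra_simps)
      then show ?thesis using H_diff[OF tt, of x g \<delta> y] 1 2 3 4 \<eta> unfolding g_def[symmetric] by linarith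
    qed
    then show "\<exists>\<gamma>>0. \<forall>x y t \<delta>. 0 < t \<longrightarrow> t < T \<longrightarrow> ?\<psi> (x - y, t) < U (x, t) + - U (y, t) \<longrightarrow>
       norm \<delta> \<le> \<gamma> \<longrightarrow> op \<theta> x t (U (x, t)) (?g (x - y) t + \<delta>) + dual (op \<theta>) y t (- U (y, t)) (- ?g (x - y) t) < ?b (x - y) t + \<eta>"
      using \<gamma>(1) \<eta> L2 by (intro exI[of _ "min \<gamma> (\<eta> / (3 * L2))"]) auto
  qed (use t open_Q op_cont[OF order_refl] dual_op_cont[OF order_refl] in auto)
  have "?\<psi> (x - y, t) \<le> M * norm (x - y)" for x y
    using t L L1 by (auto simp: M_def intro!: mult_mono)
  then show ?thesis using est[of x y] est[of y x] by (smt (verit) norm_minus_commute)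
qed

text \<open>
  On \<open>{u \<theta> < 0}\<close> the source term is at least \<open>k (u \<theta>)\<close>, so it is absorbed by the exponential factor.
\<close>

lemma supersolution_time_change:
  assumes "\<theta> > 0" "k \<ge> 0" "\<And>p. \<theta> * bL * h p \<le> k"
  shows "jetsub (dual (op 0)) (Q \<inter> {z. u \<theta> z < 0}) (\<lambda>z. exp (- k * snd z) * - u \<theta> z)"
  unfolding jetsub_def
proof (intro allI impI)
  fix x t p a assume z: "(x, t) \<in> Q \<inter> {z. u \<theta> z < 0}"
    and s: "supergrad UNIV (\<lambda>z. exp (- k * snd z) * - u \<theta> z) (x, t) (p, a)"
  have t: "0 \<le> t" "t \<le> T" and neg: "u \<theta> (x, t) < 0" using z by auto
  let ?q = "- (exp (k * t) *\<^sub>R p)"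
  have "jetsub (dual (op \<theta>)) Q (\<lambda>z. - u \<theta> z)" using u[OF assms(1)] by (simp add: jet_ivp_def)
  from jetsubD[OF this _ supergrad_exp_time[OF s]] z
  have 1: "exp (k * t) * a - k * u \<theta> (x, t) \<le> - (H x t ?q + \<theta> * \<beta> (u \<theta> (x, t)) * h ?q)"
    by (simp add: dual_def reinit_op_def)
  have 2: "H x t ?q = exp (k * t) * H x t (- p)" using H_hom[OF _ t, of "exp (k * t)" x "- p"] by simp
  \<comment> \<open>The Lipschitz bound at 0 gives \<open>bL * r \<le> \<beta> r\<close> for
    negative \<open>r\<close>. It handles gradients with \<open>h \<ge> 0\<close>; for the others
    the source is already nonnegative.\<close>
  have b: "bL * u \<theta> (x, t) \<le> \<beta> (u \<theta> (x, t))" "\<beta> (u \<theta> (x, t)) < 0"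
    using \<beta>_lip[of "u \<theta> (x, t)" 0] \<beta>_neg[OF neg] neg by (auto simp: \<beta>_0)
  have 3: "k * u \<theta> (x, t) \<le> \<theta> * \<beta> (u \<theta> (x, t)) * h ?q"
  proof (cases "h ?q \<ge> 0")
    case True
    have "k * u \<theta> (x, t) \<le> (\<theta> * bL * h ?q) * u \<theta> (x, t)"
      using assms(3)[of ?q] neg by (intro mult_right_mono_neg) auto
    also have "\<dots> = (\<theta> * h ?q) * (bL * u \<theta> (x, t))" by simp
    also have "\<dots> \<le> (\<theta> * h ?q) * \<beta> (u \<theta> (x, t))" using True assms(1) b by (intro mult_left_mono) auto
    finally show ?thesis by (simp add: mult_ac)
  next
    case False
    have "k * u \<theta> (x, t) \<le> 0" using assms(2) neg by (simp add: mult_nonneg_nonpos)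
    moreover have "\<theta> * \<beta> (u \<theta> (x, t)) * h ?q \<ge> 0" using False b assms(1) by (simp add: mult_nonpos_nonpos mult_nonneg_nonpos)
    ultimately show ?thesis by linarith
  qed
  have "exp (k * t) * a \<le> exp (k * t) * - H x t (- p)" using 1 2 3 by simp
  then have "a \<le> - H x t (- p)" by (simp only: mult_le_cancel_left_pos exp_gt_zero)
  then show "a \<le> dual (op 0) x t (exp (- k * snd (x, t)) * - u \<theta> (x, t)) p"
    by (simp add: dual_def reinit_op_def)
qed

text \<open>The whole space-time gradient is multiplied by one positive number, which cancels
  because \<open>H\<close> is homogeneous of degree one.\<close>

lemma subsolution_exp_change:
  assumes "jetsub (op 0) D f" "D \<subseteq> Q" "\<sigma> > 0"
  shows "jetsub (op 0) D (\<lambda>z. - exp (- \<sigma> * f z) / \<sigma>)"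
  unfolding jetsub_def
proof (intro allI impI)
  fix x t p a assume z: "(x, t) \<in> D" and s: "supergrad UNIV (\<lambda>z. - exp (- \<sigma> * f z) / \<sigma>) (x, t) (p, a)"
  obtain c where c: "c > 0" "supergrad UNIV f (x, t) (c *\<^sub>R p, c *\<^sub>R a)"
    using supergrad_exp_change[OF s assms(3)] by auto
  have "c * a \<le> H x t (c *\<^sub>R p)" using jetsubD[OF assms(1) z c(2)] by (simp add: reinit_op_def)
  also have "\<dots> = c * H x t p" using z assms(2) c by (intro H_hom) auto
  finally show "a \<le> op 0 x t (- exp (- \<sigma> * f (x, t)) / \<sigma>) p" using c by (simp add: reinit_op_def)
qed

text \<open>The first bound controls the slopes at which \<open>h\<close> is evaluated, the second
  lets the growth of the weight absorb the dependence of \<open>H\<close> on \<open>x\<close>, and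
  the third compares the weight with the initial cone.\<close>

lemma sqrt_weight_bounds:
  fixes z :: 'a
  assumes "N \<ge> 0" "t \<ge> 0" "e > 0"
  defines "g \<equiv> (N * exp (L1 * t) / sqrt (z \<bullet> z + e\<^sup>2)) *\<^sub>R z"
  shows "norm g \<le> N * exp (L1 * t)" "L1 * norm z * norm g \<le> L1 * N * exp (L1 * t) * sqrt (z \<bullet> z + e\<^sup>2)"
    "N * norm z \<le> N * exp (L1 * t) * sqrt (z \<bullet> z + e\<^sup>2)"
proof -
  have s: "norm z \<le> sqrt (z \<bullet> z + e\<^sup>2)" by (rule norm_le_sqrt_weight)
  have p: "sqrt (z \<bullet> z + e\<^sup>2) > 0" using assms by (simp add: add_nonneg_pos)
  have "norm g = N * exp (L1 * t) * (norm z / sqrt (z \<bullet> z + e\<^sup>2))" using assms p by (simp add: g_def)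
  also have "\<dots> \<le> N * exp (L1 * t) * 1" using s p assms by (intro mult_left_mono) (auto simp: divide_le_eq_1)
  finally show g: "norm g \<le> N * exp (L1 * t)" by simp
  have "norm z * norm g \<le> sqrt (z \<bullet> z + e\<^sup>2) * (N * exp (L1 * t))" using s g p by (intro mult_mono) auto
  then have "L1 * (norm z * norm g) \<le> L1 * (sqrt (z \<bullet> z + e\<^sup>2) * (N * exp (L1 * t)))" using L1 by simp
  then show "L1 * norm z * norm g \<le> L1 * N * exp (L1 * t) * sqrt (z \<bullet> z + e\<^sup>2)" by (simp add: mult_ac)
  have "N * 1 \<le> N * exp (L1 * t)" using assms L1 by (intro mult_left_mono) auto
  then show "N * norm z \<le> N * exp (L1 * t) * sqrt (z \<bullet> z + e\<^sup>2)" using s assms by (intro mult_mono) auto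
qed


subsection \<open>Preservation of the zero level\<close>

lemma w_props:
  "jetsub (op 0) Q w" "jetsub (dual (op 0)) Q (\<lambda>z. - w z)" "continuous_on (UNIV \<times> {0..<T}) w" "w (x, 0) = u0 x"
  using w by (auto simp: jet_ivp_def)

lemma u_props:
  assumes "\<theta> > 0"
  shows "jetsub (op \<theta>) Q (u \<theta>)" "jetsub (dual (op \<theta>)) Q (\<lambda>z. - u \<theta> z)"
    "continuous_on (UNIV \<times> {0..<T}) (u \<theta>)" "u \<theta> (x, 0) = u0 x"
  using u[OF assms] by (auto simp: jet_ivp_def)

lemma continuous_on_Q: "continuous_on (UNIV \<times> {0..<T}) f \<Longrightarrow> continuous_on Q f"
  by (rule continuous_on_subset) auto

lemma open_Q_less: "continuous_on Q f \<Longrightarrow> open (Q \<inter> {z. f z < (c::real)})"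
  using continuous_open_preimage[OF _ open_Q, of f "{..<c}"] by (simp add: vimage_def)

text \<open>The transformed \<open>w\<close> is negative everywhere. So if the sum in the doubling
  exceeds the nonnegative weight, then \<open>V\<close> is positive, that is,
  \<open>u \<theta>\<close> is negative at \<open>y\<close>, exactly where
  \<open>supersolution_time_change\<close> holds. Where \<open>w \<ge> 0\<close> the transformed
  value is at least \<open>- 1 / \<sigma>\<close>, which vanishes as \<open>\<sigma>\<close> grows.
  As \<open>k\<close> depends on \<theta>, only the sign of \<open>u \<theta>\<close> is
  gained.\<close>

lemma nonneg_preserved:
  assumes \<theta>: "\<theta> > 0" and t: "0 \<le> t" "t < T" and wx: "w (x, t) \<ge> 0"
  shows "u \<theta> (x, t) \<ge> 0"
proof -
  obtain Mh where Mh: "Mh > 0" "\<And>p. h p \<le> Mh" using h_upper by blast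
  define k where "k = \<theta> * bL * Mh"
  have k: "k \<ge> 0" "\<theta> * bL * h p \<le> k" for p using \<theta> bL Mh by (auto simp: k_def)
  obtain K where K: "K > 0" "\<And>x t. 0 \<le> t \<Longrightarrow> t < T \<Longrightarrow> \<bar>w (x, t) - u0 x\<bar> \<le> K * t"
    using w by (auto simp: jet_ivp_def)
  obtain K' where K': "K' > 0" "\<And>x t. 0 \<le> t \<Longrightarrow> t < T \<Longrightarrow> \<bar>u \<theta> (x, t) - u0 x\<bar> \<le> K' * t"
    using u[OF \<theta>] by (auto simp: jet_ivp_def)
  have main: "- exp (- \<sigma> * w (x, t)) / \<sigma> + exp (- k * t) * - u \<theta> (x, t) \<le> (L + 2) * exp (L1 * t) * sqrt (0 + e\<^sup>2)"
    if \<sigma>: "\<sigma> > 0" and e: "e > 0" for \<sigma> e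
  proof -
    define U where "U = (\<lambda>z. - exp (- \<sigma> * w z) / \<sigma>)"
    define V where "V = (\<lambda>z. exp (- k * snd z) * - u \<theta> z)"
    let ?\<psi> = "\<lambda>z::'a \<times> real. (L + 2) * exp (L1 * snd z) * sqrt (fst z \<bullet> fst z + e\<^sup>2)"
    let ?g = "\<lambda>(z::'a) t. ((L + 2) * exp (L1 * t) / sqrt (z \<bullet> z + e\<^sup>2)) *\<^sub>R z"
    let ?b = "\<lambda>(z::'a) t. L1 * (L + 2) * exp (L1 * t) * sqrt (z \<bullet> z + e\<^sup>2)"
    let ?E = "Q \<inter> {z. u \<theta> z < 0}"
    have L0: "L + 2 \<ge> 0" using L by simp
    note sw = sqrt_weight_bounds[OF L0 _ e]
    have Uneg: "U z < 0" for z using \<sigma> by (simp add: U_def)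
    have Uw: "U z \<le> w z" for z
    proof -
      have "1 + (- \<sigma> * w z) \<le> exp (- \<sigma> * w z)" by (rule exp_ge_add_one_self)
      then show ?thesis using \<sigma> by (simp add: U_def field_simps)
    qed
    have \<psi>0: "0 \<le> ?\<psi> z" for z using L0 by simp
    \<comment> \<open>Besides the sign, the sum is dominated by
      \<open>w (x, t) - u \<theta> (y, t)\<close>, so the linear bounds in time on both solutions
      confine the doubled points.\<close>
    have low: "u \<theta> (y, t) < 0 \<and> U (x, t) + V (y, t) \<le> w (x, t) - u \<theta> (y, t)"
      if "0 \<le> t" "?\<psi> (x - y, t) < U (x, t) + V (y, t)" for x y t
    proof -
      have "V (y, t) > 0" using that(2) \<psi>0[of "(x - y, t)"] Uneg[of "(x, t)"] by linarith
      then have neg: "u \<theta> (y, t) < 0" by (simp add: V_def zero_less_mult_iff mult_less_0_iff)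
      have "exp (- k * t) \<le> 1" using k(1) that(1) by simp
      then have "exp (- k * t) * - u \<theta> (y, t) \<le> 1 * - u \<theta> (y, t)" using neg by (intro mult_right_mono) auto
      then show ?thesis using neg Uw[of "(x, t)"] unfolding V_def snd_conv by linarith
    qed
    have "U (x, t) + V (x, t) \<le> ?\<psi> (x - x, t)"
    proof (rule doubling_principle[where U = U and V = V and F = "op 0" and G = "dual (op 0)" and D = Q and E = ?E
        and T = T and \<psi> = ?\<psi> and g = ?g and b = ?b and C = "K * T + K' * T"])
      show "jetsub (op 0) Q U" unfolding U_def by (rule subsolution_exp_change[OF w_props(1) order_refl \<sigma>])
      show "jetsub (dual (op 0)) ?E V" unfolding V_def by (rule supersolution_time_change[OF \<theta> k])
      show "continuous_on (UNIV \<times> {0..<T}) U" "continuous_on (UNIV \<times> {0..<T}) V"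
        unfolding U_def V_def using \<sigma> w_props(3) u_props(3)[OF \<theta>] by (auto intro!: continuous_intros)
      show "open ?E" by (rule open_Q_less[OF continuous_on_Q[OF u_props(3)[OF \<theta>]]])
      show "continuous_on UNIV ?\<psi>" by (intro continuous_intros)
      show "U (x, 0) + V (y, 0) \<le> ?\<psi> (x - y, 0)" for x y
      proof -
        have "U (x, 0) + V (y, 0) \<le> u0 x - u0 y" using Uw[of "(x, 0)"] by (simp add: V_def w_props u_props[OF \<theta>])
        also have "\<dots> \<le> L * norm (x - y)" using u0[of x y] by simp
        also have "\<dots> \<le> (L + 2) * norm (x - y)" by (intro mult_right_mono) auto
        also have "\<dots> \<le> ?\<psi> (x - y, 0)" using sw(3)[of 0 "x - y"] by simp
        finally show ?thesis .
      qed
      fix x y t assume t: "t < T"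
      {
        assume t0: "0 \<le> t" and gt: "?\<psi> (x - y, t) < U (x, t) + V (y, t)"
        have KT: "K * t \<le> K * T" "K' * t \<le> K' * T" using t t0 K K' by auto
        have "U (x, t) + V (y, t) \<le> K * T + K' * T + L * norm (x - y)"
          using low[OF t0 gt] K(2)[OF t0 t, of x] K'(2)[OF t0 t, of y] u0[of x y] KT by linarith
        moreover have "L * norm (x - y) + 2 * norm (x - y) \<le> ?\<psi> (x - y, t)"
          using sw(3)[OF t0, of "x - y"] by (simp add: algebra_simps)
        ultimately show "U (x, t) + V (y, t) - ?\<psi> (x - y, t) \<le> K * T + K' * T \<and> norm (x - y) \<le> K * T + K' * T"
          using gt norm_ge_zero[of "x - y"] by linarith
      next
        assume t0: "0 < t" and gt: "?\<psi> (x - y, t) < U (x, t) + V (y, t)"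
        then show "(x, t) \<in> Q \<and> (y, t) \<in> ?E \<and> (?\<psi> has_derivative (\<bullet>) (?g (x - y) t, ?b (x - y) t)) (at (x - y, t))"
          using t low[OF _ gt] sqrt_weight_derivative[OF e, where N = "L + 2" and l = L1 and z = "x - y" and t = t] by auto
      }
    next
      fix \<eta> :: real assume \<eta>: "\<eta> > 0"
      have "op 0 x t (U (x, t)) (?g (x - y) t + \<delta>) + dual (op 0) y t (V (y, t)) (- ?g (x - y) t) < ?b (x - y) t + \<eta>"
        if t: "0 < t" "t < T" and \<delta>: "norm \<delta> \<le> \<eta> / (2 * L2)" for x y t \<delta>
      proof -
        have tt: "0 \<le> t" "t \<le> T" using t by auto
        have "L2 * norm \<delta> \<le> L2 * (\<eta> / (2 * L2))" using \<delta> L2 by (intro mult_left_mono) auto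
        also have "\<dots> = \<eta> / 2" using L2 by simp
        finally have "L2 * norm \<delta> \<le> \<eta> / 2" .
        then show ?thesis using H_diff[OF tt, of x "?g (x - y) t" \<delta> y] sw(2)[OF tt(1), of "x - y"] \<eta>
          unfolding reinit_op_def dual_def by simp
      qed
      then show "\<exists>\<gamma>>0. \<forall>x y t \<delta>. 0 < t \<longrightarrow> t < T \<longrightarrow> ?\<psi> (x - y, t) < U (x, t) + V (y, t) \<longrightarrow>
         norm \<delta> \<le> \<gamma> \<longrightarrow> op 0 x t (U (x, t)) (?g (x - y) t + \<delta>) + dual (op 0) y t (V (y, t)) (- ?g (x - y) t) < ?b (x - y) t + \<eta>"
        using \<eta> L2 by (intro exI[of _ "\<eta> / (2 * L2)"]) auto
    qed (use t open_Q op_cont[OF order_refl] dual_op_cont[of ?E, OF Int_lower1] in auto)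
    then show ?thesis by (simp add: U_def V_def)
  qed
  have "- exp (- k * t) * u \<theta> (x, t) \<le> 1 / \<sigma> + \<sigma>'" if "\<sigma> > 0" "\<sigma>' > 0" for \<sigma> \<sigma>'
  proof -
    define e where "e = \<sigma>' / ((L + 2) * exp (L1 * t))"
    have p: "(L + 2) * exp (L1 * t) > 0" using L by simp
    then have e: "e > 0" "(L + 2) * exp (L1 * t) * e = \<sigma>'" using that by (auto simp: e_def)
    have "exp (- \<sigma> * w (x, t)) \<le> 1" using wx that by simp
    then have "exp (- \<sigma> * w (x, t)) / \<sigma> \<le> 1 / \<sigma>" using that by (simp add: divide_right_mono)
    moreover have "sqrt (0 + e\<^sup>2) = e" using e by simp
    ultimately show ?thesis using main[OF that(1) e(1)] e(2) by simp
  qed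
  note bound = this
  show ?thesis
  proof (rule ccontr)
    assume "\<not> ?thesis"
    then have "exp (- k * t) * - u \<theta> (x, t) > 0" by (intro mult_pos_pos) auto
    then obtain c where c: "c > 0" "c = exp (- k * t) * - u \<theta> (x, t)" by blast
    \<comment> \<open>With these parameters each of the two errors is a quarter of the supposed gap
      \<open>c\<close>.\<close>
    have "c \<le> 1 / (4 / c) + c / 4" using bound[of "4 / c" "c / 4"] c by simp
    with c(1) show False by simp
  qed
qed


text \<open>
  Once \<open>\<epsilon> w\<close> has Lipschitz constant at most \<open>1 / 2\<close>, the source term is nonnegative at its gradients,
  which is why \<open>\<epsilon>\<close> does not depend on \<open>\<theta>\<close>.
\<close>

lemma linear_lower_bound:
  obtains \<epsilon> where "\<epsilon> > 0" "\<And>\<theta> x t. \<theta> > 0 \<Longrightarrow> 0 \<le> t \<Longrightarrow> t < T \<Longrightarrow> w (x, t) \<ge> 0 \<Longrightarrow> \<epsilon> * w (x, t) \<le> u \<theta> (x, t)"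
proof -
  \<comment> \<open>With this choice \<open>N * exp (L1 * T) = 1 / 2\<close>, so the weight below
    has slopes at most 1 / 2, where \<open>h\<close> is positive.\<close>
  define \<epsilon> where "\<epsilon> = 1 / (2 * M * exp (L1 * T))"
  define N where "N = \<epsilon> * M"
  have ET: "exp (L1 * T) \<ge> 1" using L1 T by simp
  have "1 * 1 \<le> 2 * M * exp (L1 * T)" using ET M_ge by (intro mult_mono) auto
  then have \<epsilon>: "\<epsilon> > 0" "\<epsilon> \<le> 1" using M_ge by (auto simp: \<epsilon>_def divide_le_eq_1)
  have N: "N \<ge> 0" "N \<ge> \<epsilon> * (L + 2)" "N * exp (L1 * T) \<le> 1 / 2"
    using \<epsilon> M_ge by (auto simp: N_def intro!: mult_left_mono) (simp add: \<epsilon>_def)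
  obtain K where K: "K > 0" "\<And>x t. 0 \<le> t \<Longrightarrow> t < T \<Longrightarrow> \<bar>w (x, t) - u0 x\<bar> \<le> K * t"
    using w by (auto simp: jet_ivp_def)
  have wl: "\<bar>w (x, t) - w (y, t)\<bar> \<le> M * norm (x - y)" if "0 \<le> t" "t < T" for x y t
    by (rule space_lipschitz[OF w order_refl that])
  let ?E = "Q \<inter> {z. - w z < 0}"
  have E: "open ?E" by (rule open_Q_less) (intro continuous_intros continuous_on_Q w_props)
  define U where "U = (\<lambda>z. \<epsilon> * max 0 (w z))"
  have Uj: "jetsub (op 0) ?E U"
    unfolding jetsub_def
  proof (intro allI impI)
    fix x t p a assume z: "(x, t) \<in> ?E" and s: "supergrad UNIV U (x, t) (p, a)"
    have "\<forall>\<^sub>F z in nhds (x, t). z \<in> ?E" using E z by (rule eventually_nhds_in_open)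
    then have "\<forall>\<^sub>F z in nhds (x, t). U z = \<epsilon> * w z" by eventually_elim (simp add: U_def)
    from supergrad_scale[OF supergrad_cong[OF s this] \<epsilon>(1)]
    have "supergrad UNIV w (x, t) ((1 / \<epsilon>) *\<^sub>R p, (1 / \<epsilon>) *\<^sub>R a)" by simp
    from jetsubD[OF w_props(1) _ this] z have "(1 / \<epsilon>) * a \<le> H x t ((1 / \<epsilon>) *\<^sub>R p)" by (simp add: reinit_op_def)
    also have "\<dots> = (1 / \<epsilon>) * H x t p" using z \<epsilon> by (intro H_hom) auto
    finally show "a \<le> op 0 x t (U (x, t)) p" using \<epsilon> by (simp add: reinit_op_def field_simps)
  qed
  have cont: "continuous_on (UNIV \<times> {0..<T}) (\<lambda>z. max 0 (f z))" if "continuous_on (UNIV \<times> {0..<T}) f" for f :: "'a \<times> real \<Rightarrow> real"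
    using that by (auto intro!: continuous_intros)
  show ?thesis
  proof (rule that[OF \<epsilon>(1)])
    fix \<theta> x t assume \<theta>: "\<theta> > (0::real)" and t: "0 \<le> t" "t < T" and wx: "w (x, t) \<ge> 0"
    obtain K' where K': "K' > 0" "\<And>x t. 0 \<le> t \<Longrightarrow> t < T \<Longrightarrow> \<bar>u \<theta> (x, t) - u0 x\<bar> \<le> K' * t"
      using u[OF \<theta>] by (auto simp: jet_ivp_def)
    \<comment> \<open>By \<open>nonneg_preserved\<close> this equals \<open>- u \<theta>\<close>
      where \<open>w > 0\<close>, while it stays nonpositive everywhere, which forces
      \<open>U\<close> to be positive whenever the weight is exceeded.\<close>
    define V where "V = (\<lambda>z. - max 0 (u \<theta> z))"
    have Vj: "jetsub (dual (op \<theta>)) ?E V"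
      unfolding jetsub_def
    proof (intro allI impI)
      fix x t p a assume z: "(x, t) \<in> ?E" and s: "supergrad UNIV V (x, t) (p, a)"
      have "\<forall>\<^sub>F z in nhds (x, t). z \<in> ?E" using E z by (rule eventually_nhds_in_open)
      then have ev: "\<forall>\<^sub>F z in nhds (x, t). V z = - u \<theta> z"
      proof eventually_elim
        case (elim z)
        then have "u \<theta> (fst z, snd z) \<ge> 0" by (intro nonneg_preserved[OF \<theta>]) auto
        then show ?case by (simp add: V_def)
      qed
      have "V (x, t) = - u \<theta> (x, t)" using eventually_nhds_x_imp_x[OF ev] .
      with jetsubD[OF u_props(2)[OF \<theta>] _ supergrad_cong[OF s ev]] z
      show "a \<le> dual (op \<theta>) x t (V (x, t)) p" by simp
    qed
    define C0 where "C0 = K * T + K' * T"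
    have C0: "C0 \<ge> 0" using K K' T by (simp add: C0_def)
    have main: "U (x, t) + V (x, t) \<le> N * exp (L1 * t) * sqrt (0 + e\<^sup>2)" if e: "e > 0" for e
    proof -
      let ?\<psi> = "\<lambda>z::'a \<times> real. N * exp (L1 * snd z) * sqrt (fst z \<bullet> fst z + e\<^sup>2)"
      let ?g = "\<lambda>(z::'a) t. (N * exp (L1 * t) / sqrt (z \<bullet> z + e\<^sup>2)) *\<^sub>R z"
      let ?b = "\<lambda>(z::'a) t. L1 * N * exp (L1 * t) * sqrt (z \<bullet> z + e\<^sup>2)"
      note sw = sqrt_weight_bounds[OF N(1) _ e]
      have \<psi>0: "0 \<le> ?\<psi> z" for z using N by simp
      have "\<epsilon> * (L + 2) * norm (x - y) \<le> N * norm (x - y)" for x y :: 'a using N by (intro mult_right_mono) auto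
      then have \<psi>N: "\<epsilon> * (L * norm (x - y)) + 2 * \<epsilon> * norm (x - y) \<le> ?\<psi> (x - y, t)" if "0 \<le> t" for x y t
        using sw(3)[OF that, of "x - y"] by (simp add: algebra_simps) (smt (verit))
      \<comment> \<open>If \<open>w\<close> were nonpositive at \<open>y\<close>, the Lipschitz
        bound on \<open>w\<close> would give \<open>U (x, t) \<le> N * norm (x - y)\<close>, which
        the weight dominates. This is why \<open>N\<close> contains the factor
        \<open>M\<close>.\<close>
      have pos: "w (x, t) > 0 \<and> w (y, t) > 0" if "0 \<le> t" "t < T" "?\<psi> (x - y, t) < U (x, t) + V (y, t)" for x y t
      proof -
        have V0: "V (y, t) \<le> 0" by (simp add: V_def)
        then have "U (x, t) > 0" using that(3) \<psi>0[of "(x - y, t)"] by linarith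
        then have wx: "w (x, t) > 0" using \<epsilon> by (auto simp: U_def max_def zero_less_mult_iff split: if_splits)
        have "w (y, t) > 0"
        proof (rule ccontr)
          assume "\<not> ?thesis"
          then have "w (x, t) \<le> M * norm (x - y)" using wl[OF that(1,2), of x y] by simp
          then have "\<epsilon> * w (x, t) \<le> \<epsilon> * (M * norm (x - y))" using \<epsilon> by (intro mult_left_mono) auto
          then have "U (x, t) \<le> N * norm (x - y)" using wx by (simp add: U_def N_def)
          then show False using that(3) V0 sw(3)[OF that(1), of "x - y"] by simp
        qed
        with wx show ?thesis ..
      qed
      have "U (x, t) + V (x, t) \<le> ?\<psi> (x - x, t)"
      proof (rule doubling_principle[where U = U and V = V and F = "op 0" and G = "dual (op \<theta>)" and D = ?E and E = ?E
          and T = T and \<psi> = ?\<psi> and g = ?g and b = ?b and C = "C0 + C0 / (2 * \<epsilon>)"])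
        show "continuous_on (UNIV \<times> {0..<T}) U" "continuous_on (UNIV \<times> {0..<T}) V"
          unfolding U_def V_def using cont[OF w_props(3)] cont[OF u_props(3)[OF \<theta>]] by (auto intro!: continuous_intros)
        show "continuous_on UNIV ?\<psi>" by (intro continuous_intros)
        \<comment> \<open>One estimate serves both the initial comparison and the bound at later
          times; \<open>\<epsilon> \<le> 1\<close> allows the positive part of \<open>u0 y\<close>
          to be absorbed.\<close>
        have m: "\<epsilon> * max 0 a - max 0 b \<le> \<epsilon> * (L * norm (x - y)) + c" if "a \<le> u0 x + c1" "u0 y - c2 \<le> b" "0 \<le> c1" "0 \<le> c2" "c1 + c2 \<le> c"
          for a b c1 c2 c x y
        proof -
          have l: "u0 x - u0 y \<le> L * norm (x - y)" "0 \<le> L * norm (x - y)" using u0[of x y] L by auto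
          have "\<epsilon> * max 0 a \<le> \<epsilon> * (max 0 (u0 y) + L * norm (x - y) + c1)" using that l \<epsilon> by (intro mult_left_mono) auto
          moreover have "\<epsilon> * max 0 (u0 y) \<le> 1 * max 0 (u0 y)" "\<epsilon> * c1 \<le> 1 * c1" using \<epsilon> that by (intro mult_right_mono; simp)+
          moreover have "max 0 b \<ge> max 0 (u0 y) - c2" using that by auto
          ultimately show ?thesis using that by (simp add: distrib_left)
        qed
        show "U (x, 0) + V (y, 0) \<le> ?\<psi> (x - y, 0)" for x y
        proof -
          have "U (x, 0) + V (y, 0) \<le> \<epsilon> * (L * norm (x - y)) + 0"
            using m[of "u0 x" x 0 y 0 "u0 y" 0] by (simp add: U_def V_def w_props u_props[OF \<theta>])
          also have "\<dots> \<le> ?\<psi> (x - y, 0)"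
          proof -
            have "2 * \<epsilon> * norm (x - y) \<ge> 0" using \<epsilon> by simp
            then show ?thesis using \<psi>N[of 0 x y] by linarith
          qed
          finally show ?thesis .
        qed
        fix x y t assume t: "t < T"
        {
          assume t0: "0 \<le> t" and gt: "?\<psi> (x - y, t) < U (x, t) + V (y, t)"
          have KT: "K * t \<le> K * T" "K' * t \<le> K' * T" "0 \<le> K * t" "0 \<le> K' * t" using t t0 K K' by auto
          have "U (x, t) + V (y, t) \<le> \<epsilon> * (L * norm (x - y)) + C0"
            using m[of "w (x, t)" x "K * t" y "K' * t" "u \<theta> (y, t)" C0] K(2)[OF t0 t, of x] K'(2)[OF t0 t, of y] KT
            by (simp add: U_def V_def C0_def)
          then have *: "U (x, t) + V (y, t) - ?\<psi> (x - y, t) \<le> C0 - 2 * \<epsilon> * norm (x - y)" using \<psi>N[OF t0, of x y] by linarith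
          then have "norm (x - y) \<le> C0 / (2 * \<epsilon>)" using gt \<epsilon> by (simp add: pos_le_divide_eq mult.commute mult.left_commute)
          moreover have "C0 / (2 * \<epsilon>) \<ge> 0" "2 * \<epsilon> * norm (x - y) \<ge> 0" using C0 \<epsilon> by auto
          ultimately show "U (x, t) + V (y, t) - ?\<psi> (x - y, t) \<le> C0 + C0 / (2 * \<epsilon>) \<and> norm (x - y) \<le> C0 + C0 / (2 * \<epsilon>)"
            using * C0 by linarith
        next
          assume t0: "0 < t" and gt: "?\<psi> (x - y, t) < U (x, t) + V (y, t)"
          then show "(x, t) \<in> ?E \<and> (y, t) \<in> ?E \<and> (?\<psi> has_derivative (\<bullet>) (?g (x - y) t, ?b (x - y) t)) (at (x - y, t))"
            using t pos[OF _ t gt] sqrt_weight_derivative[OF e, where N = N and l = L1 and z = "x - y" and t = t] by auto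
        }
      next
        fix \<eta> :: real assume \<eta>: "\<eta> > 0"
        have "op 0 x t (U (x, t)) (?g (x - y) t + \<delta>) + dual (op \<theta>) y t (V (y, t)) (- ?g (x - y) t) < ?b (x - y) t + \<eta>"
          if t: "0 < t" "t < T" and \<delta>: "norm \<delta> \<le> \<eta> / (2 * L2)" for x y t \<delta>
        proof -
          have tt: "0 \<le> t" "t \<le> T" using t by auto
          have "L2 * norm \<delta> \<le> L2 * (\<eta> / (2 * L2))" using \<delta> L2 by (intro mult_left_mono) auto
          also have "\<dots> = \<eta> / 2" using L2 by simp
          finally have 1: "L2 * norm \<delta> \<le> \<eta> / 2" .
          define g where "g = ?g (x - y) t"
          have "norm g \<le> N * exp (L1 * t)" using sw(1)[OF tt(1)] by (simp add: g_def)
          also have "\<dots> \<le> N * exp (L1 * T)" using N L1 tt by (intro mult_left_mono) auto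
          finally have "h g > 0" using N by (intro h_pos) linarith
          moreover have "\<beta> (max 0 (u \<theta> (y, t))) \<ge> 0" using monoD[OF \<beta>_mono, of 0 "max 0 (u \<theta> (y, t))"] by (simp add: \<beta>_0)
          ultimately have "\<theta> * \<beta> (max 0 (u \<theta> (y, t))) * h g \<ge> 0" using \<theta> by simp
          then show ?thesis using H_diff[OF tt, of x g \<delta> y] sw(2)[OF tt(1), of "x - y"] \<eta> 1
            unfolding reinit_op_def dual_def V_def g_def[symmetric] by simp
        qed
        then show "\<exists>\<gamma>>0. \<forall>x y t \<delta>. 0 < t \<longrightarrow> t < T \<longrightarrow> ?\<psi> (x - y, t) < U (x, t) + V (y, t) \<longrightarrow>
           norm \<delta> \<le> \<gamma> \<longrightarrow> op 0 x t (U (x, t)) (?g (x - y) t + \<delta>) + dual (op \<theta>) y t (V (y, t)) (- ?g (x - y) t) < ?b (x - y) t + \<eta>"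
          using \<eta> L2 by (intro exI[of _ "\<eta> / (2 * L2)"]) auto
      qed (use t E Uj Vj op_cont[of ?E, OF Int_lower1] dual_op_cont[of ?E, OF Int_lower1] in auto)
      then show ?thesis by simp
    qed
    have "U (x, t) + V (x, t) \<le> 0"
    proof (rule ccontr)
      assume "\<not> ?thesis"
      then have c: "U (x, t) + V (x, t) > 0" (is "?c > 0") by simp
      \<comment> \<open>The smoothing parameter is taken to be the gap \<open>?c\<close> itself, so
        the weight on the diagonal is at most half of the gap.\<close>
      have "N * exp (L1 * t) \<le> N * exp (L1 * T)" using N L1 t by (intro mult_left_mono) auto
      then have "N * exp (L1 * t) * ?c \<le> 1 / 2 * ?c" using N c by (intro mult_right_mono) auto
      moreover have "sqrt (0 + ?c\<^sup>2) = ?c" using c by simp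
      ultimately have "?c \<le> 1 / 2 * ?c" using main[OF c] by simp
      then show False using c by simp
    qed
    moreover have "u \<theta> (x, t) \<ge> 0" by (rule nonneg_preserved[OF \<theta> t wx])
    ultimately show "\<epsilon> * w (x, t) \<le> u \<theta> (x, t)" using wx by (simp add: U_def V_def)
  qed
qed

subsection \<open>Finite speed of propagation\<close>

text \<open>Since \<open>H\<close> is bounded by \<open>L2 * norm p\<close>, signs travel with
  bounded speed. A paraboloidal cap below the exponential of \<open>w\<close> sinks at rate
  \<open>4 * A * L2 / r\<close>, twice what \<open>H\<close> can produce at its slopes, and is still
  positive at \<open>z\<close> at time \<open>t\<close>. It is used by contraposition: a point with
  \<open>w \<le> 0\<close> at time \<open>t\<close> has such points near it at earlier
  times.\<close>

lemma finite_speed: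
  assumes s: "0 < s" "s \<le> t" "t < T" and r: "r > 0" "8 * L2 * (t - s) \<le> r"
    and pos: "\<And>x. x \<in> cball z r \<Longrightarrow> w (x, s) > 0"
  shows "w (z, t) > 0"
proof -
  have "continuous_on (cball z r) (\<lambda>x. w (x, s))"
    by (rule continuous_on_compose2[OF w_props(3)]) (use s in \<open>auto intro!: continuous_intros\<close>)
  then obtain x1 where x1: "x1 \<in> cball z r" "\<And>x. x \<in> cball z r \<Longrightarrow> w (x1, s) \<le> w (x, s)"
    using continuous_attains_inf[OF compact_cball, of z r] r by (metis cball_eq_empty not_less_iff_gr_or_eq)
  define c where "c = w (x1, s)"
  have c: "c > 0" "\<And>x. x \<in> cball z r \<Longrightarrow> c \<le> w (x, s)" using x1 pos by (auto simp: c_def)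
  \<comment> \<open>Up to time \<open>t\<close> the cap keeps at least half of its height at
    \<open>z\<close>. With \<open>\<sigma> * c = 2\<close> this leaves \<open>exp 2 / 2\<close>,
    which exceeds 1 and so forces \<open>w (z, t) > 0\<close>.\<close>
  define \<sigma> where "\<sigma> = 2 / c"
  have \<sigma>: "\<sigma> > 0" "\<sigma> * c = 2" using c by (auto simp: \<sigma>_def)
  define A where "A = exp (\<sigma> * c) / \<sigma>"
  have A: "A > 0" using \<sigma> by (simp add: A_def)
  let ?U = "\<lambda>z. - exp (- \<sigma> * - w z) / \<sigma>"
  \<comment> \<open>the exponential is positive, so the barrier needs no lower bound of \<open>w\<close> on the lateral boundary\<close>
  let ?\<phi> = "\<lambda>m. - A * (1 - ((fst m - z) \<bullet> (fst m - z) + 4 * L2 * r * (snd m - s)) / r\<^sup>2)"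
  have "?U (z, t) \<le> ?\<phi> (z, t)"
  proof (rule barrier[where U = ?U and \<phi> = ?\<phi> and F = "dual (op 0)" and D = Q and K = "cball z r" and s = s and t = t])
    show "jetsub (dual (op 0)) Q ?U"
      using reinit.subsolution_exp_change[OF dual, of Q "\<lambda>z. - w z" \<sigma>] w_props(2) \<sigma> by (simp add: dual_reinit_op)
    show "continuous_on Q ?U" using \<sigma> continuous_on_Q[OF w_props(3)] by (auto intro!: continuous_intros)
    show "continuous_on {(x, t, r, p). (x, t) \<in> Q} (\<lambda>(x, t, r, p). dual (op 0) x t r p)" by (rule dual_op_cont) simp
    show "continuous_on (cball z r \<times> {s..t}) ?\<phi>" using r by (auto intro!: continuous_intros)
    fix x \<tau> assume x: "x \<in> cball z r" and \<tau>: "s \<le> \<tau>" "\<tau> \<le> t" and lt: "?\<phi> (x, \<tau>) < ?U (x, \<tau>)"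
    have q: "(x - z) \<bullet> (x - z) + 4 * L2 * r * (\<tau> - s) \<ge> 0" using L2 r \<tau> by simp
    have "?U (x, \<tau>) < 0" using \<sigma> by simp
    then have "?\<phi> (x, \<tau>) < 0" using lt by (rule less_trans[rotated])
    then have "((x - z) \<bullet> (x - z) + 4 * L2 * r * (\<tau> - s)) / r\<^sup>2 < 1" using A by (simp add: zero_less_mult_iff)
    then have "(x - z) \<bullet> (x - z) + 4 * L2 * r * (\<tau> - s) < r\<^sup>2" using r by (simp add: divide_less_eq)
    moreover have "4 * L2 * r * (\<tau> - s) \<ge> 0" using L2 r \<tau> by simp
    ultimately have "(norm (x - z))\<^sup>2 < r\<^sup>2" unfolding power2_norm_eq_inner by linarith
    then have xr: "norm (x - z) < r" using r by (metis less_eq_real_def power2_less_imp_less)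
    have "s \<noteq> \<tau>"
    proof
      assume [simp]: "s = \<tau>"
      have "\<sigma> * c \<le> \<sigma> * w (x, \<tau>)" using c(2)[OF x] \<sigma>(1) by (intro mult_left_mono) auto
      then have "A \<le> exp (\<sigma> * w (x, \<tau>)) / \<sigma>" unfolding A_def using \<sigma>(1) by (intro divide_right_mono) auto
      moreover have "A * (1 - ((x - z) \<bullet> (x - z) + 4 * L2 * r * (\<tau> - s)) / r\<^sup>2) \<le> A * 1"
        using A q by (intro mult_left_mono) auto
      ultimately show False using lt by simp
    qed
    moreover have "(?\<phi> has_derivative (\<bullet>) ((2 * A / r\<^sup>2) *\<^sub>R (x - z), 4 * A * L2 / r)) (at (x, \<tau>))"
    proof -
      have "4 * A * L2 / r = A * (4 * L2 * r) / r\<^sup>2" using r by (simp add: power2_eq_square)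
      then show ?thesis using r
        by (auto intro!: derivative_eq_intros simp: fun_eq_iff inner_commute inner_diff_left inner_diff_right) (simp add: field_simps)
    qed
    moreover have "dual (op 0) x \<tau> (?U (x, \<tau>)) ((2 * A / r\<^sup>2) *\<^sub>R (x - z)) < 4 * A * L2 / r"
    proof -
      have "0 \<le> \<tau>" "\<tau> \<le> T" using s \<tau> by auto
      from H_bound[OF this, of x "- ((2 * A / r\<^sup>2) *\<^sub>R (x - z))"]
      have "dual (op 0) x \<tau> (?U (x, \<tau>)) ((2 * A / r\<^sup>2) *\<^sub>R (x - z)) \<le> L2 * (2 * A / r\<^sup>2 * norm (x - z))"
        using A by (simp add: dual_def reinit_op_def abs_le_iff)
      also have "\<dots> \<le> L2 * (2 * A / r\<^sup>2 * r)" using L2 A xr by (intro mult_left_mono) auto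
      also have "\<dots> = 2 * A * L2 / r" using r by (simp add: power2_eq_square)
      also have "\<dots> < 4 * A * L2 / r" using r A L2 by (simp add: divide_strict_right_mono)
      finally show ?thesis .
    qed
    ultimately show "s < \<tau> \<and> x \<in> interior (cball z r) \<and>
       (\<exists>p b. (?\<phi> has_derivative (\<bullet>) (p, b)) (at (x, \<tau>)) \<and> dual (op 0) x \<tau> (?U (x, \<tau>)) p < b)"
      using \<tau> xr by (auto simp: dist_norm norm_minus_commute intro!: exI)
  qed (use s r open_Q in auto)
  then have "A * (1 - 4 * L2 * r * (t - s) / r\<^sup>2) \<le> exp (\<sigma> * w (z, t)) / \<sigma>" by simp
  moreover have "A * (1 / 2) \<le> A * (1 - 4 * L2 * r * (t - s) / r\<^sup>2)"
  proof -
    have "4 * L2 * r * (t - s) \<le> r\<^sup>2 / 2"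
      using mult_left_mono[OF r(2), of r] r(1) by (simp add: power2_eq_square algebra_simps)
    then have "4 * L2 * r * (t - s) / r\<^sup>2 \<le> 1 / 2" using r by (simp add: divide_le_eq)
    then show ?thesis using A by (intro mult_left_mono) auto
  qed
  ultimately have "exp 2 / 2 / \<sigma> \<le> exp (\<sigma> * w (z, t)) / \<sigma>" by (simp add: A_def \<sigma>(2))
  then have "exp 2 / 2 \<le> exp (\<sigma> * w (z, t))" using \<sigma>(1) by (simp add: divide_right_mono_neg divide_le_cancel del: divide_divide_eq_left)
  moreover have "exp (2::real) \<ge> 1 + 2" by (rule exp_ge_add_one_self)
  ultimately have "exp (\<sigma> * w (z, t)) > 1" by linarith
  then show ?thesis using \<sigma> by (simp add: zero_less_mult_iff)
qed


lemma nonpos_preserved: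
  assumes "\<theta> > 0" "0 \<le> t" "t < T" "w (x, t) \<le> 0"
  shows "u \<theta> (x, t) \<le> 0"
  using reinit.nonneg_preserved[OF dual, of \<theta> t x] assms by simp

subsection \<open>Barriers of slope close to one\<close>

text \<open>The bound \<open>R\<close> provides compactness: \<open>h\<close> may tend to 0 at
  infinity.\<close>

lemma h_gap_above:
  assumes "e > 0"
  obtains c where "c > 0" "\<And>p. 1 + e \<le> norm p \<Longrightarrow> norm p \<le> R \<Longrightarrow> h p \<le> - c"
proof (cases "cball 0 R - ball (0::'a) (1 + e) = {}")
  case True
  then have "\<not> (1 + e \<le> norm p \<and> norm p \<le> R)" for p :: 'a by (auto simp: set_eq_iff)
  then show ?thesis using that[of 1] by auto
next
  case False
  have "compact (cball 0 R - ball (0::'a) (1 + e))" by (intro compact_diff) auto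
  from continuous_attains_sup[OF this False h_cont] obtain q where
    q: "q \<in> cball 0 R - ball (0::'a) (1 + e)" "\<And>p. p \<in> cball 0 R - ball (0::'a) (1 + e) \<Longrightarrow> h p \<le> h q" by blast
  have "h q < 0" using q(1) assms by (intro h_neg) auto
  then show ?thesis using q(2) by (intro that[of "- h q"]) auto
qed

lemma h_gap_below:
  assumes "0 < e" "e < 1"
  obtains c where "c > 0" "\<And>p. norm p \<le> 1 - e \<Longrightarrow> c \<le> h p"
proof -
  have "cball (0::'a) (1 - e) \<noteq> {}" using assms by simp
  from continuous_attains_inf[OF compact_cball this h_cont] obtain q where
    q: "q \<in> cball (0::'a) (1 - e)" "\<And>p. p \<in> cball (0::'a) (1 - e) \<Longrightarrow> h q \<le> h p" by blast
  have "h q > 0" using q(1) assms by (intro h_pos) auto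
  then show ?thesis using q(2) by (intro that[of "h q"]) auto
qed

text \<open>Each term of the barrier has a task. The slope is at least \<open>1 + \<eta>\<close>, so
  the source pushes downwards; the quadratic term beats the Lipschitz bound on
  \<open>u \<theta>\<close> far from \<open>z\<close>; the term in time does so at the initial time;
  the last \<open>\<eta>\<close> ensures \<open>u \<theta> \<ge> \<eta>\<close> wherever the barrier
  is crossed, so that the source has strength at least \<open>\<theta> * \<beta> \<eta> * c\<close>.
  The constants are uniform in \<open>z\<close> and in \<open>t \<ge> t0\<close>.\<close>

lemma upper_barrier:
  assumes \<eta>: "\<eta> > 0" and t0: "t0 > 0"
  obtains A \<delta> \<theta>0 where "A > 0" "\<delta> > 0" "\<theta>0 > 0"
    "\<And>\<theta> t z y s. \<theta>0 \<le> \<theta> \<Longrightarrow> t0 \<le> t \<Longrightarrow> t < T \<Longrightarrow> w (z, t) \<le> 0 \<Longrightarrow> t - \<delta> \<le> s \<Longrightarrow> s \<le> t \<Longrightarrow>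
       u \<theta> (y, s) \<le> (1 + \<eta>) * norm (y - z) + \<eta> * (norm (y - z))\<^sup>2 + A * (t - s) + \<eta>"
proof -
  \<comment> \<open>The first bound yields \<open>M * r \<le> \<eta>\<close>, so passing to
    \<open>z\<close> from a point with \<open>w \<le> 0\<close> found by \<open>finite_speed\<close>
    costs at most \<open>\<eta>\<close>. The second keeps \<open>t - \<delta>\<close>
    positive.\<close>
  define \<delta> where "\<delta> = min (\<eta> / (8 * L2 * M)) (t0 / 2)"
  have M0: "M > 0" by (rule M_ge)
  have \<delta>: "\<delta> > 0" "\<delta> \<le> t0 / 2" using \<eta> t0 L2 M0 by (auto simp: \<delta>_def)
  define r where "r = 8 * L2 * \<delta>"
  have "8 * L2 * M * \<delta> \<le> 8 * L2 * M * (\<eta> / (8 * L2 * M))" using L2 M0 by (intro mult_left_mono) (auto simp: \<delta>_def)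
  also have "\<dots> = \<eta>" using L2 M0 by simp
  finally have r: "r > 0" "M * r \<le> \<eta>" using \<delta> L2 by (auto simp: r_def mult_ac)
  \<comment> \<open>By \<open>M * n \<le> \<eta> * n\<^sup>2 + M\<^sup>2 / (4 * \<eta>)\<close>, the
    height \<open>A * \<delta>\<close> lifts the barrier above the Lipschitz bound at time
    \<open>t - \<delta>\<close>.\<close>
  define A where "A = M\<^sup>2 / (4 * \<eta> * \<delta>)"
  have A: "A > 0" "A * \<delta> = M\<^sup>2 / (4 * \<eta>)" using M0 \<eta> \<delta> by (auto simp: A_def)
  obtain c where c: "c > 0" "\<And>p. 1 + \<eta> \<le> norm p \<Longrightarrow> norm p \<le> 1 + \<eta> + 2 * M \<Longrightarrow> h p \<le> - c"
    using h_gap_above[OF \<eta>] by blast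
  \<comment> \<open>The source has to outweigh the largest value of \<open>H\<close> at the slopes
    of the barrier and its rate of descent \<open>A\<close>.\<close>
  define \<theta>0 where "\<theta>0 = (L2 * (1 + \<eta> + 2 * M) + A + 1) / (\<beta> \<eta> * c)"
  have bc: "\<beta> \<eta> * c > 0" using \<beta>_pos[OF \<eta>] c by simp
  have "L2 * (1 + \<eta> + 2 * M) > 0" using L2 \<eta> M0 by simp
  then have \<theta>0: "\<theta>0 > 0" "\<theta>0 * (\<beta> \<eta> * c) = L2 * (1 + \<eta> + 2 * M) + A + 1"
    using bc A by (auto simp: \<theta>0_def add_pos_pos)
  show ?thesis
  proof (rule that[OF A(1) \<delta>(1) \<theta>0(1)])
    fix \<theta> t z y s assume \<theta>: "\<theta>0 \<le> \<theta>" and t: "t0 \<le> t" "t < T" and wz: "w (z, t) \<le> 0"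
      and s: "t - \<delta> \<le> s" "s \<le> t"
    have \<theta>p: "\<theta> > 0" using \<theta> \<theta>0 by linarith
    have lip: "\<bar>u \<theta> (x, \<tau>) - u \<theta> (x', \<tau>)\<bar> \<le> M * norm (x - x')" if "0 \<le> \<tau>" "\<tau> < T" for x x' \<tau>
      by (rule space_lipschitz[OF u[OF \<theta>p] less_imp_le[OF \<theta>p] that])
    have uz: "u \<theta> (x, \<tau>) \<le> \<eta> + M * norm (x - z)" if \<tau>: "t - \<delta> \<le> \<tau>" "\<tau> \<le> t" for x \<tau>
    proof -
      have \<tau>': "0 < \<tau>" "\<tau> < T" using \<tau> \<delta> t t0 by auto
      have "8 * L2 * (t - \<tau>) \<le> r" unfolding r_def using \<tau> L2 by (intro mult_left_mono) auto
      then obtain x' where x': "x' \<in> cball z r" "w (x', \<tau>) \<le> 0"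
        using finite_speed[OF \<tau>'(1) \<tau>(2) t(2) r(1)] wz by (metis not_le)
      have "u \<theta> (x', \<tau>) \<le> 0" using nonpos_preserved[OF \<theta>p _ _ x'(2)] \<tau>' by simp
      moreover have "\<bar>u \<theta> (z, \<tau>) - u \<theta> (x', \<tau>)\<bar> \<le> M * norm (z - x')" using \<tau>' by (intro lip) auto
      moreover have "M * norm (z - x') \<le> M * r" using x'(1) M0 by (intro mult_left_mono) (auto simp: dist_norm)
      moreover have "\<bar>u \<theta> (x, \<tau>) - u \<theta> (z, \<tau>)\<bar> \<le> M * norm (x - z)" using \<tau>' by (intro lip) auto
      ultimately show ?thesis using r(2) by linarith
    qed
    let ?\<phi> = "\<lambda>m. (1 + \<eta>) * norm (fst m - z) + \<eta> * ((fst m - z) \<bullet> (fst m - z)) + A * (t - snd m) + \<eta>"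
    let ?K = "cball z (M / \<eta> + 1 + norm (y - z))"
    have "u \<theta> (y, s) \<le> ?\<phi> (y, s)"
    proof (rule barrier[where U = "u \<theta>" and \<phi> = ?\<phi> and F = "op \<theta>" and D = Q and K = ?K and s = "t - \<delta>" and t = t])
      show "jetsub (op \<theta>) Q (u \<theta>)" "continuous_on Q (u \<theta>)" using u_props[OF \<theta>p] continuous_on_Q by auto
      show "continuous_on {(x, t, r, p). (x, t) \<in> Q} (\<lambda>(x, t, r, p). op \<theta> x t r p)" by (rule op_cont) simp
      show "continuous_on (?K \<times> {t - \<delta>..t}) ?\<phi>" by (intro continuous_intros)
      show "?K \<times> {t - \<delta>..t} \<subseteq> Q" using \<delta> t t0 by auto
      show "y \<in> ?K" using M0 \<eta> by (simp add: dist_norm norm_minus_commute)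
      fix x \<tau> assume x: "x \<in> ?K" and \<tau>: "t - \<delta> \<le> \<tau>" "\<tau> \<le> t" and lt: "?\<phi> (x, \<tau>) < u \<theta> (x, \<tau>)"
      define n where "n = norm (x - z)"
      have n0: "n \<ge> 0" by (simp add: n_def)
      have An: "A * (t - \<tau>) \<ge> 0" using A \<tau> by simp
      have \<phi>n: "?\<phi> (x, \<tau>) = (1 + \<eta>) * n + \<eta> * n\<^sup>2 + A * (t - \<tau>) + \<eta>" by (simp add: n_def power2_norm_eq_inner)
      have un: "u \<theta> (x, \<tau>) \<le> \<eta> + M * n" using uz[OF \<tau>] by (simp add: n_def)
      \<comment> \<open>At the apex \<open>u \<theta>\<close> is at most \<open>\<eta>\<close>,
        which the barrier does not fall below; a crossing thus avoids the point where the norm is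
        not differentiable.\<close>
      have nn: "n \<noteq> 0" using lt un An unfolding \<phi>n by auto
      have "\<eta> * n\<^sup>2 < M * n" using lt un An n0 \<eta> unfolding \<phi>n by (smt (verit) mult_nonneg_nonneg)
      then have "(\<eta> * n) * n < M * n" by (simp add: power2_eq_square mult_ac)
      then have \<eta>n: "\<eta> * n < M" using nn n0 by (simp add: mult_less_cancel_right_pos)
      then have "n < M / \<eta>" using \<eta> by (simp add: field_simps)
      then have int: "x \<in> interior ?K" using \<eta> M0 norm_ge_zero[of "y - z"] unfolding interior_cball mem_ball dist_norm n_def norm_minus_commute[of z x] by linarith
      have "t - \<delta> \<noteq> \<tau>"
      proof
        assume "t - \<delta> = \<tau>"
        then have "?\<phi> (x, \<tau>) = (1 + \<eta>) * n + \<eta> * n\<^sup>2 + M\<^sup>2 / (4 * \<eta>) + \<eta>" unfolding \<phi>n using A(2) by auto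
        moreover have "M * n \<le> \<eta> * n\<^sup>2 + M\<^sup>2 / (4 * \<eta>)"
        proof -
          have "0 \<le> \<eta> * (n - M / (2 * \<eta>))\<^sup>2" using \<eta> by simp
          also have "\<dots> = \<eta> * n\<^sup>2 + M\<^sup>2 / (4 * \<eta>) - M * n" using \<eta> by (simp add: field_simps power2_eq_square)
          finally show ?thesis by simp
        qed
        moreover have "(1 + \<eta>) * n \<ge> 0" using \<eta> n0 by simp
        ultimately show False using lt un by linarith
      qed
      moreover have "\<exists>p b. (?\<phi> has_derivative (\<bullet>) (p, b)) (at (x, \<tau>)) \<and> op \<theta> x \<tau> (u \<theta> (x, \<tau>)) p < b"
      proof (intro exI conjI)
        have xz: "x - z \<noteq> 0" using nn by (simp add: n_def)
        have "((\<lambda>m::'a \<times> real. norm (fst m - z)) has_derivative (\<lambda>k. ((x - z) /\<^sub>R n) \<bullet> fst k)) (at (x, \<tau>))"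
          by (rule has_derivative_compose[where g = norm and f = "\<lambda>m. fst m - z"])
            (use has_derivative_norm[OF xz] in \<open>auto intro!: derivative_eq_intros simp: sgn_div_norm inner_commute n_def\<close>)
        then show "(?\<phi> has_derivative (\<bullet>) (((1 + \<eta>) / n + 2 * \<eta>) *\<^sub>R (x - z), - A)) (at (x, \<tau>))"
          by (auto intro!: derivative_eq_intros simp: fun_eq_iff inner_commute algebra_simps inverse_eq_divide add_divide_distrib)
        define p where "p = ((1 + \<eta>) / n + 2 * \<eta>) *\<^sub>R (x - z)"
        have "norm p = ((1 + \<eta>) / n + 2 * \<eta>) * n" using \<eta> n0 by (simp add: p_def n_def)
        also have "\<dots> = 1 + \<eta> + 2 * (\<eta> * n)" using nn by (simp add: field_simps)
        finally have np: "norm p = 1 + \<eta> + 2 * (\<eta> * n)" .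
        have "\<eta> * n \<ge> 0" using \<eta> n0 by simp
        then have np2: "1 + \<eta> \<le> norm p" "norm p \<le> 1 + \<eta> + 2 * M" using \<eta>n np by auto
        have "\<tau> > 0" using \<tau> \<delta> t t0 by auto
        then have "H x \<tau> p \<le> L2 * norm p" using H_bound[of \<tau> x p] \<tau> t by simp
        also have "\<dots> \<le> L2 * (1 + \<eta> + 2 * M)" using np2 L2 by (intro mult_left_mono) auto
        finally have 1: "H x \<tau> p \<le> L2 * (1 + \<eta> + 2 * M)" .
        have "(1 + \<eta>) * n \<ge> 0" "\<eta> * n\<^sup>2 \<ge> 0" using \<eta> n0 by auto
        then have "\<eta> \<le> u \<theta> (x, \<tau>)" using lt An unfolding \<phi>n by linarith
        then have b: "\<beta> \<eta> \<le> \<beta> (u \<theta> (x, \<tau>))" using \<beta>_mono by (simp add: monoD)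
        have "\<beta> (u \<theta> (x, \<tau>)) * h p \<le> \<beta> (u \<theta> (x, \<tau>)) * - c" using b \<beta>_pos[OF \<eta>] c(2)[OF np2] by (intro mult_left_mono) auto
        also have "\<dots> \<le> \<beta> \<eta> * - c" using b c(1) by (intro mult_right_mono_neg) auto
        finally have "\<theta> * (\<beta> (u \<theta> (x, \<tau>)) * h p) \<le> \<theta> * (\<beta> \<eta> * - c)" using \<theta>p by (intro mult_left_mono) auto
        moreover have "\<theta>0 * (\<beta> \<eta> * c) \<le> \<theta> * (\<beta> \<eta> * c)" using bc \<theta> by (intro mult_right_mono) auto
        ultimately have "\<theta> * (\<beta> (u \<theta> (x, \<tau>)) * h p) \<le> - (L2 * (1 + \<eta> + 2 * M) + A + 1)" using \<theta>0(2) by simp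
        then have "op \<theta> x \<tau> (u \<theta> (x, \<tau>)) p < - A" using 1 by (simp add: reinit_op_def mult.assoc)
        then show "op \<theta> x \<tau> (u \<theta> (x, \<tau>)) (((1 + \<eta>) / n + 2 * \<eta>) *\<^sub>R (x - z)) < - A" by (simp add: p_def)
      qed
      ultimately show "t - \<delta> < \<tau> \<and> x \<in> interior ?K \<and>
        (\<exists>p b. (?\<phi> has_derivative (\<bullet>) (p, b)) (at (x, \<tau>)) \<and> op \<theta> x \<tau> (u \<theta> (x, \<tau>)) p < b)"
        using \<tau> int by simp
    qed (use s open_Q in auto)
    then show "u \<theta> (y, s) \<le> (1 + \<eta>) * norm (y - z) + \<eta> * (norm (y - z))\<^sup>2 + A * (t - s) + \<eta>"
      by (simp add: power2_norm_eq_inner)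
  qed
qed

text \<open>By \<open>linear_lower_bound\<close>, \<open>u \<theta>\<close> stays above a positive
  constant free of \<theta> near the ball, so at slopes at most \<open>1 - e1\<close> the source
  pushes upwards with strength proportional to \<theta>. A smoothed cone can therefore rise over the
  ball from below 0 to height about \<open>\<rho>\<close>. Positivity of \<open>w\<close> persists
  on both sides of \<open>t\<close>, hence the two-sided time interval.\<close>

lemma lower_barrier:
  assumes t: "0 < t" "t < T" and \<rho>: "\<rho> > 0" and e: "e > 0"
    and pos: "\<And>y. y \<in> cball x \<rho> \<Longrightarrow> w (y, t) > 0"
  obtains \<tau> \<theta>0 where "\<tau> > 0" "\<theta>0 > 0"
    "\<And>\<theta> y s. \<theta>0 \<le> \<theta> \<Longrightarrow> norm (y - x) < \<tau> \<Longrightarrow> \<bar>s - t\<bar> < \<tau> \<Longrightarrow> \<rho> - e < u \<theta> (y, s)"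
proof -
  \<comment> \<open>The losses are \<open>e1 * \<rho>\<close> from the slope, \<open>2 * e1\<close>
    from the rounded tip and the distance of \<open>y\<close> from \<open>x\<close>, and
    \<open>2 * e1\<close> from the term in time; together they are at most
    \<open>e / 2\<close>.\<close>
  define e1 where "e1 = min (1 / 2) (e / (2 * (\<rho> + 4)))"
  have "e1 * (\<rho> + 4) \<le> e / (2 * (\<rho> + 4)) * (\<rho> + 4)" using \<rho> by (intro mult_right_mono) (auto simp: e1_def)
  also have "\<dots> = e / 2" using \<rho> by (simp add: field_simps)
  finally have e1': "e1 * (\<rho> + 4) \<le> e / 2" .
  have e1: "e1 > 0" "e1 < 1" "e1 * (\<rho> + 4) \<le> e / 2" using e \<rho> e1' by (auto simp: e1_def)
  obtain \<epsilon> where \<epsilon>: "\<epsilon> > 0" "\<And>\<theta> x t. \<theta> > 0 \<Longrightarrow> 0 \<le> t \<Longrightarrow> t < T \<Longrightarrow> w (x, t) \<ge> 0 \<Longrightarrow> \<epsilon> * w (x, t) \<le> u \<theta> (x, t)"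
    using linear_lower_bound by blast
  define a b where "a = t / 2" and "b = (t + T) / 2"
  have ab: "0 < a" "a < t" "t < b" "b < T" using t by (auto simp: a_def b_def)
  have "continuous_on (cball x \<rho> \<times> {a..b}) w" by (rule continuous_on_subset[OF w_props(3)]) (use ab in auto)
  moreover have "compact (cball x \<rho> \<times> {a..b})" by (intro compact_Times) auto
  ultimately have uc: "uniformly_continuous_on (cball x \<rho> \<times> {a..b}) w" by (rule compact_uniformly_continuous)
  have "continuous_on (cball x \<rho>) (\<lambda>x. w (x, t))"
    by (rule continuous_on_compose2[OF w_props(3)]) (use t in \<open>auto intro!: continuous_intros\<close>)
  then obtain x1 where x1: "x1 \<in> cball x \<rho>" "\<And>y. y \<in> cball x \<rho> \<Longrightarrow> w (x1, t) \<le> w (y, t)"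
    using continuous_attains_inf[OF compact_cball, of x \<rho>] \<rho> by (metis cball_eq_empty not_less_iff_gr_or_eq)
  define c0 where "c0 = w (x1, t)"
  have c0: "c0 > 0" "\<And>y. y \<in> cball x \<rho> \<Longrightarrow> c0 \<le> w (y, t)" using x1 pos by (auto simp: c0_def)
  obtain d where d: "d > 0" "\<And>m m'. m \<in> cball x \<rho> \<times> {a..b} \<Longrightarrow> m' \<in> cball x \<rho> \<times> {a..b} \<Longrightarrow> dist m' m < d \<Longrightarrow> dist (w m') (w m) < c0 / 2"
    using uc c0(1) unfolding uniformly_continuous_on_def by (metis half_gt_zero)
  define \<tau>1 where "\<tau>1 = Min {d / 2, t - a, b - t}"
  have \<tau>1: "\<tau>1 > 0" "\<tau>1 < d" "a \<le> t - \<tau>1" "t + \<tau>1 \<le> b" using d ab by (auto simp: \<tau>1_def min_def)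
  define m0 where "m0 = \<epsilon> * (c0 / 2)"
  have m0: "m0 > 0" using \<epsilon> c0 by (simp add: m0_def)
  have um: "m0 \<le> u \<theta> (y, s)" if "\<theta> > 0" "y \<in> cball x \<rho>" "t - \<tau>1 \<le> s" "s \<le> t + \<tau>1" for \<theta> y s
  proof -
    have "dist (y, s) (y, t) = \<bar>s - t\<bar>" by (simp add: dist_Pair_Pair dist_real_def)
    then have "dist (w (y, s)) (w (y, t)) < c0 / 2" using that \<tau>1 ab by (intro d(2)) auto
    then have "w (y, s) \<ge> c0 / 2" using c0(2)[OF that(2)] unfolding dist_real_def by linarith
    then have "m0 \<le> \<epsilon> * w (y, s)" unfolding m0_def using \<epsilon> by (intro mult_left_mono) auto
    also have "\<dots> \<le> u \<theta> (y, s)" using that \<tau>1 ab \<open>w (y, s) \<ge> c0 / 2\<close> c0 by (intro \<epsilon>(2)) auto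
    finally show ?thesis .
  qed
  \<comment> \<open>Since \<open>A * \<tau>1 = \<rho>\<close>, the cone is lowered by its full
    height at time \<open>t - \<tau>1\<close>, where positivity of \<open>u \<theta>\<close> then
    suffices.\<close>
  define A where "A = \<rho> / \<tau>1"
  have A: "A > 0" "A * \<tau>1 = \<rho>" using \<rho> \<tau>1 by (auto simp: A_def)
  define \<tau>' where "\<tau>' = min \<tau>1 (e1 / A)"
  have "A * \<tau>' \<le> A * (e1 / A)" using A by (intro mult_left_mono) (auto simp: \<tau>'_def)
  then have \<tau>': "\<tau>' > 0" "\<tau>' \<le> \<tau>1" "A * \<tau>' \<le> e1" using A e1 \<tau>1 by (auto simp: \<tau>'_def)
  \<comment> \<open>The cylinder ends slightly after \<open>t\<close>, so that \<open>s\<close> may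
    lie on either side of \<open>t\<close>.\<close>
  define t1 where "t1 = t + \<tau>'"
  obtain c where c: "c > 0" "\<And>p. norm p \<le> 1 - e1 \<Longrightarrow> c \<le> h p" using h_gap_below[OF e1(1,2)] by blast
  have bc: "\<beta> m0 * c > 0" using \<beta>_pos[OF m0] c by simp
  define \<theta>0 where "\<theta>0 = (L2 + A + 1) / (\<beta> m0 * c)"
  have \<theta>0: "\<theta>0 > 0" "\<theta>0 * (\<beta> m0 * c) = L2 + A + 1" using bc A L2 by (auto simp: \<theta>0_def add_pos_pos)
  show ?thesis
  proof (rule that[of "min \<tau>' (min e1 \<rho>)" \<theta>0])
    fix \<theta> y s assume \<theta>: "\<theta>0 \<le> \<theta>" and y: "norm (y - x) < min \<tau>' (min e1 \<rho>)" and s: "\<bar>s - t\<bar> < min \<tau>' (min e1 \<rho>)"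
    have \<theta>p: "\<theta> > 0" using \<theta> \<theta>0 by linarith
    let ?N = "1 - e1"
    let ?\<phi> = "\<lambda>m. ?N * (sqrt ((fst m - x) \<bullet> (fst m - x) + e1\<^sup>2) - \<rho>) + A * (t1 - snd m)"
    show "\<rho> - e < u \<theta> (y, s)"
    proof -
      define S where "S = sqrt ((y - x) \<bullet> (y - x) + e1\<^sup>2)"
      have "- u \<theta> (y, s) \<le> ?\<phi> (y, s)"
      proof (rule barrier[where U = "\<lambda>z. - u \<theta> z" and \<phi> = ?\<phi> and F = "dual (op \<theta>)" and D = Q and K = "cball x \<rho>" and s = "t - \<tau>1" and t = t1])
        show "jetsub (dual (op \<theta>)) Q (\<lambda>z. - u \<theta> z)" "continuous_on Q (\<lambda>z. - u \<theta> z)"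
          using u_props[OF \<theta>p] continuous_on_Q by (auto intro!: continuous_intros)
        show "continuous_on {(x, t, r, p). (x, t) \<in> Q} (\<lambda>(x, t, r, p). dual (op \<theta>) x t r p)" by (rule dual_op_cont) simp
        show "continuous_on (cball x \<rho> \<times> {t - \<tau>1..t1}) ?\<phi>" by (intro continuous_intros)
        show "cball x \<rho> \<times> {t - \<tau>1..t1} \<subseteq> Q" using \<tau>1 \<tau>' ab by (auto simp: t1_def)
        fix y \<tau> assume y: "y \<in> cball x \<rho>" and \<tau>: "t - \<tau>1 \<le> \<tau>" "\<tau> \<le> t1" and lt: "?\<phi> (y, \<tau>) < - u \<theta> (y, \<tau>)"
        let ?S = "sqrt ((y - x) \<bullet> (y - x) + e1\<^sup>2)"
        have um': "m0 \<le> u \<theta> (y, \<tau>)" using \<tau> \<tau>' by (intro um[OF \<theta>p y]) (auto simp: t1_def)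
        then have neg: "?N * (?S - \<rho>) + A * (t1 - \<tau>) < 0" using lt m0 by simp
        have An: "A * (t1 - \<tau>) \<ge> 0" using A \<tau> by simp
        then have "?N * (?S - \<rho>) < 0" using neg by linarith
        then have S: "?S < \<rho>" using e1 by (simp add: mult_less_0_iff)
        then have int: "norm (y - x) < \<rho>" using norm_le_sqrt_weight[of "y - x" e1] by linarith
        have "t - \<tau>1 \<noteq> \<tau>"
        proof
          assume eq: "t - \<tau>1 = \<tau>"
          have "A * (t1 - \<tau>) \<ge> A * \<tau>1" using A \<tau>' eq by (intro mult_left_mono) (auto simp: t1_def)
          moreover have "?N * (?S - \<rho>) \<ge> ?N * (- \<rho>)" using e1 norm_le_sqrt_weight[of "y - x" e1] norm_ge_zero[of "y - x"]
            by (intro mult_left_mono) linarith+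
          moreover have "?N * (- \<rho>) = - \<rho> + e1 * \<rho>" by (simp add: algebra_simps)
          moreover have "e1 * \<rho> > 0" using e1 \<rho> by simp
          ultimately show False using neg A(2) by linarith
        qed
        moreover have "\<exists>p b. (?\<phi> has_derivative (\<bullet>) (p, b)) (at (y, \<tau>)) \<and> dual (op \<theta>) y \<tau> (- u \<theta> (y, \<tau>)) p < b"
        proof (intro exI conjI)
          \<comment> \<open>The factor \<open>exp (L1 * 0)\<close> is 1; it only brings
            \<open>p\<close> into the shape of \<open>sqrt_weight_bounds\<close> at time 0.\<close>
          define p where "p = (?N * exp (L1 * 0) / ?S) *\<^sub>R (y - x)"
          have "((\<lambda>m::'a \<times> real. ?N * exp (0 * snd (fst m - x, snd m)) * sqrt (fst (fst m - x, snd m) \<bullet> fst (fst m - x, snd m) + e1\<^sup>2)) has_derivative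
             (\<lambda>k. (p, 0) \<bullet> (fst k, snd k))) (at (y, \<tau>))"
            by (rule has_derivative_compose[where f = "\<lambda>m. (fst m - x, snd m)"])
              (use sqrt_weight_derivative[OF e1(1), where N = ?N and l = 0 and z = "y - x" and t = \<tau>] in
                \<open>auto intro!: derivative_eq_intros simp: p_def\<close>)
          then have d0: "((\<lambda>m::'a \<times> real. ?N * sqrt ((fst m - x) \<bullet> (fst m - x) + e1\<^sup>2)) has_derivative
             (\<lambda>k. (p, 0) \<bullet> (fst k, snd k))) (at (y, \<tau>))" by simp
          have d1: "((\<lambda>m::'a \<times> real. A * (t1 - snd m) - ?N * \<rho>) has_derivative (\<lambda>k. - A * snd k)) (at (y, \<tau>))"
            by (auto intro!: derivative_eq_intros)
          have eq: "?\<phi> = (\<lambda>m. ?N * sqrt ((fst m - x) \<bullet> (fst m - x) + e1\<^sup>2) + (A * (t1 - snd m) - ?N * \<rho>))"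
            by (simp add: fun_eq_iff right_diff_distrib)
          show "(?\<phi> has_derivative (\<bullet>) (p, - A)) (at (y, \<tau>))"
            unfolding eq by (rule has_derivative_eq_rhs[OF has_derivative_add[OF d0 d1]]) (auto simp: fun_eq_iff)
          have np: "norm p \<le> 1 - e1" using sqrt_weight_bounds(1)[of ?N 0 e1 "y - x"] e1 by (simp add: p_def)
          have tt: "0 \<le> \<tau>" "\<tau> \<le> T" using \<tau> \<tau>1 \<tau>' ab by (auto simp: t1_def)
          have "\<bar>H y \<tau> (- p)\<bar> \<le> L2 * norm (- p)" by (rule H_bound[OF tt])
          also have "\<dots> \<le> L2 * 1" using np e1 L2 by (intro mult_left_mono) auto
          finally have 1: "- H y \<tau> (- p) \<le> L2" by simp
          have "\<beta> m0 \<le> \<beta> (u \<theta> (y, \<tau>))" using um' \<beta>_mono by (simp add: monoD)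
          then have "\<beta> m0 * c \<le> \<beta> (u \<theta> (y, \<tau>)) * h (- p)" using c(2)[of "- p"] c(1) np \<beta>_pos[OF m0] by (intro mult_mono) auto
          then have "\<theta>0 * (\<beta> m0 * c) \<le> \<theta> * (\<beta> (u \<theta> (y, \<tau>)) * h (- p))" using \<theta> \<theta>p bc
            by (intro mult_mono[OF \<theta>]) auto
          then show "dual (op \<theta>) y \<tau> (- u \<theta> (y, \<tau>)) p < - A" using 1 \<theta>0(2) by (simp add: dual_def reinit_op_def mult.assoc)
        qed
        ultimately show "t - \<tau>1 < \<tau> \<and> y \<in> interior (cball x \<rho>) \<and>
          (\<exists>p b. (?\<phi> has_derivative (\<bullet>) (p, b)) (at (y, \<tau>)) \<and> dual (op \<theta>) y \<tau> (- u \<theta> (y, \<tau>)) p < b)"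
          using \<tau> int by (simp add: interior_cball dist_norm norm_minus_commute)
      qed (use s \<tau>' y open_Q in \<open>auto simp: t1_def dist_norm norm_minus_commute\<close>)
      then have f1: "- u \<theta> (y, s) \<le> ?N * (S - \<rho>) + A * (t1 - s)" by (simp add: S_def)
      have f2: "?N * S \<le> 1 * (2 * e1)"
      proof (intro mult_mono)
        have "S \<le> norm (y - x) + \<bar>e1\<bar>"
          unfolding S_def power2_norm_eq_inner[symmetric] using sqrt_sum_squares_le_sum_abs[of "norm (y - x)" e1] by simp
        then show "S \<le> 2 * e1" using y e1 by auto
      qed (use e1 in \<open>auto simp: S_def\<close>)
      have f3: "A * (t1 - s) \<le> 2 * e1"
      proof -
        have "A * (t1 - s) \<le> A * (2 * \<tau>')" using A s by (intro mult_left_mono) (auto simp: t1_def)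
        then show ?thesis using \<tau>'(3) by simp
      qed
      have f4: "?N * (S - \<rho>) = ?N * S - \<rho> + e1 * \<rho>" by (simp add: algebra_simps)
      have f5: "e1 * \<rho> + 4 * e1 \<le> e / 2" using e1' by (simp add: algebra_simps)
      show ?thesis using f1 f2 f3 f4 f5 e by linarith
    qed
  qed (use \<tau>' e1 \<theta>0 \<rho> in auto)
qed

subsection \<open>Limits\<close>

definition "sd x t = signed_distance (\<lambda>x t. w (x, t)) x t"

lemma w_slice_cont: "0 \<le> t \<Longrightarrow> t < T \<Longrightarrow> continuous_on A (\<lambda>x. w (x, t))"
  by (rule continuous_on_compose2[OF w_props(3)]) (auto intro!: continuous_intros)

lemma zero_level_closed: "0 \<le> t \<Longrightarrow> t < T \<Longrightarrow> closed (zero_level (\<lambda>x t. w (x, t)) t)"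
  unfolding zero_level_def by (intro closed_Collect_eq w_slice_cont continuous_on_const)

text \<open>A ball is connected, so a change of sign inside it would give a zero of \<open>w\<close>
  closer to \<open>x\<close> than the distance to the zero level.\<close>

lemma positive_on_cball:
  assumes t: "0 \<le> t" "t < T" and x: "w (x, t) > 0"
    and \<rho>: "\<rho> < infdist x (zero_level (\<lambda>x t. w (x, t)) t)" and y: "y \<in> cball x \<rho>"
  shows "w (y, t) > 0"
proof (rule ccontr)
  assume n: "\<not> ?thesis"
  have "\<rho> \<ge> 0" using y by (metis cball_eq_empty empty_iff not_le)
  then have xx: "x \<in> cball x \<rho>" by simp
  have "connected ((\<lambda>x. w (x, t)) ` cball x \<rho>)"
    by (intro connected_continuous_image w_slice_cont t convex_connected convex_cball)
  then have "{w (y, t)..w (x, t)} \<subseteq> (\<lambda>x. w (x, t)) ` cball x \<rho>"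
    using xx y by (intro connected_contains_Icc) auto
  moreover have "0 \<in> {w (y, t)..w (x, t)}" using n x by simp
  ultimately obtain z where z: "z \<in> cball x \<rho>" "w (z, t) = 0" by force
  then have "infdist x (zero_level (\<lambda>x t. w (x, t)) t) \<le> dist x z" by (intro infdist_le) (simp add: zero_level_def)
  with z \<rho> show False by simp
qed

lemma lower_limit:
  assumes t: "0 < t" "t < T" and ne: "zero_level (\<lambda>x t. w (x, t)) t \<noteq> {}" and x: "w (x, t) > 0" and e: "e > 0"
  obtains \<tau> \<theta>0 where "\<tau> > 0" "\<theta>0 > 0"
    "\<And>\<theta> y s. \<theta>0 \<le> \<theta> \<Longrightarrow> norm (y - x) < \<tau> \<Longrightarrow> \<bar>s - t\<bar> < \<tau> \<Longrightarrow> sd x t - e < u \<theta> (y, s)"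
proof -
  let ?d = "infdist x (zero_level (\<lambda>x t. w (x, t)) t)"
  have sd: "sd x t = ?d" using x by (simp add: sd_def signed_distance_def)
  have "x \<notin> zero_level (\<lambda>x t. w (x, t)) t" using x by (simp add: zero_level_def)
  then have d: "?d > 0" using t ne by (intro infdist_pos_not_in_closed zero_level_closed) auto
  \<comment> \<open>The radius lies strictly below the distance, as \<open>positive_on_cball\<close>
    requires; the first entry keeps it positive when \<open>e\<close> is large.\<close>
  define \<rho> where "\<rho> = max (?d / 2) (?d - e / 2)"
  have \<rho>: "\<rho> > 0" "\<rho> < ?d" "?d - e / 2 \<le> \<rho>" using d e by (auto simp: \<rho>_def)
  have "w (y, t) > 0" if "y \<in> cball x \<rho>" for y
    using positive_on_cball[OF _ t(2) x \<rho>(2) that] t by simp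
  from lower_barrier[OF t \<rho>(1) _ this, of "e / 2"] e obtain \<tau> \<theta>0 where *: "\<tau> > 0" "\<theta>0 > 0"
    "\<And>\<theta> y s. \<theta>0 \<le> \<theta> \<Longrightarrow> norm (y - x) < \<tau> \<Longrightarrow> \<bar>s - t\<bar> < \<tau> \<Longrightarrow> \<rho> - e / 2 < u \<theta> (y, s)"
    by (metis half_gt_zero)
  show ?thesis
  proof (rule that[OF *(1,2)])
    fix \<theta> y s assume "\<theta>0 \<le> \<theta>" "norm (y - x) < \<tau>" "\<bar>s - t\<bar> < \<tau>"
    from *(3)[OF this] show "sd x t - e < u \<theta> (y, s)" using \<rho>(3) by (simp add: sd)
  qed
qed

text \<open>The point with \<open>w \<le> 0\<close> may belong to a time \<open>t'\<close> after
  \<open>t\<close>: \<open>t' = t\<close> serves the limit from the past, \<open>t' > t\<close> the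
  two-sided one. The uniformity in \<open>upper_barrier\<close> lets \<open>\<tau>\<close> and
  \<open>\<theta>0\<close> be fixed before \<open>t'\<close> and \<open>z\<close>.\<close>

lemma upper_near:
  assumes t: "0 < t" and D: "D \<ge> 0" and e: "e > 0"
  obtains \<tau> \<theta>0 where "\<tau> > 0" "\<theta>0 > 0"
    "\<And>\<theta> t' z y s. \<theta>0 \<le> \<theta> \<Longrightarrow> t \<le> t' \<Longrightarrow> t' \<le> t + \<tau> \<Longrightarrow> t' < T \<Longrightarrow> w (z, t') \<le> 0 \<Longrightarrow> norm (x - z) \<le> D + \<tau> \<Longrightarrow>
       norm (y - x) < \<tau> \<Longrightarrow> t - \<tau> < s \<Longrightarrow> s \<le> t' \<Longrightarrow> u \<theta> (y, s) < D + e"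
proof -
  define D1 where "D1 = D + 1"
  define P where "P = D1 + D1\<^sup>2 + 1"
  have P: "P > 0" using D by (simp add: P_def D1_def add_pos_nonneg)
  define \<eta> where "\<eta> = e / (4 * P)"
  have \<eta>: "\<eta> > 0" "\<eta> * P = e / 4" using e P by (auto simp: \<eta>_def)
  obtain A \<delta> \<theta>0 where A: "A > 0" "\<delta> > 0" "\<theta>0 > 0"
    "\<And>\<theta> t' z y s. \<theta>0 \<le> \<theta> \<Longrightarrow> t \<le> t' \<Longrightarrow> t' < T \<Longrightarrow> w (z, t') \<le> 0 \<Longrightarrow> t' - \<delta> \<le> s \<Longrightarrow> s \<le> t' \<Longrightarrow>
       u \<theta> (y, s) \<le> (1 + \<eta>) * norm (y - z) + \<eta> * (norm (y - z))\<^sup>2 + A * (t' - s) + \<eta>"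
    using upper_barrier[OF \<eta>(1) t] by blast
  define \<tau> where "\<tau> = Min {\<delta> / 2, 1 / 2, e / 16, e / (8 * A)}"
  have \<tau>: "\<tau> > 0" "\<tau> \<le> \<delta> / 2" "\<tau> \<le> 1 / 2" "\<tau> \<le> e / 16" "\<tau> \<le> e / (8 * A)"
    using A e by (auto simp: \<tau>_def)
  have "A * \<tau> \<le> A * (e / (8 * A))" using \<tau>(5) A(1) by (intro mult_left_mono) auto
  then have A\<tau>: "A * \<tau> \<le> e / 8" using A by simp
  show ?thesis
  proof (rule that[OF \<tau>(1) A(3)])
    fix \<theta> t' z y s
    assume h: "\<theta>0 \<le> \<theta>" "t \<le> t'" "t' \<le> t + \<tau>" "t' < T" "w (z, t') \<le> 0" "norm (x - z) \<le> D + \<tau>"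
      "norm (y - x) < \<tau>" "t - \<tau> < s" "s \<le> t'"
    define n where "n = norm (y - z)"
    have "n \<le> norm (y - x) + norm (x - z)" unfolding n_def by (rule norm_diff_triangle_le[OF order_refl order_refl])
    then have n: "0 \<le> n" "n \<le> D + 2 * \<tau>" "n \<le> D1" using h \<tau> by (auto simp: n_def D1_def)
    have "u \<theta> (y, s) \<le> (1 + \<eta>) * n + \<eta> * n\<^sup>2 + A * (t' - s) + \<eta>"
      unfolding n_def using h \<tau> by (intro A(4)) auto
    also have "\<dots> = n + \<eta> * (n + n\<^sup>2 + 1) + A * (t' - s)" by (simp add: algebra_simps)
    also have "\<dots> \<le> (D + 2 * \<tau>) + \<eta> * P + A * (2 * \<tau>)"
      unfolding P_def using n \<eta> A h by (intro add_mono mult_left_mono power_mono) auto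
    also have "\<dots> < D + e" using \<eta>(2) A\<tau> \<tau> e by simp
    finally show "u \<theta> (y, s) < D + e" .
  qed
qed

lemma nearest_zero:
  assumes "0 \<le> t" "t < T" "zero_level (\<lambda>x t. w (x, t)) t \<noteq> {}"
  obtains z where "w (z, t) \<le> 0" "norm (x - z) \<le> max 0 (sd x t)"
proof (cases "w (x, t) \<le> 0")
  case True
  then show ?thesis using that[of x] by simp
next
  case False
  obtain z where z: "z \<in> zero_level (\<lambda>x t. w (x, t)) t" "infdist x (zero_level (\<lambda>x t. w (x, t)) t) = dist x z"
    using infdist_attains_inf[OF zero_level_closed assms(3)] assms by blast
  then show ?thesis using that[of z] False by (auto simp: sd_def signed_distance_def zero_level_def dist_norm)
qed

text \<open>The mirror image of \<open>lower_limit\<close>: off the zero level the sign of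
  \<open>w\<close> persists in both time directions, so both sides of \<open>t\<close> are
  covered.\<close>

lemma negative_limit:
  assumes t: "0 < t" "t < T" and ne: "zero_level (\<lambda>x t. w (x, t)) t \<noteq> {}" and x: "w (x, t) < 0" and e: "e > 0"
  obtains \<tau> \<theta>0 where "\<tau> > 0" "\<theta>0 > 0"
    "\<And>\<theta> y s. \<theta>0 \<le> \<theta> \<Longrightarrow> norm (y - x) < \<tau> \<Longrightarrow> \<bar>s - t\<bar> < \<tau> \<Longrightarrow> u \<theta> (y, s) < sd x t + e"
proof -
  interpret d: reinit T L L1 L2 bL B "\<lambda>x. - u0 x" "\<lambda>x t p. - H x t (- p)" "\<lambda>r. - \<beta> (- r)" "\<lambda>p. h (- p)"
    "\<lambda>z. - w z" "\<lambda>\<theta> z. - u \<theta> z" by (rule dual)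
  have "zero_level (\<lambda>x t. - w (x, t)) t \<noteq> {}" using ne by (simp add: zero_level_def)
  from d.lower_limit[OF t this _ e, of x] x obtain \<tau> \<theta>0 where *: "\<tau> > 0" "\<theta>0 > 0"
    "\<And>\<theta> y s. \<theta>0 \<le> \<theta> \<Longrightarrow> norm (y - x) < \<tau> \<Longrightarrow> \<bar>s - t\<bar> < \<tau> \<Longrightarrow> d.sd x t - e < - u \<theta> (y, s)" by auto
  have "d.sd x t = - sd x t" by (simp add: d.sd_def sd_def signed_distance_uminus)
  with * show ?thesis using that by force
qed

text \<open>Where \<open>w \<ge> 0\<close>, a nearest zero at time \<open>t\<close> controls
  \<open>u \<theta>\<close> only up to time \<open>t\<close>. This is where the condition
  \<open>s \<le> t\<close> arises.\<close>

lemma upper_limit: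
  assumes t: "0 < t" "t < T" and ne: "zero_level (\<lambda>x t. w (x, t)) t \<noteq> {}" and e: "e > 0"
  obtains \<tau> \<theta>0 where "\<tau> > 0" "\<theta>0 > 0"
    "\<And>\<theta> y s. \<theta>0 \<le> \<theta> \<Longrightarrow> norm (y - x) < \<tau> \<Longrightarrow> \<bar>s - t\<bar> < \<tau> \<Longrightarrow> s \<le> t \<Longrightarrow> u \<theta> (y, s) < sd x t + e"
proof (cases "w (x, t) < 0")
  case True
  then show ?thesis using negative_limit[OF t ne _ e] that by metis
next
  case False
  then have sd: "sd x t \<ge> 0" by (simp add: sd_def signed_distance_def infdist_nonneg)
  obtain z where z: "w (z, t) \<le> 0" "norm (x - z) \<le> sd x t" using nearest_zero[OF _ t(2) ne, of x] t sd by auto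
  obtain \<tau> \<theta>0 where *: "\<tau> > 0" "\<theta>0 > 0"
    "\<And>\<theta> t' z y s. \<theta>0 \<le> \<theta> \<Longrightarrow> t \<le> t' \<Longrightarrow> t' \<le> t + \<tau> \<Longrightarrow> t' < T \<Longrightarrow> w (z, t') \<le> 0 \<Longrightarrow> norm (x - z) \<le> sd x t + \<tau> \<Longrightarrow>
       norm (y - x) < \<tau> \<Longrightarrow> t - \<tau> < s \<Longrightarrow> s \<le> t' \<Longrightarrow> u \<theta> (y, s) < sd x t + e"
    using upper_near[OF t(1) sd e, of x] by blast
  show ?thesis
    by (rule that[OF *(1,2)], rule *(3)[where t' = t and z = z]) (use t z *(1) in auto)
qed

text \<open>Continuity of the signed distance supplies, at a slightly later time \<open>t'\<close>,
  a point with \<open>w \<le> 0\<close> almost as close to \<open>x\<close>. Its barrier covers all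
  times up to \<open>t'\<close>, hence a full neighbourhood of \<open>t\<close>.\<close>

lemma upper_limit_continuous:
  assumes t: "0 < t" "t < T" and ne: "\<And>t. 0 < t \<Longrightarrow> t < T \<Longrightarrow> zero_level (\<lambda>x t. w (x, t)) t \<noteq> {}"
    and c: "continuous_on Q (\<lambda>(x, t). sd x t)" and e: "e > 0"
  obtains \<tau> \<theta>0 where "\<tau> > 0" "\<theta>0 > 0"
    "\<And>\<theta> y s. \<theta>0 \<le> \<theta> \<Longrightarrow> norm (y - x) < \<tau> \<Longrightarrow> \<bar>s - t\<bar> < \<tau> \<Longrightarrow> u \<theta> (y, s) < sd x t + e"
proof (cases "w (x, t) < 0")
  case True
  then show ?thesis using negative_limit[OF t ne[OF t] _ e] that by metis
next
  case False
  then have sd: "sd x t \<ge> 0" by (simp add: sd_def signed_distance_def infdist_nonneg)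
  obtain \<tau> \<theta>0 where *: "\<tau> > 0" "\<theta>0 > 0"
    "\<And>\<theta> t' z y s. \<theta>0 \<le> \<theta> \<Longrightarrow> t \<le> t' \<Longrightarrow> t' \<le> t + \<tau> \<Longrightarrow> t' < T \<Longrightarrow> w (z, t') \<le> 0 \<Longrightarrow> norm (x - z) \<le> sd x t + \<tau> \<Longrightarrow>
       norm (y - x) < \<tau> \<Longrightarrow> t - \<tau> < s \<Longrightarrow> s \<le> t' \<Longrightarrow> u \<theta> (y, s) < sd x t + e"
    using upper_near[OF t(1) sd e, of x] by blast
  have "continuous_on {0<..<T} (\<lambda>s. (\<lambda>(x, t). sd x t) (x, s))"
    by (rule continuous_on_compose2[OF c]) (auto intro!: continuous_intros)
  then have "continuous_on {0<..<T} (\<lambda>s. sd x s)" by simp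
  from this[unfolded continuous_on_iff, rule_format, of t \<tau>] t *(1)
  obtain d where d: "d > 0" "\<And>s. s \<in> {0<..<T} \<Longrightarrow> dist s t < d \<Longrightarrow> dist (sd x s) (sd x t) < \<tau>" by auto
  \<comment> \<open>The time \<open>t + m\<close> is at most \<open>\<tau>\<close> after
    \<open>t\<close>, inside the continuity radius \<open>d\<close>, and before
    \<open>T\<close>.\<close>
  define m where "m = Min {\<tau>, d / 2, T / 2 - t / 2}"
  have "m > 0" using t d(1) *(1) by (simp add: m_def)
  moreover have "m \<le> \<tau>" "m \<le> d / 2" "m \<le> T / 2 - t / 2" unfolding m_def by (rule Min_le; simp)+
  moreover define t' where "t' = t + m"
  ultimately have t': "t < t'" "t' \<le> t + \<tau>" "t' < t + d" "t' < T" using t d(1) by linarith+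
  have t'0: "0 < t'" using t t' by simp
  obtain z where z: "w (z, t') \<le> 0" "norm (x - z) \<le> max 0 (sd x t')" using nearest_zero[OF _ t'(4) ne[OF t'0 t'(4)], of x] t'0 by auto
  have "dist (sd x t') (sd x t) < \<tau>" using t' t'0 by (intro d(2)) (auto simp: dist_real_def)
  then have z2: "norm (x - z) \<le> sd x t + \<tau>" using z(2) sd *(1) by (auto simp: dist_real_def)
  show ?thesis
  proof (rule that[of "min \<tau> (t' - t)" \<theta>0])
    fix \<theta> y s assume "\<theta>0 \<le> \<theta>" "norm (y - x) < min \<tau> (t' - t)" "\<bar>s - t\<bar> < min \<tau> (t' - t)"
    then show "u \<theta> (y, s) < sd x t + e" using t' z z2 by (intro *(3)[where t' = t' and z = z]) auto
  qed (use t' * in auto)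
qed

lemma past_limit:
  assumes t: "0 < t" "t < T" and ne: "zero_level (\<lambda>x t. w (x, t)) t \<noteq> {}" and e: "e > 0"
  obtains \<tau> \<theta>0 where "\<tau> > 0" "\<theta>0 > 0"
    "\<And>\<theta> y s. \<theta>0 \<le> \<theta> \<Longrightarrow> norm (y - x) < \<tau> \<Longrightarrow> \<bar>s - t\<bar> < \<tau> \<Longrightarrow> s \<le> t \<Longrightarrow> \<bar>u \<theta> (y, s) - sd x t\<bar> < e"
proof -
  interpret d: reinit T L L1 L2 bL B "\<lambda>x. - u0 x" "\<lambda>x t p. - H x t (- p)" "\<lambda>r. - \<beta> (- r)" "\<lambda>p. h (- p)"
    "\<lambda>z. - w z" "\<lambda>\<theta> z. - u \<theta> z" by (rule dual)
  have ne': "zero_level (\<lambda>x t. - w (x, t)) t \<noteq> {}" using ne by (simp add: zero_level_def)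
  have sd: "d.sd x t = - sd x t" by (simp add: d.sd_def sd_def signed_distance_uminus)
  obtain \<tau>1 \<theta>1 where 1: "\<tau>1 > 0" "\<theta>1 > 0"
    "\<And>\<theta> y s. \<theta>1 \<le> \<theta> \<Longrightarrow> norm (y - x) < \<tau>1 \<Longrightarrow> \<bar>s - t\<bar> < \<tau>1 \<Longrightarrow> s \<le> t \<Longrightarrow> u \<theta> (y, s) < sd x t + e"
    using upper_limit[OF t ne e] by blast
  obtain \<tau>2 \<theta>2 where 2: "\<tau>2 > 0" "\<theta>2 > 0"
    "\<And>\<theta> y s. \<theta>2 \<le> \<theta> \<Longrightarrow> norm (y - x) < \<tau>2 \<Longrightarrow> \<bar>s - t\<bar> < \<tau>2 \<Longrightarrow> s \<le> t \<Longrightarrow> - u \<theta> (y, s) < d.sd x t + e"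
    using d.upper_limit[OF t ne' e] by blast
  show ?thesis
  proof (rule that[of "min \<tau>1 \<tau>2" "max \<theta>1 \<theta>2"])
    fix \<theta> y s assume "max \<theta>1 \<theta>2 \<le> \<theta>" "norm (y - x) < min \<tau>1 \<tau>2" "\<bar>s - t\<bar> < min \<tau>1 \<tau>2" "s \<le> t"
    then show "\<bar>u \<theta> (y, s) - sd x t\<bar> < e" using 1(3)[of \<theta> y s] 2(3)[of \<theta> y s] by (simp add: sd abs_less_iff)
  qed (use 1 2 in auto)
qed

lemma full_limit:
  assumes t: "0 < t" "t < T" and ne: "\<And>t. 0 < t \<Longrightarrow> t < T \<Longrightarrow> zero_level (\<lambda>x t. w (x, t)) t \<noteq> {}"
    and c: "continuous_on Q (\<lambda>(x, t). sd x t)" and e: "e > 0"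
  obtains \<tau> \<theta>0 where "\<tau> > 0" "\<theta>0 > 0"
    "\<And>\<theta> y s. \<theta>0 \<le> \<theta> \<Longrightarrow> norm (y - x) < \<tau> \<Longrightarrow> \<bar>s - t\<bar> < \<tau> \<Longrightarrow> \<bar>u \<theta> (y, s) - sd x t\<bar> < e"
proof -
  interpret d: reinit T L L1 L2 bL B "\<lambda>x. - u0 x" "\<lambda>x t p. - H x t (- p)" "\<lambda>r. - \<beta> (- r)" "\<lambda>p. h (- p)"
    "\<lambda>z. - w z" "\<lambda>\<theta> z. - u \<theta> z" by (rule dual)
  have ne': "zero_level (\<lambda>x t. - w (x, t)) t \<noteq> {}" if "0 < t" "t < T" for t using ne[OF that] by (simp add: zero_level_def)
  have sd: "d.sd x t = - sd x t" for x t by (simp add: d.sd_def sd_def signed_distance_uminus)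
  have c': "continuous_on Q (\<lambda>(x, t). d.sd x t)"
    using continuous_on_minus[OF c] by (simp add: sd case_prod_unfold)
  obtain \<tau>1 \<theta>1 where 1: "\<tau>1 > 0" "\<theta>1 > 0"
    "\<And>\<theta> y s. \<theta>1 \<le> \<theta> \<Longrightarrow> norm (y - x) < \<tau>1 \<Longrightarrow> \<bar>s - t\<bar> < \<tau>1 \<Longrightarrow> u \<theta> (y, s) < sd x t + e"
    using upper_limit_continuous[OF t ne c e] by blast
  obtain \<tau>2 \<theta>2 where 2: "\<tau>2 > 0" "\<theta>2 > 0"
    "\<And>\<theta> y s. \<theta>2 \<le> \<theta> \<Longrightarrow> norm (y - x) < \<tau>2 \<Longrightarrow> \<bar>s - t\<bar> < \<tau>2 \<Longrightarrow> - u \<theta> (y, s) < d.sd x t + e"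
    using d.upper_limit_continuous[OF t ne' c' e] by blast
  show ?thesis
  proof (rule that[of "min \<tau>1 \<tau>2" "max \<theta>1 \<theta>2"])
    fix \<theta> y s assume "max \<theta>1 \<theta>2 \<le> \<theta>" "norm (y - x) < min \<tau>1 \<tau>2" "\<bar>s - t\<bar> < min \<tau>1 \<tau>2"
    then show "\<bar>u \<theta> (y, s) - sd x t\<bar> < e" using 1(3)[of \<theta> y s] 2(3)[of \<theta> y s] by (simp add: sd abs_less_iff)
  qed (use 1 2 in auto)
qed

end

text \<open>For large \<open>\<theta>\<close> the value \<open>f \<theta> y\<close> is close to both
  \<open>l y\<close> and \<open>l z\<close>, so these are close to each other as well; a finite
  subcover then makes the threshold uniform.\<close>

lemma locally_uniform_limitI:
  fixes f :: "real \<Rightarrow> 'b::topological_space \<Rightarrow> 'c::metric_space"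
  assumes "\<And>z e. z \<in> S \<Longrightarrow> e > 0 \<Longrightarrow>
    \<exists>N \<theta>0. open N \<and> z \<in> N \<and> (\<forall>y\<in>N \<inter> S. \<forall>\<theta>\<ge>\<theta>0. dist (f \<theta> y) (l z) < e)"
  shows "locally_uniform_limit S f l at_top"
  unfolding locally_uniform_limit_def
proof (intro allI impI)
  fix K assume K: "compact K" "K \<subseteq> S"
  show "uniform_limit K f l at_top"
    unfolding uniform_limit_iff
  proof (intro allI impI)
    fix e :: real assume e: "e > 0"
    have "\<forall>z\<in>K. \<exists>N \<theta>0. open N \<and> z \<in> N \<and> (\<forall>y\<in>N \<inter> S. \<forall>\<theta>\<ge>\<theta>0. dist (f \<theta> y) (l z) < e / 3)"
      using assms K(2) e by (metis subsetD divide_pos_pos zero_less_numeral)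
    then obtain N \<theta>0 where N: "\<And>z. z \<in> K \<Longrightarrow> open (N z) \<and> z \<in> N z"
      "\<And>z y \<theta>. z \<in> K \<Longrightarrow> y \<in> N z \<inter> S \<Longrightarrow> \<theta>0 z \<le> \<theta> \<Longrightarrow> dist (f \<theta> y) (l z) < e / 3"
      by metis
    have "K \<subseteq> (\<Union>z\<in>K. N z)" using N(1) by blast
    then obtain C where C: "C \<subseteq> K" "finite C" "K \<subseteq> (\<Union>z\<in>C. N z)"
      using compactE_image[OF K(1), of K N] N(1) by blast
    define M where "M = Max (insert 0 (\<theta>0 ` C))"
    have M: "\<theta>0 z \<le> M" if "z \<in> C" for z using C(2) that by (auto simp: M_def)
    have "dist (f \<theta> y) (l y) < e" if M': "\<theta> \<ge> M" and y: "y \<in> K" for \<theta> y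
    proof -
      obtain z where z: "z \<in> C" "y \<in> N z" using C(3) y by blast
      have zK: "z \<in> K" "y \<in> N z \<inter> S" "y \<in> N y \<inter> S" using z C(1) y K(2) N(1) by auto
      have "dist (f \<theta> y) (l z) < e / 3" using N(2)[OF zK(1,2)] M[OF z(1)] M' by simp
      moreover have "dist (f (max M (\<theta>0 y)) y) (l z) < e / 3" using N(2)[OF zK(1,2)] M[OF z(1)] by (simp add: max.coboundedI1)
      moreover have "dist (f (max M (\<theta>0 y)) y) (l y) < e / 3" using N(2)[OF y zK(3)] by simp
      ultimately show ?thesis
        using dist_triangle[of "f \<theta> y" "l y" "l z"] dist_triangle3[of "l z" "l y" "f (max M (\<theta>0 y)) y"] by linarith
    qed
    then show "\<forall>\<^sub>F \<theta> in at_top. \<forall>y\<in>K. dist (f \<theta> y) (l y) < e"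
      by (intro eventually_mono[OF eventually_ge_at_top[of M]]) auto
  qed
qed

subsection \<open>From viscosity solutions to superdifferentials\<close>

lemma usc_envelope_continuous:
  fixes f :: "'b::t2_space \<Rightarrow> real"
  assumes "open S" "continuous_on S f" "z \<in> S"
  shows "usc_envelope S f z = ereal (f z)"
  unfolding usc_envelope_def
proof (rule lim_imp_Limsup)
  show "inf (nhds z) (principal S) \<noteq> bot"
  proof
    assume "inf (nhds z) (principal S) = bot"
    then have "\<forall>\<^sub>F y in inf (nhds z) (principal S). False" by simp
    then show False using assms(3) eventually_nhds_x_imp_x unfolding eventually_inf_principal by blast
  qed
  have "isCont f z" using assms by (simp add: continuous_on_eq_continuous_at)
  then have "(f \<longlongrightarrow> f z) (nhds z)" by (simp add: continuous_at tendsto_at_iff_tendsto_nhds)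
  then have "(f \<longlongrightarrow> f z) (inf (nhds z) (principal S))" by (rule tendsto_mono[OF inf_le1])
  then show "((\<lambda>y. ereal (f y)) \<longlongrightarrow> ereal (f z)) (inf (nhds z) (principal S))" by simp
qed

lemma lsc_envelope_eq: "lsc_envelope S f z = - usc_envelope S (\<lambda>y. - f y) z"
  unfolding lsc_envelope_def usc_envelope_def ereal_Liminf_uminus[symmetric] by simp

lemma viscosity_supersolution_dual:
  assumes "viscosity_supersolution F T u"
  shows "viscosity_subsolution (dual F) T (\<lambda>x t. - u x t)"
  unfolding viscosity_subsolution_def
proof (intro allI impI)
  fix \<phi> g x t
  assume z: "(x, t) \<in> spacetime T" and C1: "C1_with_gradient (spacetime T) \<phi> g"
    and top: "touches_above (spacetime T) (usc_envelope (spacetime T) (\<lambda>(y, s). - u y s)) \<phi> (x, t)"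
  have "C1_with_gradient (spacetime T) (\<lambda>z. - \<phi> z) (\<lambda>z. - g z)"
    using C1 unfolding C1_with_gradient_def by (auto intro!: continuous_intros GDERIV_minus)
  moreover have "touches_below (spacetime T) (lsc_envelope (spacetime T) (\<lambda>(y, s). u y s)) (\<lambda>z. - \<phi> z) (x, t)"
  proof -
    have eq: "lsc_envelope (spacetime T) (\<lambda>(y, s). u y s) z = - usc_envelope (spacetime T) (\<lambda>(y, s). - u y s) z" for z
      by (simp add: lsc_envelope_eq case_prod_unfold)
    have "\<forall>\<^sub>F y in inf (nhds (x, t)) (principal (spacetime T)). usc_envelope (spacetime T) (\<lambda>(y, s). - u y s) y \<le> ereal (\<phi> y)"
      using top by (simp add: touches_above_def)
    then have "\<forall>\<^sub>F y in inf (nhds (x, t)) (principal (spacetime T)). ereal (- \<phi> y) \<le> - usc_envelope (spacetime T) (\<lambda>(y, s). - u y s) y"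
      by eventually_elim (metis ereal_minus_le_minus uminus_ereal.simps(1))
    then show ?thesis using top by (simp add: touches_below_def touches_above_def eq)
  qed
  ultimately have "snd (- g (x, t)) \<ge> F x t (- \<phi> (x, t)) (fst (- g (x, t)))"
    using assms z unfolding viscosity_supersolution_def by blast
  then show "snd (g (x, t)) \<le> dual F x t (\<phi> (x, t)) (fst (g (x, t)))" by (simp add: dual_def)
qed

text \<open>The test function of a superdifferential is not of class C1 away from the point. A
  paraboloid touching \<open>u\<close> at a nearby maximum replaces it, and continuity of
  \<open>F\<close> and \<open>u\<close> carries the inequality to the limit.\<close>

lemma viscosity_subsolution_jetsub:
  fixes u :: "'a::euclidean_space \<Rightarrow> real \<Rightarrow> real"
  assumes sub: "viscosity_subsolution F T u" and U: "continuous_on (spacetime T) (\<lambda>(x, t). u x t)"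
    and F: "continuous_on {(x, t, r, p). (x, t) \<in> spacetime T} (\<lambda>(x, t, r, p). F x t r p)"
  shows "jetsub F (spacetime T) (\<lambda>(x, t). u x t)"
  unfolding jetsub_def
proof (intro allI impI)
  fix x0 t0 p a assume z0: "(x0, t0) \<in> spacetime T" and j: "supergrad UNIV (\<lambda>(x, t). u x t) (x0, t0) (p, a)"
  let ?Q = "spacetime T :: ('a \<times> real) set"
  let ?U = "\<lambda>(x, t). u x t" and ?z = "(x0, t0)" and ?g = "(p, a)"
  have oQ: "open ?Q" unfolding spacetime_def by (intro open_Times) auto
  have step: "\<exists>z g. z \<in> ?Q \<and> norm (z - ?z) \<le> e \<and> norm (g - ?g) \<le> 4 * e \<and> snd g \<le> F (fst z) (snd z) (?U z) (fst g)"
    if e: "e > 0" for e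
  proof -
    obtain r1 where r1: "r1 > 0" "\<And>y. norm (y - ?z) < r1 \<Longrightarrow> ?U y \<le> ?U ?z + ?g \<bullet> (y - ?z) + e * norm (y - ?z)"
      using supergrad_eps[OF j e] by blast
    obtain r2 where r2: "r2 > 0" "cball ?z r2 \<subseteq> ?Q" using oQ z0 by (meson open_contains_cball)
    define r where "r = Min {r1 / 2, r2, e}"
    have r: "r > 0" "r < r1" "r \<le> r2" "r \<le> e" using r1 r2 e by (auto simp: r_def)
    have sub': "cball ?z r \<subseteq> ?Q" using r r2 by (meson order_trans subset_cball)
    \<comment> \<open>On the sphere of radius \<open>r\<close> the quadratic term equals
      \<open>2 * e * r\<close> and beats the error \<open>e * r\<close>, so the maximum is interior;
      the gradient changes by at most \<open>2 * C * r = 4 * e\<close>.\<close>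
    define C where "C = 2 * e / r"
    have C: "C > 0" "C * r = 2 * e" using e r by (auto simp: C_def)
    let ?f = "\<lambda>y. ?U y - ?g \<bullet> (y - ?z) - C * (norm (y - ?z))\<^sup>2"
    have "cball ?z r \<noteq> {}" using r by simp
    moreover have "continuous_on (cball ?z r) ?f"
      by (intro continuous_intros continuous_on_subset[OF U sub'])
    ultimately obtain z1 where z1: "z1 \<in> cball ?z r" "\<And>y. y \<in> cball ?z r \<Longrightarrow> ?f y \<le> ?f z1"
      using continuous_attains_sup[OF compact_cball] by blast
    have n1: "norm (z1 - ?z) < r"
    proof (rule ccontr)
      assume "\<not> ?thesis"
      then have n: "norm (z1 - ?z) = r" using z1(1) by (simp add: dist_norm norm_minus_commute)
      have "?f ?z \<le> ?f z1" using r by (intro z1(2)) simp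
      moreover have "?U z1 \<le> ?U ?z + ?g \<bullet> (z1 - ?z) + e * r" using r1(2)[of z1] n r by simp
      moreover have "C * r\<^sup>2 = 2 * e * r" using C by (simp add: power2_eq_square mult.assoc[symmetric])
      ultimately have "2 * e * r \<le> e * r" by (simp add: n)
      then show False using e r by simp
    qed
    let ?\<phi> = "\<lambda>y. ?U z1 + ?g \<bullet> (y - z1) + C * ((norm (y - ?z))\<^sup>2 - (norm (z1 - ?z))\<^sup>2)"
    let ?G = "\<lambda>y. ?g + (2 * C) *\<^sub>R (y - ?z)"
    have "C1_with_gradient ?Q ?\<phi> ?G"
      unfolding C1_with_gradient_def gderiv_def power2_norm_eq_inner
    proof (intro conjI ballI)
      fix y :: "'a \<times> real"
      show "((\<lambda>y. ?U z1 + ?g \<bullet> (y - z1) + C * ((y - ?z) \<bullet> (y - ?z) - (z1 - ?z) \<bullet> (z1 - ?z))) has_derivative (\<lambda>h. h \<bullet> ?G y)) (at y)"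
        by (rule has_derivative_eq_rhs, (rule derivative_eq_intros refl)+)
          (simp only: fun_eq_iff inner_add_right inner_scaleR_right inner_commute, simp add: inner_commute algebra_simps)
    qed (intro continuous_intros)
    note c1 = this
    have z1Q: "z1 \<in> ?Q" using z1(1) sub' by blast
    have ta: "touches_above ?Q (usc_envelope ?Q ?U) ?\<phi> z1"
      unfolding touches_above_def
    proof
      show "usc_envelope ?Q ?U z1 = ereal (?\<phi> z1)" using usc_envelope_continuous[OF oQ U z1Q] by simp
      have "z1 \<in> ball ?z r" using n1 by (simp add: dist_norm norm_minus_commute)
      then have "\<forall>\<^sub>F y in nhds z1. y \<in> ball ?z r" by (intro eventually_nhds_in_open) auto
      then have "\<forall>\<^sub>F y in inf (nhds z1) (principal ?Q). y \<in> ball ?z r" by (simp add: eventually_inf_principal eventually_mono)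
      then show "\<forall>\<^sub>F y in inf (nhds z1) (principal ?Q). usc_envelope ?Q ?U y \<le> ereal (?\<phi> y)"
      proof eventually_elim
        case (elim y)
        then have "y \<in> cball ?z r" by simp
        moreover from this have "usc_envelope ?Q ?U y = ereal (?U y)" using sub' by (intro usc_envelope_continuous[OF oQ U]) auto
        moreover have "?g \<bullet> (y - z1) = ?g \<bullet> (y - ?z) - ?g \<bullet> (z1 - ?z)" unfolding inner_diff_right by simp
        ultimately show ?case using z1(2)[of y] by (simp only: ereal_less_eq) (simp add: right_diff_distrib)
      qed
    qed
    have "snd (?G z1) \<le> F (fst z1) (snd z1) (?\<phi> z1) (fst (?G z1))"
      by (rule sub[unfolded viscosity_subsolution_def, rule_format, OF _ c1, of "fst z1" "snd z1", unfolded prod.collapse, OF z1Q ta])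
    moreover have "norm (?G z1 - ?g) \<le> 4 * e"
    proof -
      have "2 * C * norm (z1 - ?z) \<le> 2 * C * r" using n1 C by (intro mult_left_mono) auto
      then show ?thesis using C by simp
    qed
    ultimately show ?thesis using z1Q n1 r by (intro exI[of _ z1] exI[of _ "?G z1"]) simp
  qed
  have "\<forall>n. \<exists>z g. z \<in> ?Q \<and> norm (z - ?z) \<le> inverse (real (Suc n)) \<and> norm (g - ?g) \<le> 4 * inverse (real (Suc n)) \<and>
     snd g \<le> F (fst z) (snd z) (?U z) (fst g)"
    using step by simp
  then obtain z g where zg: "\<And>n. z n \<in> ?Q" "\<And>n. norm (z n - ?z) \<le> inverse (real (Suc n))"
    "\<And>n. norm (g n - ?g) \<le> 4 * inverse (real (Suc n))" "\<And>n. snd (g n) \<le> F (fst (z n)) (snd (z n)) (?U (z n)) (fst (g n))"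
    by metis
  have lim0: "(\<lambda>n. inverse (real (Suc n))) \<longlonglongrightarrow> 0" by (rule LIMSEQ_inverse_real_of_nat)
  have lim4: "(\<lambda>n. 4 * inverse (real (Suc n))) \<longlonglongrightarrow> 0" using tendsto_mult_left[OF lim0, of 4] by simp
  have lz: "z \<longlonglongrightarrow> ?z" and lg: "g \<longlonglongrightarrow> ?g"
    using Lim_null_comparison[OF always_eventually[OF allI[OF zg(2)]] lim0]
      Lim_null_comparison[OF always_eventually[OF allI[OF zg(3)]] lim4]
    by (simp_all add: LIM_zero_iff)
  have lU: "(\<lambda>n. ?U (z n)) \<longlonglongrightarrow> ?U ?z" by (rule continuous_on_tendsto_compose[OF U lz z0]) (simp add: zg)
  have "(\<lambda>n. (\<lambda>(x, t, r, p). F x t r p) (fst (z n), snd (z n), ?U (z n), fst (g n))) \<longlonglongrightarrow> (\<lambda>(x, t, r, p). F x t r p) (x0, t0, ?U ?z, p)"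
    by (rule continuous_on_tendsto_compose[OF F])
      (use tendsto_Pair[OF tendsto_fst[OF lz] tendsto_Pair[OF tendsto_snd[OF lz] tendsto_Pair[OF lU tendsto_fst[OF lg]]]] z0 zg(1) in auto)
  from LIMSEQ_le[OF tendsto_snd[OF lg] this] zg(4) show "a \<le> F x0 t0 (?U (x0, t0)) p" by auto
qed

lemma viscosity_ivp_jet_ivp:
  fixes U :: "'a::euclidean_space \<Rightarrow> real \<Rightarrow> real"
  assumes U: "viscosity_ivp_solution F T u0 U"
    and F: "continuous_on {(x, t, r, p). (x, t) \<in> spacetime T} (\<lambda>(x, t, r, p). F x t r p)"
  shows "jet_ivp F T u0 (\<lambda>(x, t). U x t)"
proof -
  have sub: "viscosity_subsolution F T U" and sup: "viscosity_subsolution (dual F) T (\<lambda>x t. - U x t)"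
    and c: "continuous_on (UNIV \<times> {0..<T}) (\<lambda>(x, t). U x t)" and i: "\<And>x. U x 0 = u0 x"
    using U viscosity_supersolution_dual by (auto simp: viscosity_ivp_solution_def viscosity_solution_def)
  obtain K where K: "K > 0" "\<And>x t. t \<in> {0..<T} \<Longrightarrow> u0 x - K * t \<le> U x t \<and> U x t \<le> u0 x + K * t"
    using U by (auto simp: viscosity_ivp_solution_def)
  have cQ: "continuous_on (spacetime T) (\<lambda>(x, t). U x t)"
    by (rule continuous_on_subset[OF c]) (auto simp: spacetime_def)
  have cQ': "continuous_on (spacetime T) (\<lambda>(x, t). - U x t)"
    using continuous_on_minus[OF cQ] by (simp add: case_prod_unfold)
  have F': "continuous_on {(x, t, r, p). (x, t) \<in> spacetime T} (\<lambda>(x, t, r, p). dual F x t r p)"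
  proof -
    have "continuous_on {(x, t, r, p). (x, t) \<in> spacetime T}
      (\<lambda>m. (\<lambda>(x, t, r, p). F x t r p) (fst m, fst (snd m), - fst (snd (snd m)), - snd (snd (snd m))))"
      by (rule continuous_on_compose2[OF F]) (auto intro!: continuous_intros)
    from continuous_on_minus[OF this] show ?thesis by (simp add: dual_def case_prod_unfold)
  qed
  have "jetsub F (UNIV \<times> {0<..<T}) (\<lambda>(x, t). U x t)"
    using viscosity_subsolution_jetsub[OF sub cQ F] by (simp add: spacetime_def)
  moreover have "jetsub (dual F) (UNIV \<times> {0<..<T}) (\<lambda>z. - (case z of (x, t) \<Rightarrow> U x t))"
    using viscosity_subsolution_jetsub[OF sup cQ' F'] by (simp add: spacetime_def case_prod_unfold)
  moreover have "\<bar>U x t - u0 x\<bar> \<le> K * t" if "0 \<le> t" "t < T" for x t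
    using K(2)[of t x] that by (simp add: abs_le_iff)
  ultimately show ?thesis using c i K(1) unfolding jet_ivp_def by auto
qed

lemma modulus_uniformly_continuous:
  fixes h :: "'a::real_normed_vector \<Rightarrow> real"
  assumes "modulus \<omega>" "\<And>p q. \<bar>h p - h q\<bar> \<le> \<omega> (norm (p - q))"
  shows "uniformly_continuous_on UNIV h"
  unfolding uniformly_continuous_on_def
proof (intro allI impI)
  fix e :: real assume e: "e > 0"
  have "(\<omega> \<longlongrightarrow> 0) (at_right 0)" "\<omega> 0 = 0" using assms(1) by (auto simp: modulus_def)
  from order_tendstoD(2)[OF this(1) e] obtain d where d: "d > 0" "\<And>r. 0 < r \<Longrightarrow> r < d \<Longrightarrow> \<omega> r < e"
    by (auto simp: eventually_at_right_field)
  have "dist (h q) (h p) < e" if "dist q p < d" for p q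
  proof (cases "q = p")
    case False
    then show ?thesis using assms(2)[of q p] d(2)[of "norm (q - p)"] that by (simp add: dist_norm)
  qed (use e in simp)
  then show "\<exists>d>0. \<forall>p\<in>UNIV. \<forall>q\<in>UNIV. dist q p < d \<longrightarrow> dist (h q) (h p) < e" using d(1) by blast
qed

theorem theorem2p1:
  fixes T :: real
    and u\<^sub>0 :: "real ^ 'n \<Rightarrow> real"
    and H\<^sub>1 :: "real ^ 'n \<Rightarrow> real \<Rightarrow> real ^ 'n \<Rightarrow> real"
    and \<beta> :: "real \<Rightarrow> real"
    and h :: "real ^ 'n \<Rightarrow> real"
    and w :: "real ^ 'n \<Rightarrow> real \<Rightarrow> real"
    and u :: "real \<Rightarrow> real ^ 'n \<Rightarrow> real \<Rightarrow> real"
  assumes T_pos: "T > 0"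
    and u0_lipschitz: "\<exists>L. L-lipschitz_on UNIV u\<^sub>0"
    and H1_continuous: "continuous_on (UNIV \<times> {0..T} \<times> UNIV) (\<lambda>(x, t, p). H\<^sub>1 x t p)"
    and H1_homogeneous: "\<forall>c>0. \<forall>x. \<forall>t\<in>{0..T}. \<forall>p. H\<^sub>1 x t (c *\<^sub>R p) = c * H\<^sub>1 x t p"
    and H1_lipschitz_x: "\<exists>L\<^sub>1>0. \<forall>x y. \<forall>t\<in>{0..T}. \<forall>p. norm p = 1 \<longrightarrow>
          \<bar>H\<^sub>1 x t p - H\<^sub>1 y t p\<bar> \<le> L\<^sub>1 * norm (x - y)"
    and H1_lipschitz_p: "\<exists>L\<^sub>2>0. \<forall>x p q. \<forall>t\<in>{0..T}.
          \<bar>H\<^sub>1 x t p - H\<^sub>1 x t q\<bar> \<le> L\<^sub>2 * norm (p - q)"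
    and H1_bounded: "bdd_above {\<bar>H\<^sub>1 x t p\<bar> | x t p. t \<in> {0..T} \<and> norm p = 1}"
    and beta_lipschitz: "\<exists>L. L-lipschitz_on UNIV \<beta>"
    and beta_mono: "mono \<beta>"
    and beta_bounded: "bounded (range \<beta>)"
    and beta_zero: "\<beta> 0 = 0"
    and beta_pos: "\<forall>r>0. \<beta> r > 0"
    and beta_neg: "\<forall>r<0. \<beta> r < 0"
    and h_modulus: "\<exists>\<omega>. modulus \<omega> \<and> (\<forall>p q. \<bar>h p - h q\<bar> \<le> \<omega> (norm (p - q)))"
    and h_pos: "\<forall>p. norm p < 1 \<longrightarrow> h p > 0"
    and h_neg: "\<forall>p. norm p > 1 \<longrightarrow> h p < 0"
    and w_solution: "viscosity_ivp_solution (\<lambda>x t r p. H\<^sub>1 x t p) T u\<^sub>0 w"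
    and zero_level_nonempty: "\<forall>t\<in>{0..<T}. zero_level w t \<noteq> {}"
    and u_solution: "\<forall>\<theta>>0. viscosity_ivp_solution
          (\<lambda>x t r p. H\<^sub>1 x t p + \<theta> * \<beta> r * h p) T u\<^sub>0 (u \<theta>)"
  shows "(\<forall>x. \<forall>t\<in>{0<..<T}.
            ((\<lambda>(y, s, \<theta>). u \<theta> y s) \<longlongrightarrow> signed_distance w x t)
              (nhds x \<times>\<^sub>F inf (nhds t) (principal {..t}) \<times>\<^sub>F at_top)) \<and>
         (\<forall>t\<in>{0<..<T}.
            locally_uniform_limit UNIV (\<lambda>\<theta> x. u \<theta> x t) (\<lambda>x. signed_distance w x t) at_top) \<and>
         (continuous_on (UNIV \<times> {0<..<T}) (\<lambda>(x, t). signed_distance w x t) \<longrightarrow>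
            locally_uniform_limit (UNIV \<times> {0<..<T})
              (\<lambda>\<theta> (x, t). u \<theta> x t) (\<lambda>(x, t). signed_distance w x t) at_top)"
proof -
  obtain L where L: "L-lipschitz_on UNIV u\<^sub>0" using u0_lipschitz by blast
  obtain L\<^sub>1 where L1: "L\<^sub>1 > 0" "\<And>x y t p. t \<in> {0..T} \<Longrightarrow> norm p = 1 \<Longrightarrow> \<bar>H\<^sub>1 x t p - H\<^sub>1 y t p\<bar> \<le> L\<^sub>1 * norm (x - y)"
    using H1_lipschitz_x by blast
  obtain L\<^sub>2 where L2: "L\<^sub>2 > 0" "\<And>x p q t. t \<in> {0..T} \<Longrightarrow> \<bar>H\<^sub>1 x t p - H\<^sub>1 x t q\<bar> \<le> L\<^sub>2 * norm (p - q)"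
    using H1_lipschitz_p by blast
  obtain bL where bL: "bL-lipschitz_on UNIV \<beta>" using beta_lipschitz by blast
  obtain B where B: "\<And>r. \<bar>\<beta> r\<bar> \<le> B" using beta_bounded by (auto simp: bounded_iff)
  have hom: "H\<^sub>1 x t (c *\<^sub>R p) = c * H\<^sub>1 x t p" if "c > 0" "0 \<le> t" "t \<le> T" for c x t p
    using H1_homogeneous that by simp
  have h_uc: "uniformly_continuous_on UNIV h" using h_modulus modulus_uniformly_continuous by blast
  \<comment> \<open>The bound on unit vectors extends by homogeneity; for \<open>p = 0\<close>,
    homogeneity with factor 2 gives the value 0.\<close>
  have H_x: "\<bar>H\<^sub>1 x t p - H\<^sub>1 y t p\<bar> \<le> L\<^sub>1 * norm (x - y) * norm p" if t: "0 \<le> t" "t \<le> T" for x y t p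
  proof (cases "p = 0")
    case True
    then show ?thesis using hom[of 2 t x 0] hom[of 2 t y 0] t by simp
  next
    case False
    define q where "q = p /\<^sub>R norm p"
    have q: "norm q = 1" "p = norm p *\<^sub>R q" using False by (auto simp: q_def)
    have "H\<^sub>1 z t p = norm p * H\<^sub>1 z t q" for z using hom[of "norm p" t z q] q(2) False t by simp
    then have "\<bar>H\<^sub>1 x t p - H\<^sub>1 y t p\<bar> = norm p * \<bar>H\<^sub>1 x t q - H\<^sub>1 y t q\<bar>"
      by (simp add: abs_mult flip: right_diff_distrib)
    also have "\<dots> \<le> norm p * (L\<^sub>1 * norm (x - y))" using L1(2)[of t q x y] q t by (intro mult_left_mono) auto
    finally show ?thesis by (simp add: mult_ac)
  qed
  have \<beta>c: "continuous_on UNIV \<beta>" and hc: "continuous_on UNIV h"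
    using lipschitz_on_continuous_on[OF bL] uniformly_continuous_imp_continuous[OF h_uc] .
  have opc: "continuous_on {(x, t, r, p). (x, t) \<in> spacetime T} (\<lambda>(x, t, r, p). reinit_op H\<^sub>1 \<beta> h \<theta> x t r p)" for \<theta>
    by (rule reinit_op_continuous[OF H1_continuous \<beta>c hc]) (auto simp: spacetime_def)
  \<comment> \<open>\<open>bL + 1\<close> is used because the locale asks for a positive Lipschitz
    constant of \<open>\<beta>\<close>.\<close>
  interpret reinit T L L\<^sub>1 L\<^sub>2 "bL + 1" B u\<^sub>0 H\<^sub>1 \<beta> h "\<lambda>(x, t). w x t" "\<lambda>\<theta> (x, t). u \<theta> x t"
  proof unfold_locales
    show "0 \<le> L" by (rule lipschitz_on_nonneg[OF L])
    show "0 < bL + 1" using lipschitz_on_nonneg[OF bL] by simp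
    show "\<bar>u\<^sub>0 x - u\<^sub>0 y\<bar> \<le> L * norm (x - y)" for x y using lipschitz_onD[OF L, of x y] by (simp add: dist_norm)
    show "\<bar>\<beta> r - \<beta> s\<bar> \<le> (bL + 1) * \<bar>r - s\<bar>" for r s
      using lipschitz_onD[OF bL, of r s] by (simp add: dist_real_def algebra_simps)
    show "jet_ivp (reinit_op H\<^sub>1 \<beta> h 0) T u\<^sub>0 (\<lambda>(x, t). w x t)"
      by (rule viscosity_ivp_jet_ivp[OF _ opc]) (use w_solution in \<open>simp add: reinit_op_def\<close>)
    show "jet_ivp (reinit_op H\<^sub>1 \<beta> h \<theta>) T u\<^sub>0 (\<lambda>(x, t). u \<theta> x t)" if "\<theta> > 0" for \<theta>
      by (rule viscosity_ivp_jet_ivp[OF _ opc]) (use u_solution that in \<open>simp add: reinit_op_def\<close>)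
  qed (use T_pos L1 L2 B hom H_x H1_continuous h_uc beta_mono beta_zero beta_pos beta_neg h_pos h_neg in auto)
  have sd: "sd x t = signed_distance w x t" for x t by (simp add: sd_def)
  have ne: "zero_level (\<lambda>x t. case (x, t) of (x, t) \<Rightarrow> w x t) t \<noteq> {}" if "0 < t" "t < T" for t
    using zero_level_nonempty that by simp
  have past: "\<exists>\<tau>>0. \<exists>\<theta>0. \<forall>\<theta> y s. \<theta>0 \<le> \<theta> \<longrightarrow> norm (y - x) < \<tau> \<longrightarrow> \<bar>s - t\<bar> < \<tau> \<longrightarrow> s \<le> t \<longrightarrow>
      \<bar>u \<theta> y s - signed_distance w x t\<bar> < e" if "0 < t" "t < T" "e > 0" for x t e
    using past_limit[OF that(1,2) ne[OF that(1,2)] that(3), of x] unfolding sd prod.case by metis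
  have 1: "((\<lambda>(y, s, \<theta>). u \<theta> y s) \<longlongrightarrow> signed_distance w x t)
      (nhds x \<times>\<^sub>F inf (nhds t) (principal {..t}) \<times>\<^sub>F at_top)" if t: "t \<in> {0<..<T}" for x t
  proof (rule tendstoI)
    fix e :: real assume e: "e > 0"
    have t': "0 < t" "t < T" using t by auto
    from past[OF t' e, of x] obtain \<tau> \<theta>0 where \<tau>: "\<tau> > 0" "\<And>\<theta> y s. \<theta>0 \<le> \<theta> \<Longrightarrow> norm (y - x) < \<tau> \<Longrightarrow> \<bar>s - t\<bar> < \<tau> \<Longrightarrow> s \<le> t \<Longrightarrow>
      \<bar>u \<theta> y s - signed_distance w x t\<bar> < e" by blast
    have "\<forall>\<^sub>F y in nhds x. norm (y - x) < \<tau>"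
      using \<tau>(1) by (auto simp: eventually_nhds_metric dist_norm)
    moreover have "\<forall>\<^sub>F s in inf (nhds t) (principal {..t}). \<bar>s - t\<bar> < \<tau> \<and> s \<le> t"
      using \<tau>(1) by (auto simp: eventually_inf_principal eventually_nhds_metric dist_real_def)
    moreover have "\<forall>\<^sub>F \<theta> in at_top. \<theta>0 \<le> \<theta>" by (rule eventually_ge_at_top)
    ultimately have "\<forall>\<^sub>F m in nhds x \<times>\<^sub>F inf (nhds t) (principal {..t}) \<times>\<^sub>F at_top.
       norm (fst m - x) < \<tau> \<and> (\<bar>fst (snd m) - t\<bar> < \<tau> \<and> fst (snd m) \<le> t) \<and> \<theta>0 \<le> snd (snd m)"
      by (intro eventually_prodI)
    then show "\<forall>\<^sub>F m in nhds x \<times>\<^sub>F inf (nhds t) (principal {..t}) \<times>\<^sub>F at_top.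
       dist ((\<lambda>(y, s, \<theta>). u \<theta> y s) m) (signed_distance w x t) < e"
      by eventually_elim (auto simp: dist_real_def split: prod.splits intro: \<tau>(2))
  qed
  \<comment> \<open>The limit from the past includes \<open>s = t\<close>, which gives convergence
    at varying points \<open>y\<close> on the time slice.\<close>
  have 2: "locally_uniform_limit UNIV (\<lambda>\<theta> x. u \<theta> x t) (\<lambda>x. signed_distance w x t) at_top"
    if t: "t \<in> {0<..<T}" for t
  proof (rule locally_uniform_limitI)
    fix x :: "real ^ 'n" and e :: real assume e: "e > 0"
    have t': "0 < t" "t < T" using t by auto
    from past[OF t' e, of x] obtain \<tau> \<theta>0 where \<tau>: "\<tau> > 0" "\<And>\<theta> y s. \<theta>0 \<le> \<theta> \<Longrightarrow> norm (y - x) < \<tau> \<Longrightarrow> \<bar>s - t\<bar> < \<tau> \<Longrightarrow> s \<le> t \<Longrightarrow>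
      \<bar>u \<theta> y s - signed_distance w x t\<bar> < e" by blast
    then show "\<exists>N \<theta>0. open N \<and> x \<in> N \<and> (\<forall>y\<in>N \<inter> UNIV. \<forall>\<theta>\<ge>\<theta>0. dist (u \<theta> y t) (signed_distance w x t) < e)"
      by (intro exI[of _ "ball x \<tau>"] exI[of _ \<theta>0]) (auto simp: dist_norm norm_minus_commute)
  qed
  have 3: "locally_uniform_limit (UNIV \<times> {0<..<T}) (\<lambda>\<theta> (x, t). u \<theta> x t) (\<lambda>(x, t). signed_distance w x t) at_top"
    if c: "continuous_on (UNIV \<times> {0<..<T}) (\<lambda>(x, t). signed_distance w x t)"
  proof (rule locally_uniform_limitI)
    fix z :: "(real ^ 'n) \<times> real" and e :: real assume z: "z \<in> UNIV \<times> {0<..<T}" and e: "e > 0"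
    obtain x t where xt: "z = (x, t)" "0 < t" "t < T" using z by auto
    have c': "continuous_on (UNIV \<times> {0<..<T}) (\<lambda>(x, t). sd x t)" using c by (simp add: sd)
    obtain \<tau> \<theta>0 where \<tau>: "\<tau> > 0" "\<And>\<theta> y s. \<theta>0 \<le> \<theta> \<Longrightarrow> norm (y - x) < \<tau> \<Longrightarrow> \<bar>s - t\<bar> < \<tau> \<Longrightarrow>
      \<bar>u \<theta> y s - signed_distance w x t\<bar> < e"
      using full_limit[OF xt(2,3) ne c' e, of x] unfolding sd prod.case by metis
    show "\<exists>N \<theta>0. open N \<and> z \<in> N \<and> (\<forall>y\<in>N \<inter> UNIV \<times> {0<..<T}. \<forall>\<theta>\<ge>\<theta>0.
        dist (case y of (x, t) \<Rightarrow> u \<theta> x t) (case z of (x, t) \<Rightarrow> signed_distance w x t) < e)"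
      using \<tau> by (intro exI[of _ "ball x \<tau> \<times> ball t \<tau>"] exI[of _ \<theta>0])
        (auto simp: xt(1) open_Times dist_norm norm_minus_commute)
  qed
  show ?thesis using 1 2 3 by blast
qed

end
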